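(* Let $\nu$ be a non-atomic self-similar measure on $\mathbb{R}$ with respect to a self-similar IFS $\Phi=\{f_1,\dots,f_\ell\}$. If $\nu$ is not pointwise absolutely normal, then there exists an invertible affine map $g:\mathbb{R}\to\mathbb{R}$ such that the conjugated IFS $\Psi=\{g^{-1}\circ f_i\circ g\}_{f_i\in\Phi}$ has the following form. There exists an integer $b>1$ such that for every map $h_i(x)=s_i\cdot x+t_i$ in $\Psi$: 1. $\frac{\log|s_i|}{\log b}\in\mathbb{Q}$; and 2. there exist $k_i\in\mathbb{Z}$ and $q_i\in\mathbb{Q}_+$ such that $t_i=\frac{k_i}{b^{q_i}}$.
   Context: A self-similar IFS is a finite collection $\Phi=\{f_1,\dots,f_\ell\}$ of maps $f_i:\mathbb{R}\to\mathbb{R}$, $f_i(x)=s_i x+t_i$, with $s_i\in(-1,1)\setminus\{0\}$ and $t_i\in\mathbb{R}$, leaving some compact interval $J\subseteq\mathbb{R}$ invariant ($f_i(J)\subseteq J$ for all $i$). It is always assumed that the fixed points of $f_i$ and $f_j$ differ for some $i,j$. Given a probability vector $\mathbf{p}=(p_1,\dots,p_\ell)$ with $p_i>0$ for all $i$ and $\sum_i p_i=1$, there is a unique Borel probability measure $\nu$ on $\mathbb{R}$ with $\nu=\sum_{i=1}^{\ell} p_i\, f_i\nu$, where $f_i\nu$ is the push-forward of $\nu$ by $f_i$. Such a $\nu$ is called a self-similar measure with respect to $\Phi$. For an integer $b\ge 2$ let $T_b(x)=b\cdot x \bmod 1$, $x\in\mathbb{R}$, with values in $[0,1)$. A number $x\in\mathbb{R}$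 is $b$-normal (normal to base $b$) if $\frac1N\sum_{n=1}^N\delta_{T_b^n(x)}$ converges in the weak$^*$ sense, as $N\to\infty$, to the Lebesgue measure $\lambda$ on $[0,1]$. It is absolutely normal if it is $b$-normal for every integer $b\ge2$. A measure $\mu$ on $\mathbb{R}$ is pointwise absolutely normal if $\mu$-almost every $x$ is absolutely normal. $\mathbb{Q}_+$ denotes the positive rational numbers. *)

theory Defs
  imports "HOL-Probability.Probability"
begin

section \<open>Self-similar measures on the line\<close>

definition similarity :: "(real \<Rightarrow> real) \<Rightarrow> bool" where
  "similarity h \<longleftrightarrow> (\<exists>s t. -1 < s \<and> s < 1 \<and> s \<noteq> 0 \<and> h = (\<lambda>x. s * x + t))"

text \<open>The maps are \<open>f 1, \<dots>, f l\<close>; values of \<open>f\<close> outside that range play no role. The maps need not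
  be pairwise distinct. The last conjunct is the standing assumption that not all maps share the same
  fixed point.\<close>

definition self_similar_IFS :: "nat \<Rightarrow> (nat \<Rightarrow> real \<Rightarrow> real) \<Rightarrow> bool" where
  "self_similar_IFS l f \<longleftrightarrow>
     (\<forall>i\<in>{1..l}. similarity (f i)) \<and>
     (\<exists>c d. c \<le> d \<and> (\<forall>i\<in>{1..l}. f i ` {c..d} \<subseteq> {c..d})) \<and>
     (\<exists>i\<in>{1..l}. \<exists>j\<in>{1..l}. \<exists>x y. f i x = x \<and> f j y = y \<and> x \<noteq> y)"

definition self_similar_measure :: "nat \<Rightarrow> (nat \<Rightarrow> real \<Rightarrow> real) \<Rightarrow> real measure \<Rightarrow> bool" where
  "self_similar_measure l f \<nu> \<longleftrightarrow>
     real_distribution \<nu> \<and>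
     (\<exists>p :: nat \<Rightarrow> real. (\<forall>i\<in>{1..l}. 0 < p i) \<and> (\<Sum>i=1..l. p i) = 1 \<and>
        (\<forall>A\<in>sets borel. measure \<nu> A = (\<Sum>i=1..l. p i * measure (distr \<nu> borel (f i)) A)))"

definition non_atomic :: "real measure \<Rightarrow> bool" where
  "non_atomic \<mu> \<longleftrightarrow> (\<forall>x. emeasure \<mu> {x} = 0)"

section \<open>Normal numbers\<close>

definition Tmap :: "int \<Rightarrow> real \<Rightarrow> real" where
  "Tmap b x = frac (of_int b * x)"

text \<open>The measure \<open>1/N * (\<delta>\<^bsub>Tmap b x\<^esub> + \<dots> + \<delta>\<^bsub>(Tmap b ^^ N) x\<^esub>)\<close>, as the push-forward of the uniform
  probability on \<open>{1..N}\<close>.  It is meaningful for \<open>N > 0\<close>, which is all that matters for limits.\<close>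

definition empirical_measure :: "int \<Rightarrow> real \<Rightarrow> nat \<Rightarrow> real measure" where
  "empirical_measure b x N = distr (uniform_count_measure {1..N}) borel (\<lambda>n. (Tmap b ^^ n) x)"

text \<open>\<^const>\<open>weak_conv_m\<close> is the library's weak convergence of Borel probability measures on the line;
  the lemma \<open>normal_to_base_iff_continuous\<close> below spells it out as weak* convergence against \<open>C([0,1])\<close>.\<close>

definition normal_to_base :: "int \<Rightarrow> real \<Rightarrow> bool" where
  "normal_to_base b x \<longleftrightarrow> weak_conv_m (empirical_measure b x) (uniform_measure lborel {0..1})"

definition absolutely_normal :: "real \<Rightarrow> bool" where
  "absolutely_normal x \<longleftrightarrow> (\<forall>b\<ge>2. normal_to_base b x)"

definition pointwise_absolutely_normal :: "real measure \<Rightarrow> bool" where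
  "pointwise_absolutely_normal \<mu> \<longleftrightarrow> (AE x in \<mu>. absolutely_normal x)"

lemma integral_empirical_measure:
  fixes \<phi> :: "real \<Rightarrow> real"
  assumes "\<phi> \<in> borel_measurable borel"
  shows "integral\<^sup>L (empirical_measure b x N) \<phi> = (\<Sum>n=1..N. \<phi> ((Tmap b ^^ n) x)) / real N"
  unfolding empirical_measure_def using assms
  by (subst integral_distr)
     (auto simp: uniform_count_measure_def measurable_def space_point_measure sets_point_measure
        lebesgue_integral_point_measure_finite sum_divide_distrib)

lemma real_distribution_empirical_measure: "real_distribution (empirical_measure b x (Suc N))"
proof -
  have "prob_space (uniform_count_measure {1..Suc N})"
    by (rule prob_space_uniform_count_measure) auto
  then have "prob_space (empirical_measure b x (Suc N))"
    unfolding empirical_measure_def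
    by (rule prob_space.prob_space_distr)
       (auto simp: measurable_def space_uniform_count_measure sets_uniform_count_measure)
  then show ?thesis
    by (auto simp: real_distribution_def real_distribution_axioms_def empirical_measure_def)
qed

lemma real_distribution_uniform: "real_distribution (uniform_measure lborel {0..1::real})"
  by (auto simp: real_distribution_def real_distribution_axioms_def intro!: prob_space_uniform_measure)

lemma integral_uniform_01:
  fixes \<phi> :: "real \<Rightarrow> real"
  assumes [measurable]: "\<phi> \<in> borel_measurable borel"
  shows "integral\<^sup>L (uniform_measure lborel {0..1}) \<phi> = (LBINT y:{0..1}. \<phi> y)"
proof -
  have "uniform_measure lborel {0..1::real} = density lborel (\<lambda>x. ennreal (indicator {0..1} x))"
    unfolding uniform_measure_def
    by (intro density_cong) (auto simp: divide_ennreal_def split: split_indicator)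
  then show ?thesis
    by (simp add: set_lebesgue_integral_def integral_density)
qed

lemma Tmap_iterate_in_01:
  assumes "n \<in> {1..N}" shows "(Tmap b ^^ n) x \<in> {0..1}"
  using assms by (cases n) (auto simp: Tmap_def intro: less_imp_le frac_lt_1)

lemma normal_to_base_iff_continuous:
  "normal_to_base b x \<longleftrightarrow>
     (\<forall>\<phi> :: real \<Rightarrow> real. continuous_on {0..1} \<phi> \<longrightarrow>
        (\<lambda>N. (\<Sum>n=1..N. \<phi> ((Tmap b ^^ n) x)) / real N) \<longlonglongrightarrow> (LBINT y:{0..1}. \<phi> y))"
proof -
  let ?M = "\<lambda>N. empirical_measure b x (Suc N)" and ?U = "uniform_measure lborel {0..1::real}"
  have shift: "normal_to_base b x \<longleftrightarrow> weak_conv_m ?M ?U"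
    unfolding normal_to_base_def weak_conv_m_def weak_conv_def
    by (subst filterlim_sequentially_Suc[symmetric]) simp
  show ?thesis
    unfolding shift
  proof (intro iffI allI impI)
    fix \<phi> :: "real \<Rightarrow> real"
    assume wc: "weak_conv_m ?M ?U" and cont: "continuous_on {0..1} \<phi>"
    define \<psi> where "\<psi> y = \<phi> (max 0 (min 1 y))" for y
    have psi: "\<psi> y = \<phi> y" if "y \<in> {0..1}" for y
      using that by (auto simp: \<psi>_def max_def min_def)
    have cont': "continuous_on UNIV \<psi>"
      unfolding \<psi>_def by (intro continuous_on_compose2[OF cont] continuous_intros) auto
    have [measurable]: "\<psi> \<in> borel_measurable borel"
      using cont' by (rule borel_measurable_continuous_onI)
    obtain B where B: "\<And>y. y \<in> {0..1} \<Longrightarrow> norm (\<phi> y) \<le> B"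
      using compact_imp_bounded[OF compact_continuous_image[OF cont compact_Icc]]
      unfolding bounded_iff by blast
    have "(\<lambda>N. integral\<^sup>L (?M N) \<psi>) \<longlonglongrightarrow> integral\<^sup>L ?U \<psi>"
    proof (rule weak_conv_imp_integral_bdd_continuous_conv[OF _ real_distribution_uniform wc])
      show "isCont \<psi> y" for y
        using cont' by (simp add: continuous_on_eq_continuous_at)
      show "norm (\<psi> y) \<le> B" for y
        unfolding \<psi>_def by (rule B) auto
    qed (rule real_distribution_empirical_measure)
    moreover have "integral\<^sup>L ?U \<psi> = (LBINT y:{0..1}. \<phi> y)"
      by (simp add: integral_uniform_01) (intro set_lebesgue_integral_cong, auto simp: psi)
    moreover have "integral\<^sup>L (empirical_measure b x N) \<psi> = (\<Sum>n=1..N. \<phi> ((Tmap b ^^ n) x)) / real N" for N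
      by (simp add: integral_empirical_measure)
         (auto intro!: arg_cong2[where f = "(/)"] sum.cong psi Tmap_iterate_in_01[of _ N, simplified])
    ultimately show "(\<lambda>N. (\<Sum>n=1..N. \<phi> ((Tmap b ^^ n) x)) / real N) \<longlonglongrightarrow> (LBINT y:{0..1}. \<phi> y)"
      using filterlim_sequentially_Suc[of "\<lambda>N. (\<Sum>n=1..N. \<phi> ((Tmap b ^^ n) x)) / real N"] by simp
  next
    assume *: "\<forall>\<phi> :: real \<Rightarrow> real. continuous_on {0..1} \<phi> \<longrightarrow>
        (\<lambda>N. (\<Sum>n=1..N. \<phi> ((Tmap b ^^ n) x)) / real N) \<longlonglongrightarrow> (LBINT y:{0..1}. \<phi> y)"
    show "weak_conv_m ?M ?U"
    proof (rule integral_bdd_continuous_conv_imp_weak_conv[OF real_distribution_empirical_measure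
          real_distribution_uniform])
      fix \<phi> :: "real \<Rightarrow> real"
      assume "\<And>y. isCont \<phi> y"
      then have cont: "continuous_on A \<phi>" for A
        by (simp add: continuous_at_imp_continuous_on)
      have m: "\<phi> \<in> borel_measurable borel"
        using cont by (rule borel_measurable_continuous_onI)
      have "(\<lambda>N. integral\<^sup>L (empirical_measure b x N) \<phi>) \<longlonglongrightarrow> integral\<^sup>L ?U \<phi>"
        using *[rule_format, OF cont]
        by (simp add: integral_empirical_measure[OF m] integral_uniform_01[OF m])
      then show "(\<lambda>N. integral\<^sup>L (?M N) \<phi>) \<longlonglongrightarrow> integral\<^sup>L ?U \<phi>"
        by (rule filterlim_sequentially_Suc[THEN iffD2])
    qed
  qed
qed

end

theory Submission
  imports Defs
begin

text \<open>
  Let \<open>x = code \<omega>\<close> be coded by an i.i.d. sequence, and let \<open>L\<close> be minus the logarithm to base \<open>b\<close> of the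
  contraction of a word. For a frequency \<open>k \<noteq> 0\<close> the Weyl sum of \<open>exp (2 \<pi> i k b ^ n x)\<close> over \<open>n < N\<close> is cut
  into blocks according to the last letter needed to resolve the scale \<open>b ^ - n\<close>. Up to a martingale, which
  is negligible by a second moment argument, the block of the \<open>m\<close>-th letter is bounded by finitely many values
  \<open>G (b powr (j + frac (- L w)))\<close>, where \<open>G\<close> is the modulus of the Fourier transform, \<open>w\<close> is the prefix of
  length \<open>m\<close>, and \<open>j\<close> is as large as we please.

  If no nonzero integer multiple of \<open>L\<close> is integral on all maps, then \<open>L w\<close> equidistributes modulo \<open>1\<close> along
  almost every sequence, and the average of \<open>G\<close> tends to \<open>0\<close> with \<open>j\<close> because there are no atoms (Wiener).

  Otherwise \<open>L\<close> takes values in \<open>\<int> / q\<close>, and only the numbers \<open>\<phi> x = G (b powr (x / q))\<close> matter. Self-similarity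
  makes \<open>\<phi>\<^sup>2\<close> subharmonic for a random walk on the integers, with a defect equal to a variance. Hence either
  \<open>\<phi>\<close> tends to \<open>0\<close>, or \<open>\<phi>\<close> stays away from \<open>0\<close> along an arithmetic progression while the variance tends to
  \<open>0\<close>. In the latter case the phases of the words \<open>ij\<close> and \<open>ji\<close>, which have the same contraction,
  agree asymptotically, so that \<open>k D b powr (x / q)\<close> approaches the integers along the progression for the
  difference \<open>D\<close> of their translation parts. As \<open>b\<close> is an integer, it then is an integer eventually. Placing
  the fixed point of one map at the origin turns the differences \<open>D\<close> into the translation parts.
\<close>

section \<open>Weyl sums and equidistribution\<close>

definition echar :: "real \<Rightarrow> complex" where
  "echar x = cis (2 * pi * x)"

lemma norm_echar [simp]: "norm (echar x) = 1"
  by (simp add: echar_def)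

lemma echar_0 [simp]: "echar 0 = 1"
  by (simp add: echar_def)

lemma echar_add: "echar (x + y) = echar x * echar y"
  by (simp add: echar_def cis_mult distrib_left)

lemma continuous_on_echar [continuous_intros]:
  "continuous_on A f \<Longrightarrow> continuous_on A (\<lambda>x. echar (f x))"
  unfolding echar_def cis_conv_exp by (intro continuous_intros)

lemma echar_of_int [simp]: "echar (of_int n) = 1"
  using cos_int_2pin[of n] sin_int_2pin[of n] by (simp add: echar_def complex_eq_iff)

lemma echar_frac: "echar (of_int j * frac x) = echar (of_int j * x)"
proof -
  have "echar (of_int j * x) = echar (of_int (j * \<lfloor>x\<rfloor>)) * echar (of_int j * frac x)"
    by (subst echar_add[symmetric]) (simp add: frac_def algebra_simps)
  then show ?thesis by (simp only: echar_of_int mult_1_left)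
qed

section \<open>Trigonometric polynomials and their density in the continuous periodic
  functions\<close>

inductive trig_poly :: "(real \<Rightarrow> complex) \<Rightarrow> bool" where
  trig_poly_monom: "trig_poly (\<lambda>x. c * echar (of_int j * x))"
| trig_poly_add: "trig_poly f \<Longrightarrow> trig_poly g \<Longrightarrow> trig_poly (\<lambda>x. f x + g x)"

lemma trig_poly_mult:
  assumes "trig_poly f" "trig_poly g"
  shows "trig_poly (\<lambda>x. f x * g x)"
  using assms
proof (induction f)
  case (trig_poly_monom c j)
  from trig_poly_monom.prems show ?case
  proof (induction g)
    case (trig_poly_monom d k)
    have "trig_poly (\<lambda>x. (c * d) * echar (of_int (j + k) * x))"
      by (rule trig_poly.trig_poly_monom)
    also have "(\<lambda>x. (c * d) * echar (of_int (j + k) * x)) =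
        (\<lambda>x. (c * echar (of_int j * x)) * (d * echar (of_int k * x)))"
      by (simp add: fun_eq_iff distrib_right echar_add)
    finally show ?case .
  next
    case (trig_poly_add f g)
    then show ?case
      using trig_poly.trig_poly_add by (simp add: distrib_left)
  qed
next
  case (trig_poly_add f g)
  then show ?case
    using trig_poly.trig_poly_add by (simp add: distrib_right)
qed

text \<open>On the unit circle the conjugate of \<open>echar x\<close> is
  \<open>echar (- x)\<close>, so a real-linear functional of \<open>echar x\<close> is a combination
  of two characters; sums and products preserve the class. This makes the real Stone-Weierstrass
  theorem usable on the circle.\<close>

lemma trig_poly_real_polynomial_function:
  fixes h :: "complex \<Rightarrow> real"
  assumes "real_polynomial_function h"
  shows "trig_poly (\<lambda>x. of_real (h (echar x)))"
  using assms
proof induction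
  case (linear h)
  then interpret bounded_linear h .
  have h: "h z = Re z * h 1 + Im z * h \<i>" for z
  proof -
    have "z = Re z *\<^sub>R 1 + Im z *\<^sub>R \<i>"
      by (simp add: complex_eq_iff)
    then have "h z = h (Re z *\<^sub>R 1 + Im z *\<^sub>R \<i>)" by simp
    then show ?thesis by (simp only: add scaleR) simp
  qed
  \<comment> \<open>The coefficient with \<open>h z = c * z + cnj c * cnj z\<close>, that is,
    \<open>h z\<close> is twice the real part of \<open>c * z\<close>.\<close>
  define c where "c = Complex (h 1) (- h \<i>) / 2"
  have "of_real (h (echar x)) = c * echar (of_int 1 * x) + cnj c * echar (of_int (-1) * x)" for x
    unfolding h[of "echar x"] by (simp add: complex_eq_iff echar_def c_def field_simps)
  moreover have "trig_poly (\<lambda>x. c * echar (of_int 1 * x) + cnj c * echar (of_int (-1) * x))"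
    by (intro trig_poly.intros)
  ultimately show ?case by simp
next
  case (const c)
  show ?case using trig_poly_monom[of "of_real c" 0] by simp
next
  case (add f g)
  then show ?case using trig_poly.trig_poly_add by simp
next
  case (mult f g)
  then show ?case using trig_poly_mult by simp
qed

lemma echar_surj:
  assumes "norm z = 1"
  obtains x where "x \<in> {0..1}" "z = echar x"
proof
  show "Arg2pi z / (2 * pi) \<in> {0..1}"
    using Arg2pi_ge_0[of z] Arg2pi_lt_2pi[of z] by (auto simp: field_simps)
  show "z = echar (Arg2pi z / (2 * pi))"
    using Arg2pi_eq[of z] assms by (simp add: echar_def cis_conv_exp)
qed

lemma echar_eq_iff: "echar x = echar y \<longleftrightarrow> x - y \<in> \<int>"
proof -
  have "echar x = echar y \<longleftrightarrow> (\<exists>n::int. x - y = of_int n)"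
  proof -
    have "echar x = echar y \<longleftrightarrow> (\<exists>n::int. 2 * pi * x = 2 * pi * y + of_int (2 * n) * pi)"
      unfolding echar_def cis_conv_exp exp_eq by (simp add: complex_eq_iff)
    also have "\<dots> \<longleftrightarrow> (\<exists>n::int. x - y = of_int n)"
    proof (rule ex_cong1)
      fix n :: int
      have "2 * pi * x = 2 * pi * y + of_int (2 * n) * pi \<longleftrightarrow> (2 * pi) * x = (2 * pi) * (y + of_int n)"
        by (simp add: algebra_simps)
      also have "\<dots> \<longleftrightarrow> x - y = of_int n"
        by (subst mult_cancel_left) auto
      finally show "2 * pi * x = 2 * pi * y + of_int (2 * n) * pi \<longleftrightarrow> x - y = of_int n" .
    qed
    finally show ?thesis .
  qed
  then show ?thesis by (auto elim: Ints_cases)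
qed

text \<open>Stone-Weierstrass is applied on the circle rather than on the interval:
  \<open>\<phi> 0 = \<phi> 1\<close> lets \<open>\<phi>\<close> descend to a continuous function on
  the unit circle.\<close>

lemma trig_poly_dense:
  fixes \<phi> :: "real \<Rightarrow> real"
  assumes cont: "continuous_on {0..1} \<phi>" and per: "\<phi> 0 = \<phi> 1" and "0 < e"
  obtains p where "trig_poly p" "\<And>x. x \<in> {0..1} \<Longrightarrow> norm (of_real (\<phi> x) - p x) < e"
proof -
  \<comment> \<open>The choice of the angle is harmless: \<open>0\<close> and \<open>1\<close> are
    the only distinct points of \<open>{0..1}\<close> with the same image, and \<open>\<phi>\<close>
    agrees there.\<close>
  define F where "F z = \<phi> (SOME x. x \<in> {0..1} \<and> z = echar x)" for z
  have F: "F (echar x) = \<phi> x" if "x \<in> {0..1}" for x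
  proof -
    define y where "y = (SOME y. y \<in> {0..1} \<and> echar x = echar y)"
    have y: "y \<in> {0..1} \<and> echar x = echar y"
      unfolding y_def by (rule someI[of _ x]) (use that in auto)
    then obtain n :: int where n: "x - y = of_int n"
      using echar_eq_iff by (auto elim: Ints_cases)
    have "\<bar>x - y\<bar> \<le> 1" using that y by auto
    then have "n = 0 \<or> n = 1 \<or> n = -1" unfolding n by linarith
    then have "x = y \<or> x = 0 \<and> y = 1 \<or> x = 1 \<and> y = 0"
      using that y n by auto
    then have "\<phi> x = \<phi> y" using per by auto
    then show ?thesis by (simp add: F_def y_def)
  qed
  \<comment> \<open>The angle is not a continuous function on the whole circle. Instead, the
    preimage of a closed set under \<open>F\<close> is the image under \<open>echar\<close> of a
    compact subset of \<open>{0..1}\<close>.\<close>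
  have "continuous_on (sphere 0 1) F"
  proof (rule continuous_on_closed_vimage[THEN iffD2, rule_format])
    fix C :: "real set" assume "closed C"
    have "F -` C \<inter> sphere 0 1 = echar ` {x\<in>{0..1}. \<phi> x \<in> C}"
      using echar_surj by (force simp: F)
    moreover have "compact {x\<in>{0..1}. \<phi> x \<in> C}"
      using continuous_closed_preimage[OF cont _ \<open>closed C\<close>]
      by (auto simp: compact_eq_bounded_closed vimage_def Int_def conj_commute intro: bounded_subset[of "{0..1}"])
    ultimately show "closed (F -` C \<inter> sphere 0 1)"
      by (auto intro!: compact_imp_closed compact_continuous_image continuous_intros)
  qed simp
  then obtain h where h: "real_polynomial_function h" "\<And>z. z \<in> sphere 0 1 \<Longrightarrow> \<bar>F z - h z\<bar> < e"
    using Stone_Weierstrass_real_polynomial_function[OF compact_sphere _ \<open>0 < e\<close>] by metis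
  show ?thesis
  proof
    show "trig_poly (\<lambda>x. of_real (h (echar x)))"
      by (rule trig_poly_real_polynomial_function) fact
    show "norm (of_real (\<phi> x) - complex_of_real (h (echar x))) < e" if "x \<in> {0..1}" for x
      using h(2)[of "echar x"] that by (simp add: F flip: of_real_diff)
  qed
qed

section \<open>Weyl's criterion for equidistribution modulo one\<close>

definition weyl_null :: "(nat \<Rightarrow> real) \<Rightarrow> bool" where
  "weyl_null x \<longleftrightarrow>
     (\<forall>j::int. j \<noteq> 0 \<longrightarrow> (\<lambda>N. (\<Sum>n<N. echar (of_int j * x n)) / of_nat N) \<longlonglongrightarrow> 0)"

lemma has_integral_echar:
  assumes "j \<noteq> 0"
  shows "((\<lambda>x. echar (of_int j * x)) has_integral 0) {0..1}"
proof -
  define a where "a = 2 * of_real pi * of_int j * \<i>"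
  have a: "a \<noteq> 0" using assms by (simp add: a_def)
  have "((\<lambda>x. echar (of_int j * x) / a) has_vector_derivative echar (of_int j * x)) (at x within {0..1})" for x
  proof -
    have "((\<lambda>z. exp (a * z) / a) has_field_derivative exp (a * of_real x)) (at (of_real x))"
      using a by (auto intro!: derivative_eq_intros)
    then have "((\<lambda>x. exp (a * of_real x) / a) has_vector_derivative exp (a * of_real x)) (at x within {0..1})"
      by (rule has_vector_derivative_real_field)
    then show ?thesis
      by (simp add: echar_def cis_conv_exp a_def mult_ac)
  qed
  from fundamental_theorem_of_calculus[OF _ this]
  show ?thesis by (simp add: echar_of_int[of j, simplified])
qed

text \<open>By linearity a single frequency suffices. A nonzero one has integral \<open>0\<close>
  and, by hypothesis, averages tending to \<open>0\<close>; integer frequencies do not see the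
  difference between \<open>x n\<close> and its fractional part.\<close>

lemma weyl_trig_poly:
  assumes "weyl_null x" "trig_poly p"
  shows "\<exists>I. (p has_integral I) {0..1} \<and> (\<lambda>N. (\<Sum>n<N. p (frac (x n))) / of_nat N) \<longlonglongrightarrow> I"
  using assms(2)
proof induction
  case (trig_poly_monom c j)
  show ?case
  proof (cases "j = 0")
    case True
    \<comment> \<open>At \<open>N = 0\<close> the quotient is \<open>0\<close>, so the average
      equals \<open>c\<close> only eventually.\<close>
    have "(\<lambda>N. (\<Sum>n<N. c) / of_nat N) \<longlonglongrightarrow> c"
      by (rule Lim_transform_eventually[OF tendsto_const])
         (use eventually_gt_at_top[of 0] in eventually_elim, simp)
    moreover have "((\<lambda>x::real. c) has_integral c) {0..1}"
      using has_integral_const_real[of c 0 1] by simp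
    ultimately show ?thesis using True by auto
  next
    case False
    have "(\<lambda>N. c * ((\<Sum>n<N. echar (of_int j * x n)) / of_nat N)) \<longlonglongrightarrow> c * 0"
      by (intro tendsto_intros) (use assms(1) False in \<open>simp add: weyl_null_def\<close>)
    then have "(\<lambda>N. (\<Sum>n<N. c * echar (of_int j * frac (x n))) / of_nat N) \<longlonglongrightarrow> 0"
      by (simp add: echar_frac sum_distrib_left)
    moreover have "((\<lambda>x. c * echar (of_int j * x)) has_integral c * 0) {0..1}"
      by (intro has_integral_mult_right has_integral_echar False)
    ultimately show ?thesis by auto
  qed
next
  case (trig_poly_add f g)
  then obtain I J where "(f has_integral I) {0..1}" "(\<lambda>N. (\<Sum>n<N. f (frac (x n))) / of_nat N) \<longlonglongrightarrow> I"
    "(g has_integral J) {0..1}" "(\<lambda>N. (\<Sum>n<N. g (frac (x n))) / of_nat N) \<longlonglongrightarrow> J" by auto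
  from has_integral_add[OF this(1,3)] tendsto_add[OF this(2,4)] show ?case
    by (auto simp: sum.distrib add_divide_distrib)
qed

lemma frac_in_unit [simp]: "frac x \<in> {0..1}"
  using frac_lt_1[of x] by (auto intro: less_imp_le)

lemma weyl_periodic:
  fixes \<phi> :: "real \<Rightarrow> real"
  assumes x: "weyl_null x" and cont: "continuous_on {0..1} \<phi>" and per: "\<phi> 0 = \<phi> 1"
  shows "(\<lambda>N. (\<Sum>n<N. \<phi> (frac (x n))) / real N) \<longlonglongrightarrow> integral {0..1} \<phi>"
proof (rule LIMSEQ_I)
  fix e :: real assume e: "e > 0"
  obtain p where p: "trig_poly p" "\<And>x. x \<in> {0..1} \<Longrightarrow> norm (of_real (\<phi> x) - p x) < e / 4"
    using trig_poly_dense[OF cont per, of "e / 4"] e by auto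
  obtain I where I: "(p has_integral I) {0..1}"
    and lim: "(\<lambda>N. (\<Sum>n<N. p (frac (x n))) / of_nat N) \<longlonglongrightarrow> I"
    using weyl_trig_poly[OF x p(1)] by auto
  have int: "((\<lambda>x. complex_of_real (\<phi> x)) has_integral of_real (integral {0..1} \<phi>)) {0..1}"
    using has_integral_of_real[OF integrable_integral[OF integrable_continuous_real[OF cont]]] .
  have dI: "norm (of_real (integral {0..1} \<phi>) - I) \<le> e / 4"
    using has_integral_bound_real[OF _ finite.emptyI has_integral_diff[OF int I], of "e / 4"] p(2) e 
    by (simp add: less_imp_le)
  obtain N0 where N0: "\<And>N. N \<ge> N0 \<Longrightarrow> norm ((\<Sum>n<N. p (frac (x n))) / of_nat N - I) < e / 4"
    using LIMSEQ_D[OF lim, of "e / 4"] e by auto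
  show "\<exists>no. \<forall>N\<ge>no. norm ((\<Sum>n<N. \<phi> (frac (x n))) / real N - integral {0..1} \<phi>) < e"
  proof (intro exI allI impI)
    fix N assume N: "N \<ge> max 1 N0"
    let ?A = "(\<Sum>n<N. \<phi> (frac (x n))) / real N" and ?P = "(\<Sum>n<N. p (frac (x n))) / of_nat N"
    have "of_real ?A - ?P = (\<Sum>n<N. of_real (\<phi> (frac (x n))) - p (frac (x n))) / of_nat N"
      by (simp add: sum_subtractf diff_divide_distrib)
    also have "norm \<dots> \<le> (\<Sum>n<N. e / 4) / N"
      unfolding norm_divide norm_of_nat
      by (intro divide_right_mono sum_norm_le p(2)[THEN less_imp_le] frac_in_unit) auto
    also have "\<dots> = e / 4" using N by (simp add: field_simps)
    finally have 1: "norm (of_real ?A - ?P) \<le> e / 4" .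
    have "norm (complex_of_real (?A - integral {0..1} \<phi>))
        = norm ((of_real ?A - ?P) + (?P - I) + (I - of_real (integral {0..1} \<phi>)))" by simp
    also have "\<dots> \<le> norm (of_real ?A - ?P) + norm (?P - I) + norm (I - of_real (integral {0..1} \<phi>))"
      by (meson add_mono norm_triangle_ineq order_refl order_trans)
    also have "\<dots> < e"
      using 1 N0[of N] N dI e by (simp add: norm_minus_commute)
    finally show "norm (?A - integral {0..1} \<phi>) < e"
      by (simp only: norm_of_real real_norm_def)
  qed
qed

text \<open>Endpoint values are equalised by adding a multiple of a high power
  \<open>y ^ Suc m\<close>. The change is dominated by a multiple of \<open>\<zeta>\<close>, which
  has equal endpoint values itself and a small integral, so that the periodic case controls both
  pieces.\<close>

lemma weyl_equidistribution:
  fixes \<phi> :: "real \<Rightarrow> real"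
  assumes x: "weyl_null x" and cont: "continuous_on {0..1} \<phi>"
  shows "(\<lambda>N. (\<Sum>n<N. \<phi> (frac (x n))) / real N) \<longlonglongrightarrow> integral {0..1} \<phi>"
proof (rule LIMSEQ_I)
  fix e :: real assume e: "e > 0"
  define A where "A = \<bar>\<phi> 0 - \<phi> 1\<bar> + 1"
  have A: "A > 0" by (simp add: A_def)
  \<comment> \<open>Large enough for \<open>A * (2 / (m + 2)) \<le> e / 3\<close>, where
    \<open>2 / (m + 2)\<close> is the integral of \<open>\<zeta>\<close>.\<close>
  obtain m :: nat where m: "A * 6 / e < m"
    using reals_Archimedean2 by blast
  define \<phi>' where "\<phi>' y = \<phi> y + (\<phi> 0 - \<phi> 1) * y ^ Suc m" for y
  \<comment> \<open>The mirrored summand makes the majorant itself take equal values at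
    \<open>0\<close> and \<open>1\<close>, as \<open>weyl_periodic\<close> demands.\<close>
  define \<zeta> where "\<zeta> y = y ^ Suc m + (1 - y) ^ Suc m" for y :: real
  have \<phi>': "continuous_on {0..1} \<phi>'" "\<phi>' 0 = \<phi>' 1"
    unfolding \<phi>'_def by (auto intro!: continuous_intros cont)
  have \<zeta>: "continuous_on {0..1} \<zeta>" "\<zeta> 0 = \<zeta> 1"
    unfolding \<zeta>_def by (auto intro!: continuous_intros)
  have close: "\<bar>\<phi> y - \<phi>' y\<bar> \<le> A * \<zeta> y" if "y \<in> {0..1}" for y
  proof -
    have "\<bar>\<phi> y - \<phi>' y\<bar> = \<bar>\<phi> 0 - \<phi> 1\<bar> * y ^ Suc m"
      using that by (simp add: \<phi>'_def abs_mult power_abs)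
    also have "\<dots> \<le> A * \<zeta> y"
      using that by (intro mult_mono) (auto simp: A_def \<zeta>_def)
    finally show ?thesis .
  qed
  have "(\<zeta> has_integral 2 / (m + 2)) {0..1}"
  proof -
    have "((\<lambda>y. (y ^ Suc (Suc m) - (1 - y) ^ Suc (Suc m)) / (m + 2)) has_real_derivative \<zeta> y)
        (at y within {0..1})" for y
    proof -
      have "((\<lambda>y. y ^ Suc (Suc m) - (1 - y) ^ Suc (Suc m)) has_real_derivative
          real (m + 2) * \<zeta> y) (at y within {0..1})"
        unfolding \<zeta>_def
        by (rule derivative_eq_intros refl)+ (simp add: distrib_left)
      from DERIV_cdivide[OF this, of "real (m + 2)"] show ?thesis by simp
    qed
    from fundamental_theorem_of_calculus[OF _ this[unfolded has_real_derivative_iff_has_vector_derivative]]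
    show ?thesis by simp
  qed
  then have "integral {0..1} \<zeta> = 2 / (m + 2)"
    by (rule integral_unique)
  moreover have "A * 6 \<le> e * (m + 2)"
    using m e by (simp add: field_simps)
  then have "A * (2 / (m + 2)) \<le> e / 3"
    by (simp add: field_simps)
  ultimately have I\<zeta>: "A * integral {0..1} \<zeta> \<le> e / 3"
    by simp
  have Idiff: "\<bar>integral {0..1} \<phi> - integral {0..1} \<phi>'\<bar> \<le> A * integral {0..1} \<zeta>"
  proof -
    have "norm (integral {0..1} (\<lambda>y. \<phi> y - \<phi>' y)) \<le> integral {0..1} (\<lambda>y. A * \<zeta> y)"
      by (intro integral_norm_bound_integral integrable_continuous_real continuous_intros cont \<phi>' \<zeta>)
         (use close in auto)
    then show ?thesis
      by (simp add: integral_diff integrable_continuous_real cont \<phi>')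
  qed
  have "(\<lambda>N. (\<Sum>n<N. \<phi>' (frac (x n))) / real N) \<longlonglongrightarrow> integral {0..1} \<phi>'"
    by (intro weyl_periodic x \<phi>')
  from LIMSEQ_D[OF this, of "e / 6"] obtain N1 where
    N1: "\<And>N. N \<ge> N1 \<Longrightarrow> \<bar>(\<Sum>n<N. \<phi>' (frac (x n))) / real N - integral {0..1} \<phi>'\<bar> < e / 6" 
    using e by auto
  have "(\<lambda>N. A * ((\<Sum>n<N. \<zeta> (frac (x n))) / real N)) \<longlonglongrightarrow> A * integral {0..1} \<zeta>"
    by (intro tendsto_intros weyl_periodic x \<zeta>)
  from LIMSEQ_D[OF this, of "e / 6"] obtain N2 where
    N2: "\<And>N. N \<ge> N2 \<Longrightarrow> \<bar>A * ((\<Sum>n<N. \<zeta> (frac (x n))) / real N) - A * integral {0..1} \<zeta>\<bar> < e / 6" 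
    using e by auto
  show "\<exists>no. \<forall>N\<ge>no. norm ((\<Sum>n<N. \<phi> (frac (x n))) / real N - integral {0..1} \<phi>) < e"
  proof (intro exI allI impI)
    fix N assume N: "N \<ge> max N1 N2"
    have "\<bar>(\<Sum>n<N. \<phi> (frac (x n))) / real N - (\<Sum>n<N. \<phi>' (frac (x n))) / real N\<bar>
        = \<bar>\<Sum>n<N. \<phi> (frac (x n)) - \<phi>' (frac (x n))\<bar> / real N"
      by (simp add: sum_subtractf diff_divide_distrib[symmetric] abs_divide)
    also have "\<dots> \<le> (\<Sum>n<N. A * \<zeta> (frac (x n))) / real N"
      by (intro divide_right_mono order_trans[OF sum_abs] sum_mono close frac_in_unit) auto
    also have "\<dots> = A * ((\<Sum>n<N. \<zeta> (frac (x n))) / real N)"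
      by (simp add: sum_distrib_left)
    also have "\<dots> \<le> e / 3 + e / 6"
      using N2[of N] N I\<zeta> unfolding real_norm_def by linarith
    finally show "norm ((\<Sum>n<N. \<phi> (frac (x n))) / real N - integral {0..1} \<phi>) < e"
      using N1[of N] N Idiff I\<zeta> unfolding real_norm_def by linarith
  qed
qed

section \<open>Averages of weakly correlated variables\<close>

text \<open>Let \<open>q\<close> be the integer part of \<open>sqrt N\<close>. Between
  \<open>q ^ 2\<close> and \<open>N\<close> there are at most \<open>2 * q\<close> terms, so
  \<open>S\<close> changes by at most \<open>2 * C * q\<close>, which is negligible against
  \<open>q ^ 2 \<le> N\<close>.\<close>

lemma square_lacunary:
  fixes S :: "nat \<Rightarrow> 'a::real_normed_vector" and C :: real
  assumes lim: "(\<lambda>j. norm (S (j\<^sup>2)) / real (j\<^sup>2)) \<longlonglongrightarrow> 0"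
    and lip: "\<And>m n. m \<le> n \<Longrightarrow> norm (S n - S m) \<le> C * real (n - m)"
  shows "(\<lambda>N. norm (S N) / real N) \<longlonglongrightarrow> 0"
proof -
  have C: "0 \<le> C" using order_trans[OF norm_ge_zero lip[of 0 1]] by simp
  define q where "q N = nat \<lfloor>sqrt (real N)\<rfloor>" for N
  have qreal: "real (q N) \<le> sqrt N" "sqrt N < real (q N) + 1" for N
    unfolding q_def using real_of_int_floor_add_one_gt[of "sqrt (real N)"]
    by (simp_all add: of_nat_floor add.commute)
  have q: "(q N)\<^sup>2 \<le> N" "N \<le> (q N)\<^sup>2 + 2 * q N" for N
  proof -
    have "real (q N) ^ 2 \<le> sqrt N ^ 2"
      by (intro power_mono qreal) auto
    then show "(q N)\<^sup>2 \<le> N" by (simp flip: of_nat_power)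
    have "sqrt N ^ 2 < (real (q N) + 1)^2"
      by (intro power_strict_mono qreal) auto
    then have "real N < real ((q N + 1)\<^sup>2)" by (simp add: add.commute)
    then show "N \<le> (q N)\<^sup>2 + 2 * q N" by (simp only: of_nat_less_iff power2_eq_square) simp
  qed
  have filt: "filterlim q at_top sequentially"
    unfolding filterlim_at_top
  proof
    fix Z :: nat
    show "\<forall>\<^sub>F N in sequentially. Z \<le> q N"
      using eventually_ge_at_top[of "Z\<^sup>2"]
    proof eventually_elim
      case (elim N)
      then have "real Z ^ 2 \<le> N" by (simp flip: of_nat_power)
      then have "real Z \<le> sqrt N" by (rule real_le_rsqrt)
      then show ?case unfolding q_def by (simp add: le_nat_floor)
    qed
  qed
  have l1: "(\<lambda>N. norm (S ((q N)\<^sup>2)) / real ((q N)\<^sup>2)) \<longlonglongrightarrow> 0"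
    using filterlim_compose[OF lim filt] .
  have l2: "(\<lambda>N. 2 * C / real (q N)) \<longlonglongrightarrow> 0"
    by (intro real_tendsto_divide_at_top[OF tendsto_const] filterlim_compose[OF filterlim_real_sequentially filt])
  have "\<forall>\<^sub>F N in sequentially. norm (norm (S N) / real N) \<le>
      norm (S ((q N)\<^sup>2)) / real ((q N)\<^sup>2) + 2 * C / real (q N)"
    using filterlim_at_top[THEN iffD1, OF filt, rule_format, of 1]
  proof eventually_elim
    case (elim N)
    let ?q = "q N"
    have q0: "real ?q > 0" using elim by simp
    have qN: "real (?q\<^sup>2) \<le> N" using q(1)[of N] by linarith
    then have N0: "real N > 0" using q0 by (meson less_le_trans of_nat_0_less_iff zero_less_power)
    have "norm (S N) \<le> norm (S (?q\<^sup>2)) + norm (S N - S (?q\<^sup>2))"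
      by (metis norm_triangle_sub)
    also have "norm (S N - S (?q\<^sup>2)) \<le> C * real (N - ?q\<^sup>2)" by (rule lip) (rule q)
    also have "\<dots> \<le> C * (2 * ?q)" using q(2)[of N] C by (intro mult_left_mono) linarith+
    finally have "norm (S N) / N \<le> (norm (S (?q\<^sup>2)) + C * (2 * ?q)) / N"
      by (intro divide_right_mono) auto
    also have "\<dots> \<le> (norm (S (?q\<^sup>2)) + C * (2 * ?q)) / real (?q\<^sup>2)"
      by (intro divide_left_mono qN add_nonneg_nonneg mult_nonneg_nonneg C mult_pos_pos) (use q0 N0 in auto)
    also have "\<dots> = norm (S (?q\<^sup>2)) / real (?q\<^sup>2) + 2 * C / ?q"
      using q0 by (simp add: add_divide_distrib power2_eq_square)
    finally show ?case using N0 by simp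
  qed
  from Lim_null_comparison[OF this] show ?thesis
    using tendsto_add[OF l1 l2] by simp
qed

text \<open>Each row splits at the diagonal into two geometric sums, each at most
  \<open>1 / (1 - r)\<close>.\<close>

lemma sum_geometric_pairs:
  fixes r :: real
  assumes r: "0 \<le> r" "r < 1"
  shows "(\<Sum>m<N. \<Sum>n<N. r ^ (if m \<le> n then n - m else m - n)) \<le> 2 * real N / (1 - r)"
proof -
  have geo: "(\<Sum>k<n. r ^ k) \<le> 1 / (1 - r)" for n
  proof -
    have "(\<Sum>k<n. r ^ k) = (1 - r ^ n) / (1 - r)"
      using r by (subst geometric_sum) (auto simp: field_simps)
    also have "\<dots> \<le> 1 / (1 - r)" using r by (intro divide_right_mono) auto
    finally show ?thesis .
  qed
  have "(\<Sum>n<N. r ^ (if m \<le> n then n - m else m - n)) \<le> 2 / (1 - r)" if "m < N" for m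
  proof -
    have "(\<Sum>n<N. r ^ (if m \<le> n then n - m else m - n))
        = (\<Sum>n\<in>{m..<N}. r ^ (n - m)) + (\<Sum>n<m. r ^ (m - n))"
      using that
      by (subst sum.atLeastLessThan_concat[of 0 m N, symmetric, unfolded atLeast0LessThan])
         (auto simp: add.commute intro!: arg_cong2[where f = "(+)"] sum.cong)
    also have "(\<Sum>n\<in>{m..<N}. r ^ (n - m)) = (\<Sum>k<N-m. r ^ k)"
      by (rule sum.reindex_bij_witness[of _ "\<lambda>k. k + m" "\<lambda>n. n - m"]) auto
    also have "(\<Sum>n<m. r ^ (m - n)) \<le> (\<Sum>n<m. r ^ (m - Suc n))"
      using r by (intro sum_mono power_decreasing) auto
    also have "\<dots> = (\<Sum>k<m. r ^ k)"
      by (rule sum.nat_diff_reindex)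
    finally show ?thesis using geo[of "N - m"] geo[of m] by simp
  qed
  then have "(\<Sum>m<N. \<Sum>n<N. r ^ (if m \<le> n then n - m else m - n)) \<le> (\<Sum>m<N. 2 / (1 - r))"
    by (intro sum_mono) auto
  then show ?thesis by (simp add: mult.commute)
qed

text \<open>A strong law by second moments: geometric decay of correlations makes the second moment
  of the \<open>N\<close>-th partial sum \<open>O(N)\<close>. Along the squares this is summable
  after normalisation, and \<open>square_lacunary\<close> fills the gaps.\<close>

lemma (in prob_space) AE_average_tendsto_0:
  fixes D :: "nat \<Rightarrow> 'a \<Rightarrow> complex"
  assumes meas [measurable]: "\<And>m. D m \<in> borel_measurable M"
    and bound: "\<And>m \<omega>. norm (D m \<omega>) \<le> C"
    and corr: "\<And>m n. m \<le> n \<Longrightarrow> \<bar>expectation (\<lambda>\<omega>. D m \<omega> \<bullet> D n \<omega>)\<bar> \<le> K * r ^ (n - m)"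
    and r: "0 \<le> r" "r < 1"
  shows "AE \<omega> in M. (\<lambda>N. norm (\<Sum>m<N. D m \<omega>) / real N) \<longlonglongrightarrow> 0"
proof -
  define S where "S N \<omega> = (\<Sum>m<N. D m \<omega>)" for N \<omega>
  have [measurable]: "S N \<in> borel_measurable M" for N unfolding S_def by measurable
  have C: "0 \<le> C" using bound[of 0 undefined] norm_ge_zero order_trans by blast
  have K: "0 \<le> K" using order_trans[OF abs_ge_zero corr[of 0 0]] by simp
  have int: "integrable M (\<lambda>\<omega>. D m \<omega> \<bullet> D n \<omega>)" for m n
  proof (rule integrable_const_bound[of _ "C * C"])
    show "AE x in M. norm (D m x \<bullet> D n x) \<le> C * C"
      by (intro AE_I2) (simp, intro order_trans[OF Cauchy_Schwarz_ineq2] mult_mono bound C norm_ge_zero)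
  qed measurable
  have expect: "expectation (\<lambda>\<omega>. (norm (S N \<omega>))\<^sup>2) \<le> K * (2 * real N / (1 - r))" for N
  proof -
    have "(norm (S N \<omega>))\<^sup>2 = (\<Sum>m<N. \<Sum>n<N. D m \<omega> \<bullet> D n \<omega>)" for \<omega>
      unfolding power2_norm_eq_inner S_def inner_sum_left inner_sum_right by (rule sum.swap)
    then have "expectation (\<lambda>\<omega>. (norm (S N \<omega>))\<^sup>2) = (\<Sum>m<N. \<Sum>n<N. expectation (\<lambda>\<omega>. D m \<omega> \<bullet> D n \<omega>))"
      using int by simp
    also have "\<dots> \<le> (\<Sum>m<N. \<Sum>n<N. K * r ^ (if m \<le> n then n - m else m - n))"
    proof (intro sum_mono)
      fix m n
      show "expectation (\<lambda>\<omega>. D m \<omega> \<bullet> D n \<omega>) \<le> K * r ^ (if m \<le> n then n - m else m - n)"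
        using corr[of m n] corr[of n m] by (auto simp: inner_commute)
    qed
    also have "\<dots> = K * (\<Sum>m<N. \<Sum>n<N. r ^ (if m \<le> n then n - m else m - n))"
      by (simp add: sum_distrib_left)
    also have "\<dots> \<le> K * (2 * real N / (1 - r))"
      by (intro mult_left_mono sum_geometric_pairs r K)
    finally show ?thesis .
  qed
  define K' where "K' = K * 2 / (1 - r)"
  have intS: "integrable M (\<lambda>\<omega>. (norm (S N \<omega>))\<^sup>2)" for N
  proof (rule integrable_const_bound[of _ "(N * C)\<^sup>2"])
    have "norm (S N \<omega>) \<le> N * C" for \<omega>
      unfolding S_def by (rule order_trans[OF sum_norm_bound[of _ _ C]]) (auto simp: bound)
    then show "AE x in M. norm ((norm (S N x))\<^sup>2) \<le> (N * C)\<^sup>2"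
      by (intro AE_I2) (auto intro!: power_mono)
  qed measurable
  \<comment> \<open>The expectations of these are \<open>O(1 / j ^ 2)\<close>, so the series of the
    \<open>Y j\<close> converges almost surely and its terms tend to \<open>0\<close>.\<close>
  define Y where "Y j \<omega> = (norm (S (j\<^sup>2) \<omega>) / real (j\<^sup>2))\<^sup>2" for j \<omega>
  have [measurable]: "Y j \<in> borel_measurable M" for j unfolding Y_def by measurable
  have Yexp: "integrable M (Y j)" "expectation (Y j) \<le> K' * (1 / (real j)\<^sup>2)" for j
  proof -
    have Y: "Y j = (\<lambda>\<omega>. (norm (S (j\<^sup>2) \<omega>))\<^sup>2 / (real (j\<^sup>2))\<^sup>2)"
      by (auto simp: Y_def power_divide)
    show "integrable M (Y j)" unfolding Y using intS by auto
    have "expectation (Y j) = expectation (\<lambda>\<omega>. (norm (S (j\<^sup>2) \<omega>))\<^sup>2) / (real (j\<^sup>2))\<^sup>2"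
      unfolding Y by simp
    also have "\<dots> \<le> K * (2 * real (j\<^sup>2) / (1 - r)) / (real (j\<^sup>2))\<^sup>2"
      by (intro divide_right_mono expect) auto
    also have "\<dots> \<le> K' * (1 / (real j)\<^sup>2)"
      by (cases "j = 0") (simp_all add: K'_def power2_eq_square)
    finally show "expectation (Y j) \<le> K' * (1 / (real j)\<^sup>2)" .
  qed
  have summ: "summable (\<lambda>j. K' * (1 / (real j)\<^sup>2))"
    by (intro summable_mult) (use inverse_power_summable[of 2, where 'a = real] in \<open>simp add: field_simps\<close>)
  have "AE \<omega> in M. summable (\<lambda>j. Y j \<omega>)"
  proof -
    have "(\<integral>\<^sup>+\<omega>. (\<Sum>j. ennreal (Y j \<omega>)) \<partial>M) = (\<Sum>j. \<integral>\<^sup>+\<omega>. ennreal (Y j \<omega>) \<partial>M)"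
      by (rule nn_integral_suminf) auto
    also have "\<dots> = (\<Sum>j. ennreal (expectation (Y j)))"
      by (intro suminf_cong nn_integral_eq_integral Yexp) (auto simp: Y_def)
    also have "\<dots> \<le> (\<Sum>j. ennreal (K' * (1 / (real j)\<^sup>2)))"
      by (intro suminf_le ennreal_leI Yexp) auto
    also have "\<dots> < \<top>"
      using summ K r by (subst ennreal_suminf_neq_top[THEN less_top[THEN iffD1]]) (auto simp: K'_def)
    finally have "(\<integral>\<^sup>+\<omega>. (\<Sum>j. ennreal (Y j \<omega>)) \<partial>M) \<noteq> \<infinity>" by simp
    then have "AE \<omega> in M. (\<Sum>j. ennreal (Y j \<omega>)) \<noteq> \<infinity>"
      by (intro nn_integral_noteq_infinite) auto
    then show ?thesis
      by eventually_elim (auto intro!: summable_suminf_not_top simp: Y_def)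
  qed
  then show ?thesis
  proof eventually_elim
    case (elim \<omega>)
    have "(\<lambda>j. sqrt (Y j \<omega>)) \<longlonglongrightarrow> sqrt 0"
      by (intro tendsto_real_sqrt summable_LIMSEQ_zero elim)
    then have "(\<lambda>j. norm (S (j\<^sup>2) \<omega>) / real (j\<^sup>2)) \<longlonglongrightarrow> 0"
      by (simp add: Y_def)
    then have "(\<lambda>N. norm (S N \<omega>) / real N) \<longlonglongrightarrow> 0"
    proof (rule square_lacunary)
      fix m n :: nat assume mn: "m \<le> n"
      have "S n \<omega> - S m \<omega> = (\<Sum>k\<in>{m..<n}. D k \<omega>)"
        unfolding S_def using mn by (simp add: sum_diff_nat_ivl flip: atLeast0LessThan)
      also have "norm \<dots> \<le> C * real (n - m)"
        by (rule order_trans[OF sum_norm_bound[of _ _ C]]) (auto simp: bound mult.commute)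
      finally show "norm (S n \<omega> - S m \<omega>) \<le> C * real (n - m)" .
    qed
    then show ?case by (simp add: S_def)
  qed
qed

section \<open>Subharmonic sequences\<close>

text \<open>Euclidean descent: subtracting the least element from a larger element of
  \<open>G\<close> stays in \<open>G\<close>, until the least element itself is reached.\<close>

lemma least_difference:
  fixes G :: "nat set"
  assumes pos: "0 \<notin> G" and ne: "G \<noteq> {}"
    and diff: "\<And>m n. m \<in> G \<Longrightarrow> n \<in> G \<Longrightarrow> m < n \<Longrightarrow> n - m \<in> G"
  shows "\<exists>d\<in>G. \<forall>n\<in>G. d dvd n"
proof -
  define d where "d = (LEAST n. n \<in> G)"
  have d: "d \<in> G" "\<And>n. n \<in> G \<Longrightarrow> d \<le> n"
    unfolding d_def using ne by (auto intro: LeastI Least_le)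
  have "d dvd n" if "n \<in> G" for n
    using that
  proof (induction n rule: less_induct)
    case (less n)
    show ?case
    proof (cases "n = d")
      case False
      with d(2)[OF less.prems] have "d < n" by simp
      moreover from this have "n - d \<in> G" using diff d(1) less.prems by blast
      moreover have "d > 0" using pos d(1) by (cases d) auto
      ultimately have "d dvd n - d" using less.IH[of "n - d"] by simp
      then show ?thesis using \<open>d < n\<close> by (simp add: dvd_minus_self)
    qed simp
  qed
  with d(1) show ?thesis by blast
qed

text \<open>\<open>\<Phi>\<close> is a potential: along steps of length \<open>d\<close> it decreases by the defect of subharmonicity, so that
  the defects tend to \<open>0\<close>.  No renewal theorem is needed.\<close>

locale subharmonic =
  fixes W :: "'w set" and p :: "'w \<Rightarrow> real" and h :: "'w \<Rightarrow> nat" and \<psi> \<epsilon> :: "nat \<Rightarrow> real" and H :: nat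
  assumes finW: "finite W" and p_pos: "\<And>w. w \<in> W \<Longrightarrow> 0 < p w" and p_sum: "(\<Sum>w\<in>W. p w) = 1"
    and h_pos: "\<And>w. w \<in> W \<Longrightarrow> 0 < h w" and h_le: "\<And>w. w \<in> W \<Longrightarrow> h w \<le> H"
    and \<psi>_nonneg: "\<And>i. 0 \<le> \<psi> i"
    and sub: "\<And>i. H \<le> i \<Longrightarrow> \<psi> i + \<epsilon> i \<le> (\<Sum>w\<in>W. p w * \<psi> (i - h w))"
    and \<epsilon>_nonneg: "\<And>i. H \<le> i \<Longrightarrow> 0 \<le> \<epsilon> i"
begin

definition \<Phi> :: "nat \<Rightarrow> nat \<Rightarrow> real" where
  "\<Phi> d i = (\<Sum>w\<in>W. p w * (\<Sum>j<h w div d. \<psi> (i - d * j)))"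

lemma W_nonempty: "W \<noteq> {}"
  using p_sum by auto

text \<open>Moving \<open>i\<close> by \<open>d\<close> shifts each window of
  \<open>h w div d\<close> points by one place: it gains \<open>\<psi> (i + d)\<close> and loses
  \<open>\<psi> (i + d - h w)\<close>. The bound \<open>H \<le> i\<close> keeps the subtractions
  from being truncated at \<open>0\<close>.\<close>

lemma \<Phi>_step:
  assumes d: "d > 0" "\<And>w. w \<in> W \<Longrightarrow> d dvd h w" and i: "H \<le> i"
  shows "\<Phi> d (i + d) = \<Phi> d i + \<psi> (i + d) - (\<Sum>w\<in>W. p w * \<psi> (i + d - h w))"
proof -
  have "(\<Sum>j<h w div d. \<psi> (i + d - d * j)) = (\<Sum>j<h w div d. \<psi> (i - d * j)) + \<psi> (i + d) - \<psi> (i + d - h w)"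
    if w: "w \<in> W" for w
  proof -
    obtain m where m: "h w = d * m" using d(2)[OF w] by blast
    with h_pos[OF w] obtain m' where m': "m = Suc m'" by (cases m) auto
    have "(\<Sum>j<Suc m'. \<psi> (i + d - d * j)) = \<psi> (i + d) + (\<Sum>j<m'. \<psi> (i + d - d * Suc j))"
      by (subst sum.lessThan_Suc_shift) simp
    also have "(\<Sum>j<m'. \<psi> (i + d - d * Suc j)) = (\<Sum>j<m'. \<psi> (i - d * j))"
      by (intro sum.cong) auto
    finally have "(\<Sum>j<Suc m'. \<psi> (i + d - d * j)) = \<psi> (i + d) + (\<Sum>j<Suc m'. \<psi> (i - d * j)) - \<psi> (i - d * m')"
      by simp
    moreover have "i + d - h w = i - d * m'" using h_le[OF w] i unfolding m m' by simp
    ultimately show ?thesis using d(1) by (simp add: m m')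
  qed
  then have "\<Phi> d (i + d) = (\<Sum>w\<in>W. p w * (\<Sum>j<h w div d. \<psi> (i - d * j)) + p w * \<psi> (i + d) - p w * \<psi> (i + d - h w))"
    unfolding \<Phi>_def by (intro sum.cong) (simp_all add: distrib_left right_diff_distrib)
  then show ?thesis
    using p_sum by (simp add: sum.distrib sum_subtractf \<Phi>_def flip: sum_distrib_right)
qed

lemma \<Phi>_nonneg: "0 \<le> \<Phi> d i"
  unfolding \<Phi>_def by (intro sum_nonneg mult_nonneg_nonneg \<psi>_nonneg less_imp_le p_pos)

lemma \<Phi>_convergent:
  assumes d: "d > 0" "\<And>w. w \<in> W \<Longrightarrow> d dvd h w" and i: "H \<le> i"
  shows "\<exists>L. (\<lambda>j. \<Phi> d (i + d * j)) \<longlonglongrightarrow> L"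
proof -
  have "decseq (\<lambda>j. \<Phi> d (i + d * j))"
  proof (rule decseq_SucI)
    fix j
    have "\<Phi> d (i + d * j + d) \<le> \<Phi> d (i + d * j)"
      using \<Phi>_step[OF d, of "i + d * j"] sub[of "i + d * j + d"] \<epsilon>_nonneg[of "i + d * j + d"] i by simp
    then show "\<Phi> d (i + d * Suc j) \<le> \<Phi> d (i + d * j)" by (simp add: algebra_simps)
  qed
  moreover have "bdd_below (range (\<lambda>j. \<Phi> d (i + d * j)))"
    by (intro bdd_belowI2[of _ 0] \<Phi>_nonneg)
  ultimately show ?thesis by (metis LIMSEQ_decseq_INF)
qed

text \<open>The defects are the successive decrements of \<open>\<Phi> 1\<close>, which converges.
  Subharmonicity squeezes \<open>\<epsilon>\<close> between \<open>0\<close> and the defect.\<close>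

lemma defect_tendsto_0:
  "(\<lambda>i. (\<Sum>w\<in>W. p w * \<psi> (i - h w)) - \<psi> i) \<longlonglongrightarrow> 0" and \<epsilon>_tendsto_0: "\<epsilon> \<longlonglongrightarrow> 0"
proof -
  obtain L where L: "(\<lambda>j. \<Phi> 1 (H + 1 * j)) \<longlonglongrightarrow> L" using \<Phi>_convergent[of 1 H] by auto
  have "(\<lambda>j. \<Phi> 1 (H + 1 * j) - \<Phi> 1 (H + 1 * Suc j)) \<longlonglongrightarrow> L - L"
    by (intro tendsto_diff L filterlim_compose[OF L filterlim_Suc])
  then have "(\<lambda>j. (\<Sum>w\<in>W. p w * \<psi> (j + Suc H - h w)) - \<psi> (j + Suc H)) \<longlonglongrightarrow> 0"
    using \<Phi>_step[of 1] by (simp add: add.commute)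
  from LIMSEQ_offset[OF this]
  show *: "(\<lambda>i. (\<Sum>w\<in>W. p w * \<psi> (i - h w)) - \<psi> i) \<longlonglongrightarrow> 0" .
  show "\<epsilon> \<longlonglongrightarrow> 0"
  proof (rule Lim_null_comparison[OF _ *])
    show "\<forall>\<^sub>F i in sequentially. norm (\<epsilon> i) \<le> (\<Sum>w\<in>W. p w * \<psi> (i - h w)) - \<psi> i"
      using eventually_ge_at_top[of H] by eventually_elim (use sub \<epsilon>_nonneg in fastforce)
  qed
qed

text \<open>The hypothesis on differences makes every step length an asymptotic period of
  \<open>\<psi>\<close>. With \<open>d\<close> the generator of the asymptotic periods,
  \<open>\<psi>\<close> is asymptotically proportional to \<open>\<Phi> d\<close>, hence converges
  along each progression of difference \<open>d\<close>; not all of these limits can vanish.\<close>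

lemma persistence:
  assumes var: "\<And>v w. v \<in> W \<Longrightarrow> w \<in> W \<Longrightarrow> (\<lambda>i. \<psi> (i - h v) - \<psi> (i - h w)) \<longlonglongrightarrow> 0"
    and not: "\<not> \<psi> \<longlonglongrightarrow> 0"
  shows "\<exists>d i c. 0 < d \<and> 0 < c \<and> (\<forall>j. c \<le> \<psi> (i + d * j))"
proof -
  define G where "G = {n. 0 < n \<and> (\<lambda>i. \<psi> (i + n) - \<psi> i) \<longlonglongrightarrow> 0}"
  \<comment> \<open>The values \<open>\<psi> (i - h v)\<close> are asymptotically equal to each
    other, and their mean is asymptotically \<open>\<psi> i\<close>; so each of them is
    asymptotically \<open>\<psi> i\<close>.\<close>
  have hG: "h w \<in> G" if w: "w \<in> W" for w
  proof -
    have "(\<lambda>i. (\<Sum>v\<in>W. p v * (\<psi> (i - h w) - \<psi> (i - h v))) + ((\<Sum>v\<in>W. p v * \<psi> (i - h v)) - \<psi> i)) \<longlonglongrightarrow> (\<Sum>v\<in>W. p v * 0) + 0"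
      by (intro tendsto_intros var w defect_tendsto_0)
    moreover have "(\<Sum>v\<in>W. p v * (\<psi> (i - h w) - \<psi> (i - h v))) + ((\<Sum>v\<in>W. p v * \<psi> (i - h v)) - \<psi> i)
        = \<psi> (i - h w) - \<psi> i" for i
      using p_sum by (simp add: right_diff_distrib sum_subtractf flip: sum_distrib_right)
    ultimately have "(\<lambda>i. - (\<psi> (i - h w) - \<psi> i)) \<longlonglongrightarrow> - 0"
      by (intro tendsto_minus) simp
    from LIMSEQ_ignore_initial_segment[OF this, of "h w"]
    show ?thesis using h_pos[OF w] by (simp add: G_def)
  qed
  have "\<exists>d\<in>G. \<forall>n\<in>G. d dvd n"
  proof (rule least_difference)
    show "n - m \<in> G" if "m \<in> G" "n \<in> G" "m < n" for m n
    proof -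
      have "(\<lambda>i. (\<psi> (i + n) - \<psi> i) - (\<psi> (i + (n - m) + m) - \<psi> (i + (n - m)))) \<longlonglongrightarrow> 0 - 0"
        using that LIMSEQ_ignore_initial_segment[of "\<lambda>i. \<psi> (i + m) - \<psi> i" 0 "n - m"]
        by (intro tendsto_diff) (auto simp: G_def)
      then show ?thesis using that by (simp add: G_def)
    qed
  qed (use hG W_nonempty in \<open>auto simp: G_def\<close>)
  then obtain d where d: "d > 0" "(\<lambda>i. \<psi> (i + d) - \<psi> i) \<longlonglongrightarrow> 0" "\<And>w. w \<in> W \<Longrightarrow> d dvd h w"
    using hG by (auto simp: G_def)
  have mult: "(\<lambda>i. \<psi> (i - d * j) - \<psi> i) \<longlonglongrightarrow> 0" for j
  proof -
    have "(\<lambda>i. \<psi> (i + d * j) - \<psi> i) \<longlonglongrightarrow> 0"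
    proof (induction j)
      case (Suc j)
      from tendsto_add[OF this LIMSEQ_ignore_initial_segment[OF d(2), of "d * j"]]
      show ?case by (simp add: algebra_simps)
    qed simp
    from tendsto_minus[OF this]
    have "(\<lambda>i. \<psi> (i + d * j - d * j) - \<psi> (i + d * j)) \<longlonglongrightarrow> 0" by simp
    then show ?thesis by (rule LIMSEQ_offset[where k = "d * j"])
  qed
  \<comment> \<open>The mean window length of \<open>\<Phi> d\<close>. As \<open>d\<close> is an
    asymptotic period, all values in a window are close to \<open>\<psi> i\<close>, so
    \<open>\<Phi> d i\<close> is close to \<open>\<kappa> * \<psi> i\<close>.\<close>
  define \<kappa> where "\<kappa> = (\<Sum>w\<in>W. p w * real (h w div d))"
  have \<kappa>: "\<kappa> > 0"
    unfolding \<kappa>_def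
  proof (intro sum_pos finW W_nonempty mult_pos_pos p_pos)
    fix w assume "w \<in> W"
    then show "0 < real (h w div d)"
      using h_pos[of w] d(1) dvd_imp_le[OF d(3), of w] by (simp add: div_greater_zero_iff)
  qed
  have "(\<lambda>i. \<Sum>w\<in>W. p w * (\<Sum>j<h w div d. \<psi> (i - d * j) - \<psi> i)) \<longlonglongrightarrow> (\<Sum>w\<in>W. p w * (\<Sum>j<h w div d. 0))"
    by (intro tendsto_intros mult)
  then have \<Phi>\<psi>: "(\<lambda>i. \<Phi> d i - \<kappa> * \<psi> i) \<longlonglongrightarrow> 0"
    by (simp add: \<Phi>_def \<kappa>_def sum_subtractf right_diff_distrib sum_distrib_right mult.assoc)
  have conv: "\<exists>L\<ge>0. (\<lambda>j. \<psi> (i + d * j)) \<longlonglongrightarrow> L" if i: "H \<le> i" for i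
  proof -
    obtain L where L: "(\<lambda>j. \<Phi> d (i + d * j)) \<longlonglongrightarrow> L" using \<Phi>_convergent[OF d(1,3) i] by auto
    have sub: "filterlim (\<lambda>j. i + d * j) at_top sequentially"
      using d(1) by (intro filterlim_subseq) (auto simp: strict_mono_def)
    have "(\<lambda>j. (\<Phi> d (i + d * j) - (\<Phi> d (i + d * j) - \<kappa> * \<psi> (i + d * j))) / \<kappa>) \<longlonglongrightarrow> (L - 0) / \<kappa>"
      using \<kappa> by (intro tendsto_divide tendsto_diff L filterlim_compose[OF \<Phi>\<psi> sub] tendsto_const) auto
    then have "(\<lambda>j. \<psi> (i + d * j)) \<longlonglongrightarrow> L / \<kappa>" using \<kappa> by simp
    moreover from this have "L / \<kappa> \<ge> 0" by (rule LIMSEQ_le_const) (use \<psi>_nonneg in blast)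
    ultimately show ?thesis by blast
  qed
  \<comment> \<open>If all these limits were \<open>0\<close>, the largest of \<open>d\<close>
    thresholds, one for each residue class, would serve for the whole sequence.\<close>
  have "\<exists>i\<ge>H. \<not> (\<lambda>j. \<psi> (i + d * j)) \<longlonglongrightarrow> 0"
  proof (rule ccontr)
    assume "\<not> ?thesis"
    then have lim0: "(\<lambda>j. \<psi> (i + d * j)) \<longlonglongrightarrow> 0" if "H \<le> i" for i using that by blast
    have "\<psi> \<longlonglongrightarrow> 0"
    proof (rule LIMSEQ_I)
      fix e :: real assume e: "e > 0"
      have "\<forall>r. \<exists>n. \<forall>j\<ge>n. \<psi> (H + r + d * j) < e"
        using LIMSEQ_D[OF lim0 e] \<psi>_nonneg by (metis abs_of_nonneg diff_zero le_add1 real_norm_def)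
      then obtain n where n: "\<And>r j. j \<ge> n r \<Longrightarrow> \<psi> (H + r + d * j) < e" by metis
      define n' where "n' = Max (n ` {..<d})"
      have n': "n r \<le> n'" if "r < d" for r unfolding n'_def using that by auto
      show "\<exists>no. \<forall>i\<ge>no. norm (\<psi> i - 0) < e"
      proof (intro exI allI impI)
        fix i assume i: "H + d * n' \<le> i"
        define r where "r = (i - H) mod d"
        have "i = H + r + d * ((i - H) div d)" using i by (simp add: r_def)
        moreover have "(i - H) div d \<ge> n'"
          using i d(1) div_le_mono[of "d * n'" "i - H" d] by simp
        moreover have "r < d" using d(1) by (simp add: r_def)
        ultimately have "\<psi> i < e" using n[of r "(i - H) div d"] n'[of r] by simp
        then show "norm (\<psi> i - 0) < e" using \<psi>_nonneg[of i] by simp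
      qed
    qed
    with not show False by contradiction
  qed
  then obtain i where i: "i \<ge> H" "\<not> (\<lambda>j. \<psi> (i + d * j)) \<longlonglongrightarrow> 0" by blast
  then obtain L where L: "L > 0" "(\<lambda>j. \<psi> (i + d * j)) \<longlonglongrightarrow> L"
    using conv[of i] by (metis less_eq_real_def)
  then have "\<forall>\<^sub>F j in sequentially. L / 2 < \<psi> (i + d * j)"
    by (intro order_tendstoD) auto
  then obtain n where n: "\<And>j. j \<ge> n \<Longrightarrow> L / 2 < \<psi> (i + d * j)"
    by (auto simp: eventually_sequentially)
  have "\<forall>j. L / 2 \<le> \<psi> ((i + d * n) + d * j)"
    using n[of "n + j" for j] by (auto simp: algebra_simps intro: less_imp_le)
  then show ?thesis using d(1) L(1) by (metis half_gt_zero)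
qed

end

text \<open>Once the signed distance to the nearest integer is small, multiplication by the integer
  \<open>\<beta>\<close> multiplies it by exactly \<open>\<beta>\<close>. It can stay small forever
  only if it is \<open>0\<close>.\<close>

lemma expanding_near_integers:
  fixes y :: real and \<beta> :: nat
  assumes \<beta>: "2 \<le> \<beta>" and lim: "(\<lambda>j. \<bar>y * \<beta> ^ j - round (y * \<beta> ^ j)\<bar>) \<longlonglongrightarrow> 0"
  shows "\<exists>j0. \<forall>j\<ge>j0. y * \<beta> ^ j \<in> \<int>"
proof -
  define D where "D j = y * \<beta> ^ j - round (y * \<beta> ^ j)" for j
  \<comment> \<open>This bound keeps \<open>\<beta> * D j\<close> below \<open>1 / 4\<close>, so
    that rounding commutes with multiplication by \<open>\<beta>\<close>.\<close>
  have "\<forall>\<^sub>F j in sequentially. \<bar>D j\<bar> < 1 / (4 * \<beta>)"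
    using order_tendstoD(2)[OF lim, of "1 / (4 * \<beta>)"] \<beta> by (simp add: D_def)
  then obtain n where n: "\<And>j. j \<ge> n \<Longrightarrow> \<bar>D j\<bar> < 1 / (4 * \<beta>)"
    by (auto simp: eventually_sequentially)
  have step: "D (Suc j) = \<beta> * D j" if "j \<ge> n" for j
  proof -
    have 1: "\<bar>\<beta> * D j\<bar> < 1 / 4"
      using n[OF that] \<beta> by (simp add: abs_mult field_simps)
    have "y * \<beta> ^ Suc j = of_int (int \<beta> * round (y * \<beta> ^ j)) + \<beta> * D j"
      by (simp add: D_def algebra_simps)
    moreover have "round (of_int (int \<beta> * round (y * \<beta> ^ j)) + \<beta> * D j) = int \<beta> * round (y * \<beta> ^ j)"
      by (rule round_unique') (use 1 in simp)
    ultimately show ?thesis by (simp add: D_def)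
  qed
  have Dn: "D (n + k) = \<beta> ^ k * D n" for k
    by (induction k) (auto simp: step)
  have "D n = 0"
  proof (rule ccontr)
    assume "D n \<noteq> 0"
    then obtain k where "1 / \<bar>D n\<bar> < real \<beta> ^ k"
      using real_arch_pow[of "real \<beta>"] \<beta> by auto
    then have "1 < \<bar>D (n + k)\<bar>"
      using \<open>D n \<noteq> 0\<close> by (simp add: Dn abs_mult) (simp add: field_simps)
    moreover have "1 / (4 * real \<beta>) < 1" using \<beta> by simp
    ultimately show False using n[of "n + k"] by simp
  qed
  then have "y * \<beta> ^ j = of_int (round (y * \<beta> ^ j))" if "j \<ge> n" for j
    using Dn[of "j - n"] that by (simp add: D_def)
  then show ?thesis by (metis Ints_of_int)
qed

text \<open>Expanding the squared distances gives the variance as half the mean squared distance of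
  two independent samples. This form exhibits the differences \<open>z v - z w\<close>
  explicitly.\<close>

lemma weighted_variance:
  fixes z :: "'w \<Rightarrow> 'b::real_inner"
  assumes "finite W" "(\<Sum>w\<in>W. p w) = 1"
  shows "(norm (\<Sum>w\<in>W. p w *\<^sub>R z w))\<^sup>2 + (\<Sum>v\<in>W. \<Sum>w\<in>W. p v * p w * (norm (z v - z w))\<^sup>2) / 2
    = (\<Sum>w\<in>W. p w * (norm (z w))\<^sup>2)"
proof -
  have "(\<Sum>v\<in>W. \<Sum>w\<in>W. p v * p w * (norm (z v - z w))\<^sup>2)
     = (\<Sum>v\<in>W. \<Sum>w\<in>W. p w * (p v * (norm (z v))\<^sup>2)) + (\<Sum>v\<in>W. \<Sum>w\<in>W. p v * (p w * (norm (z w))\<^sup>2))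
       - 2 * (\<Sum>v\<in>W. \<Sum>w\<in>W. (p v *\<^sub>R z v) \<bullet> (p w *\<^sub>R z w))"
    by (simp add: power2_norm_eq_inner inner_diff_left inner_diff_right inner_commute algebra_simps
        sum.distrib sum_subtractf sum_distrib_left)
  also have "(\<Sum>v\<in>W. \<Sum>w\<in>W. p w * (p v * (norm (z v))\<^sup>2)) = (\<Sum>w\<in>W. p w * (norm (z w))\<^sup>2)"
    using assms(2) by (simp flip: sum_distrib_right)
  also have "(\<Sum>v\<in>W. \<Sum>w\<in>W. p v * (p w * (norm (z w))\<^sup>2)) = (\<Sum>w\<in>W. p w * (norm (z w))\<^sup>2)"
    using assms(2) by (simp flip: sum_distrib_left sum_distrib_right)
  also have "(\<Sum>v\<in>W. \<Sum>w\<in>W. (p v *\<^sub>R z v) \<bullet> (p w *\<^sub>R z w)) = (norm (\<Sum>w\<in>W. p w *\<^sub>R z w))\<^sup>2"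
    unfolding power2_norm_eq_inner inner_sum_left inner_sum_right by (rule sum.swap)
  finally show ?thesis by (simp add: diff_divide_distrib)
qed

section \<open>Fourier transforms of measures on the line\<close>

definition fourier :: "real measure \<Rightarrow> real \<Rightarrow> complex" where
  "fourier \<nu> \<xi> = (\<integral>x. echar (\<xi> * x) \<partial>\<nu>)"

lemma borel_measurable_echar [measurable]: "echar \<in> borel_measurable borel"
  by (intro borel_measurable_continuous_onI continuous_intros)

lemma echar_minus: "echar (- x) = cnj (echar x)"
  by (simp add: echar_def cis_cnj)

lemma echar_eq_iexp: "echar (\<xi> * x) = iexp (2 * pi * \<xi> * x)"
  by (simp add: echar_def cis_conv_exp mult_ac)

lemma echar_inner: "echar x \<bullet> echar y = cos (2 * pi * (x - y))"
  by (simp add: echar_def inner_complex_def right_diff_distrib cos_diff)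

lemma norm_echar_diff_le: "norm (echar x - echar y) \<le> 2 * pi * \<bar>x - y\<bar>"
proof -
  have "echar x - echar y = echar y * (echar (x - y) - 1)"
    by (simp add: right_diff_distrib flip: echar_add)
  then have "norm (echar x - echar y) = norm (iexp (2 * pi * (x - y)) - 1)"
    using echar_eq_iexp[of 1 "x - y"] by (simp add: norm_mult)
  also have "\<dots> \<le> \<bar>2 * pi * (x - y)\<bar>"
    using iexp_approx1[of "2 * pi * (x - y)" 0] by simp
  finally show ?thesis by (simp add: abs_mult)
qed

locale borel_prob = prob_space \<nu> for \<nu> :: "real measure" +
  assumes sets_eq [measurable_cong, simp]: "sets \<nu> = sets borel"
begin

lemma space_eq [simp]: "space \<nu> = UNIV"
  using sets_eq_imp_space_eq[OF sets_eq] by simp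

lemma integrable_echar [simp]: 
  assumes [measurable]: "g \<in> borel_measurable borel"
  shows "integrable \<nu> (\<lambda>x. echar (g x))"
  by (rule integrable_const_bound[of _ 1]) auto

lemma norm_fourier_le_1: "norm (fourier \<nu> \<xi>) \<le> 1"
proof -
  have "norm (fourier \<nu> \<xi>) \<le> (\<integral>x. norm (echar (\<xi> * x)) \<partial>\<nu>)"
    unfolding fourier_def by (rule integral_norm_bound)
  then show ?thesis using prob_space by simp
qed

lemma fourier_eq_char: "fourier \<nu> \<xi> = char \<nu> (2 * pi * \<xi>)"
  by (simp add: fourier_def char_def echar_eq_iexp)

lemma real_distribution: "real_distribution \<nu>"
  by unfold_locales simp

lemma isCont_fourier: "isCont (fourier \<nu>) \<xi>"
proof -
  interpret real_distribution \<nu> by (rule real_distribution)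
  have "isCont (\<lambda>\<xi>. char \<nu> (2 * pi * \<xi>)) \<xi>"
    by (intro continuous_intros isCont_o2[OF _ isCont_char])
  then show ?thesis by (simp add: fourier_eq_char[abs_def])
qed

lemma continuous_on_fourier [continuous_intros]:
  "continuous_on A g \<Longrightarrow> continuous_on A (\<lambda>x. fourier \<nu> (g x))"
  by (rule continuous_on_compose2[of UNIV "fourier \<nu>"])
     (auto simp: isCont_fourier intro: continuous_at_imp_continuous_on)

lemma fourier_uminus: "fourier \<nu> (- \<xi>) = cnj (fourier \<nu> \<xi>)"
  by (simp add: fourier_def echar_minus flip: Bochner_Integration.integral_cnj)

lemma norm_fourier_abs: "norm (fourier \<nu> \<bar>\<xi>\<bar>) = norm (fourier \<nu> \<xi>)"
  by (simp add: abs_if fourier_uminus)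

lemma norm_fourier_mult_abs: "norm (fourier \<nu> (k * \<bar>\<xi>\<bar>)) = norm (fourier \<nu> (k * \<xi>))"
  by (metis norm_fourier_abs abs_mult abs_abs)

text \<open>The inner product on the complex numbers is the real one, so the integrand comes out
  directly as a cosine, without a sine part to cancel.\<close>

lemma norm_fourier_square:
  "(norm (fourier \<nu> \<xi>))\<^sup>2 = (\<integral>x. \<integral>y. cos (2 * pi * \<xi> * (x - y)) \<partial>\<nu> \<partial>\<nu>)"
proof -
  have "(norm (fourier \<nu> \<xi>))\<^sup>2 = (\<integral>x. echar (\<xi> * x) \<partial>\<nu>) \<bullet> fourier \<nu> \<xi>"
    by (simp add: power2_norm_eq_inner fourier_def)
  also have "\<dots> = (\<integral>x. echar (\<xi> * x) \<bullet> fourier \<nu> \<xi> \<partial>\<nu>)"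
    by simp
  also have "\<dots> = (\<integral>x. \<integral>y. echar (\<xi> * x) \<bullet> echar (\<xi> * y) \<partial>\<nu> \<partial>\<nu>)"
    unfolding fourier_def by (subst integral_inner_right) auto
  finally show ?thesis
    by (simp add: echar_inner mult.assoc right_diff_distrib)
qed

end

text \<open>Integration by parts: with \<open>u = a * b powr \<tau>\<close> and
  \<open>q = sin u / u\<close>, the derivative of \<open>q / ln b\<close> is
  \<open>cos u - q\<close>. The boundary terms and the integral of \<open>q\<close> are all
  \<open>O(1 / \<bar>a\<bar>)\<close>.\<close>

lemma integral_cos_exponential_bound:
  fixes a b :: real
  assumes a: "a \<noteq> 0" and b: "b > 1"
  shows "\<bar>integral {0..1} (\<lambda>\<tau>. cos (a * b powr \<tau>))\<bar> \<le> (1 + 2 / ln b) / \<bar>a\<bar>"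
proof -
  define q where "q \<tau> = sin (a * b powr \<tau>) / (a * b powr \<tau>)" for \<tau>
  have lb: "ln b > 0" using b by simp
  have q_le: "\<bar>q \<tau>\<bar> \<le> 1 / \<bar>a\<bar>" if "0 \<le> \<tau>" for \<tau>
  proof -
    have "1 \<le> b powr \<tau>" using b that by (simp add: ge_one_powr_ge_zero)
    then have "\<bar>a\<bar> * 1 \<le> \<bar>a\<bar> * b powr \<tau>" by (intro mult_left_mono) auto
    then show ?thesis
      using a b unfolding q_def abs_divide abs_mult by (intro frac_le) auto
  qed
  have der: "((\<lambda>\<tau>. q \<tau> / ln b) has_real_derivative cos (a * b powr \<tau>) - q \<tau>) (at \<tau> within {0..1})" for \<tau>
  proof -
    have E: "((\<lambda>\<tau>. a * b powr \<tau>) has_real_derivative a * b powr \<tau> * ln b) (at \<tau>)"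
      using b unfolding powr_def by (auto intro!: derivative_eq_intros)
    have E0: "a * b powr \<tau> \<noteq> 0" using a b by simp
    from DERIV_cdivide[OF DERIV_divide[OF DERIV_fun_sin[OF E] E E0], of "ln b"]
    have "((\<lambda>\<tau>. q \<tau> / ln b) has_real_derivative cos (a * b powr \<tau>) - q \<tau>) (at \<tau>)"
      unfolding q_def using E0 lb by (elim DERIV_cong) (simp add: divide_simps, simp add: algebra_simps)
    then show ?thesis by (rule has_field_derivative_at_within)
  qed
  have FTC: "((\<lambda>\<tau>. cos (a * b powr \<tau>) - q \<tau>) has_integral (q 1 / ln b - q 0 / ln b)) {0..1}"
    by (rule fundamental_theorem_of_calculus) (use der in \<open>auto simp: has_real_derivative_iff_has_vector_derivative\<close>)
  have contq: "continuous_on {0..1} q"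
    unfolding q_def using a b by (auto intro!: continuous_intros)
  have "integral {0..1} (\<lambda>\<tau>. cos (a * b powr \<tau>)) = (q 1 / ln b - q 0 / ln b) + integral {0..1} q"
    using has_integral_add[OF FTC integrable_integral[OF integrable_continuous_real[OF contq]]]
    by (simp add: integral_unique)
  moreover have "\<bar>integral {0..1} q\<bar> \<le> 1 / \<bar>a\<bar>"
    using integral_bound[OF _ contq, of "1 / \<bar>a\<bar>"] q_le by simp
  moreover have "\<bar>q 1 / ln b - q 0 / ln b\<bar> \<le> 2 / ln b / \<bar>a\<bar>"
  proof -
    have "\<bar>q 1 - q 0\<bar> \<le> 2 / \<bar>a\<bar>" using q_le[of 1] q_le[of 0] by simp
    then have "\<bar>q 1 - q 0\<bar> / ln b \<le> 2 / \<bar>a\<bar> / ln b" using lb by (intro divide_right_mono) auto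
    then show ?thesis using lb by (simp add: diff_divide_distrib[symmetric] abs_divide mult.commute)
  qed
  ultimately show ?thesis by (simp add: add_divide_distrib)
qed

text \<open>A version of Wiener's lemma averaged over a logarithmic scale. Off the diagonal the
  averaged cosine decays like \<open>b ^ - j\<close>; the diagonal is null for the product measure
  since there are no atoms; dominated convergence finishes.\<close>

lemma (in borel_prob) wiener:
  fixes b k :: real
  assumes na: "\<And>x. emeasure \<nu> {x} = 0" and b: "b > 1" and k: "k \<noteq> 0"
  shows "(\<lambda>j. integral {0..1} (\<lambda>\<tau>. (norm (fourier \<nu> (k * b powr (real j + \<tau>))))\<^sup>2)) \<longlonglongrightarrow> 0"
proof -
  interpret PP: pair_prob_space \<nu> \<nu> ..
  define U where "U = uniform_measure lborel {0..1::real}"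
  have sU [measurable_cong, simp]: "sets U = sets borel" by (simp add: U_def)
  interpret U: prob_space U unfolding U_def by (rule prob_space_uniform_measure) auto
  interpret UP: pair_prob_space U "\<nu> \<Otimes>\<^sub>M \<nu>" ..
  have U_int: "integral\<^sup>L U \<phi> = integral {0..1} \<phi>" if "continuous_on UNIV \<phi>" for \<phi> :: "real \<Rightarrow> real"
    using borel_measurable_continuous_onI[OF that] set_borel_integral_eq_integral(2)[of "{0..1}" \<phi>]
      borel_integrable_atLeastAtMost'[OF continuous_on_subset[OF that], of 0 1]
    by (simp add: U_def integral_uniform_01)
  define c where "c j x y \<tau> = cos (2 * pi * (k * b powr (real j + \<tau>)) * (x - y))" for j x y \<tau>
  have eq: "integral {0..1} (\<lambda>\<tau>. (norm (fourier \<nu> (k * b powr (real j + \<tau>))))\<^sup>2)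
      = (\<integral>z. (\<integral>\<tau>. c j (fst z) (snd z) \<tau> \<partial>U) \<partial>(\<nu> \<Otimes>\<^sub>M \<nu>))" for j
  proof -
    have "integral {0..1} (\<lambda>\<tau>. (norm (fourier \<nu> (k * b powr (real j + \<tau>))))\<^sup>2)
       = (\<integral>\<tau>. (norm (fourier \<nu> (k * b powr (real j + \<tau>))))\<^sup>2 \<partial>U)"
      by (subst U_int) (use b in \<open>auto intro!: continuous_intros\<close>)
    also have "\<dots> = (\<integral>\<tau>. (\<integral>x. \<integral>y. c j x y \<tau> \<partial>\<nu> \<partial>\<nu>) \<partial>U)"
      by (simp add: norm_fourier_square c_def)
    also have "\<dots> = (\<integral>\<tau>. (\<integral>z. c j (fst z) (snd z) \<tau> \<partial>(\<nu> \<Otimes>\<^sub>M \<nu>)) \<partial>U)"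
    proof (intro Bochner_Integration.integral_cong refl)
      fix \<tau>
      have "integrable (\<nu> \<Otimes>\<^sub>M \<nu>) (\<lambda>(x, y). c j x y \<tau>)"
        by (rule PP.P.integrable_const_bound[of _ 1]) (auto simp: c_def split_beta)
      from PP.integral_fst[OF this]
      show "(\<integral>x. \<integral>y. c j x y \<tau> \<partial>\<nu> \<partial>\<nu>) = (\<integral>z. c j (fst z) (snd z) \<tau> \<partial>(\<nu> \<Otimes>\<^sub>M \<nu>))"
        by (simp add: case_prod_beta')
    qed
    also have "\<dots> = (\<integral>z. (\<integral>\<tau>. c j (fst z) (snd z) \<tau> \<partial>U) \<partial>(\<nu> \<Otimes>\<^sub>M \<nu>))"
      by (rule UP.Fubini_integral[symmetric])
         (rule UP.P.integrable_const_bound[of _ 1], auto simp: c_def split_beta)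
    finally show ?thesis .
  qed
  have inner: "(\<integral>\<tau>. c j x y \<tau> \<partial>U) = integral {0..1} (\<lambda>\<tau>. cos (2 * pi * k * (x - y) * b ^ j * b powr \<tau>))" for j x y
  proof -
    have "c j x y = (\<lambda>\<tau>. cos (2 * pi * k * (x - y) * b ^ j * b powr \<tau>))"
      using b by (simp add: c_def fun_eq_iff powr_add powr_realpow algebra_simps)
    then show ?thesis
      using b by (simp add: U_int continuous_intros)
  qed
  have lim: "(\<lambda>j. \<integral>\<tau>. c j x y \<tau> \<partial>U) \<longlonglongrightarrow> 0" if "x \<noteq> y" for x y
  proof (rule Lim_null_comparison[OF always_eventually])
    define a where "a = 2 * pi * k * (x - y)"
    have a: "a \<noteq> 0" using that k by (simp add: a_def)
    show "\<forall>j. norm (\<integral>\<tau>. c j x y \<tau> \<partial>U) \<le> (1 + 2 / ln b) / \<bar>a\<bar> * (1 / b) ^ j"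
    proof
      fix j
      have "norm (\<integral>\<tau>. c j x y \<tau> \<partial>U) \<le> (1 + 2 / ln b) / \<bar>a * b ^ j\<bar>"
        unfolding inner a_def[symmetric] real_norm_def
        by (rule integral_cos_exponential_bound) (use a b in auto)
      also have "\<dots> = (1 + 2 / ln b) / \<bar>a\<bar> * (1 / b) ^ j"
        using b by (simp add: abs_mult power_inverse divide_inverse mult_ac)
      finally show "norm (\<integral>\<tau>. c j x y \<tau> \<partial>U) \<le> (1 + 2 / ln b) / \<bar>a\<bar> * (1 / b) ^ j" .
    qed
    show "(\<lambda>j. (1 + 2 / ln b) / \<bar>a\<bar> * (1 / b) ^ j) \<longlonglongrightarrow> 0"
      by (rule tendsto_mult_right_zero, rule LIMSEQ_realpow_zero) (use b in auto)
  qed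
  \<comment> \<open>The only use of the absence of atoms: each vertical section of the diagonal is a
    single point.\<close>
  have diag: "AE z in \<nu> \<Otimes>\<^sub>M \<nu>. fst z \<noteq> snd z"
  proof -
    have "AE x in \<nu>. AE y in \<nu>. fst (x, y) \<noteq> snd (x, y)"
    proof (rule AE_I2)
      fix x
      show "AE y in \<nu>. fst (x, y) \<noteq> snd (x, y)"
        by (rule AE_I[of _ _ "{x}"]) (auto simp: na)
    qed
    moreover have "{z \<in> space (\<nu> \<Otimes>\<^sub>M \<nu>). fst z \<noteq> snd z} \<in> sets (\<nu> \<Otimes>\<^sub>M \<nu>)"
      by measurable
    ultimately show ?thesis
      using PP.AE_pair_iff[of "(\<noteq>)"] by simp
  qed
  have "(\<lambda>j. (\<integral>z. (\<integral>\<tau>. c j (fst z) (snd z) \<tau> \<partial>U) \<partial>(\<nu> \<Otimes>\<^sub>M \<nu>))) \<longlonglongrightarrow> (\<integral>z. 0 \<partial>(\<nu> \<Otimes>\<^sub>M \<nu>))"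
  proof (rule integral_dominated_convergence[where w = "\<lambda>_. 1"])
    show "(\<lambda>z. \<integral>\<tau>. c j (fst z) (snd z) \<tau> \<partial>U) \<in> borel_measurable (\<nu> \<Otimes>\<^sub>M \<nu>)" for j
      unfolding c_def by measurable
    show "AE z in \<nu> \<Otimes>\<^sub>M \<nu>. (\<lambda>j. \<integral>\<tau>. c j (fst z) (snd z) \<tau> \<partial>U) \<longlonglongrightarrow> 0"
      using diag by eventually_elim (rule lim)
    show "AE z in \<nu> \<Otimes>\<^sub>M \<nu>. norm (\<integral>\<tau>. c j (fst z) (snd z) \<tau> \<partial>U) \<le> 1" for j
    proof (intro AE_I2)
      fix z
      have "norm (\<integral>\<tau>. c j (fst z) (snd z) \<tau> \<partial>U) \<le> (\<integral>\<tau>. 1 \<partial>U)"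
        by (intro Bochner_Integration.integral_norm_bound_integral U.integrable_const_bound[of _ 1]) (auto simp: c_def)
      then show "norm (\<integral>\<tau>. c j (fst z) (snd z) \<tau> \<partial>U) \<le> 1" by (simp add: U.prob_space)
    qed
  qed auto
  then show ?thesis unfolding eq by simp
qed

section \<open>Coding of a self-similar measure\<close>

text \<open>The bounds are imposed on every natural number, not just on the support of
  \<open>P\<close>, so that the coding map is defined and bounded on every stream and no exceptional
  null set appears.\<close>

locale contracting_ifs =
  fixes P :: "nat pmf" and s t :: "nat \<Rightarrow> real" and r0 r T :: real
  assumes r0_pos: "0 < r0" and s_ge: "\<And>i. r0 \<le> \<bar>s i\<bar>" and s_le: "\<And>i. \<bar>s i\<bar> \<le> r" and r_lt_1: "r < 1"
    and t_le: "\<And>i. \<bar>t i\<bar> \<le> T"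
begin

lemma r_pos: "0 < r" using r0_pos s_ge[of 0] s_le[of 0] by linarith
lemma T_nonneg: "0 \<le> T" using t_le[of 0] by linarith
lemma s_neq_0: "s i \<noteq> 0" using r0_pos s_ge[of i] by auto

section \<open>The Bernoulli measure on streams and the coding map\<close>

definition S :: "nat stream measure" where
  "S = stream_space (measure_pmf P)"

lemma sets_S [measurable_cong]: "sets S = sets (stream_space (count_space UNIV))"
  unfolding S_def by (rule sets_stream_space_cong) simp

lemma space_S [simp]: "space S = UNIV"
  by (simp add: S_def space_stream_space)

sublocale S: prob_space S
  unfolding S_def by (rule prob_space.prob_space_stream_space) (rule measure_pmf.prob_space_axioms)

text \<open>A word stands for the composition of its maps, first letter outermost;
  \<open>scale\<close> is its linear part, with sign, and \<open>trans\<close> its translation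
  part.\<close>

fun scale :: "nat list \<Rightarrow> real" where
  "scale [] = 1"
| "scale (i # w) = s i * scale w"

fun trans :: "nat list \<Rightarrow> real" where
  "trans [] = 0"
| "trans (i # w) = s i * trans w + t i"

lemma scale_append: "scale (u @ v) = scale u * scale v"
  by (induction u) auto

lemma scale_neq_0 [simp]: "scale w \<noteq> 0"
  by (induction w) (auto simp: s_neq_0)

lemma scale_le: "\<bar>scale w\<bar> \<le> r ^ length w"
  by (induction w) (auto simp: abs_mult intro!: mult_mono s_le order_trans[OF abs_ge_zero s_le])

text \<open>The limit of the compositions of the first \<open>n\<close> maps applied to
  \<open>0\<close>.\<close>

definition code :: "nat stream \<Rightarrow> real" where
  "code \<omega> = (\<Sum>n. scale (stake n \<omega>) * t (\<omega> !! n))"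

definition R where "R = T / (1 - r)"

lemma R_nonneg: "0 \<le> R"
  using T_nonneg r_lt_1 by (simp add: R_def)

lemma code_term_le: "norm (scale (stake n \<omega>) * t (\<omega> !! n)) \<le> T * r ^ n"
  using mult_mono[OF scale_le[of "stake n \<omega>"] t_le[of "\<omega> !! n"]] r_pos T_nonneg
  by (simp add: abs_mult mult.commute)

lemma summable_geo: "summable (\<lambda>n. T * r ^ n)"
  using r_pos r_lt_1 by (intro summable_mult summable_geometric) auto

lemma summable_code: "summable (\<lambda>n. scale (stake n \<omega>) * t (\<omega> !! n))"
  by (rule summable_comparison_test'[OF summable_geo code_term_le])

lemma code_le: "\<bar>code \<omega>\<bar> \<le> R"
proof -
  have "norm (code \<omega>) \<le> (\<Sum>n. T * r ^ n)"
    unfolding code_def by (rule norm_suminf_le[OF code_term_le summable_geo])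
  also have "\<dots> = R"
    using r_pos r_lt_1 by (simp add: suminf_mult summable_geometric suminf_geometric R_def)
  finally show ?thesis by simp
qed

lemma code_Stream: "code (i ## \<omega>) = s i * code \<omega> + t i"
proof -
  have "code (i ## \<omega>) = (\<Sum>n. s i * (scale (stake n \<omega>) * t (\<omega> !! n))) + t i"
    unfolding code_def using suminf_split_head[OF summable_code[of "i ## \<omega>"]] by (simp add: mult.assoc)
  then show ?thesis
    by (simp add: suminf_mult summable_code code_def)
qed

lemma code_shift: "code (w @- \<omega>) = scale w * code \<omega> + trans w"
  by (induction w) (auto simp: code_Stream algebra_simps)

lemma code_split: "code \<omega> = scale (stake n \<omega>) * code (sdrop n \<omega>) + trans (stake n \<omega>)"
  using code_shift[of "stake n \<omega>" "sdrop n \<omega>"] by (simp only: stake_sdrop)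

lemma code_dist:
  assumes "stake n \<omega> = stake n \<omega>'"
  shows "\<bar>code \<omega> - code \<omega>'\<bar> \<le> 2 * R * r ^ n"
proof -
  have "\<bar>code \<omega> - code \<omega>'\<bar> = \<bar>scale (stake n \<omega>)\<bar> * \<bar>code (sdrop n \<omega>) - code (sdrop n \<omega>')\<bar>"
    by (subst (1 2) code_split[of _ n]) (simp add: assms abs_mult flip: right_diff_distrib)
  also have "\<dots> \<le> r ^ n * (2 * R)"
    using scale_le[of "stake n \<omega>"] code_le[of "sdrop n \<omega>"] code_le[of "sdrop n \<omega>'"] r_pos
    by (intro mult_mono) auto
  finally show ?thesis by (simp add: mult.commute)
qed

section \<open>Resampling the tail of a stream\<close>

lemma measurable_stake' [measurable]: "stake n \<in> S \<rightarrow>\<^sub>M count_space UNIV"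
  by measurable

lemma measurable_code [measurable]: "code \<in> borel_measurable S"
  unfolding code_def by measurable

text \<open>Independence of the letters: the tail after \<open>m\<close> letters may be replaced by
  an independent copy. The inner integral is then a conditional expectation given the first
  \<open>m\<close> letters.\<close>

lemma nn_integral_split:
  assumes [measurable]: "f \<in> borel_measurable S"
  shows "(\<integral>\<^sup>+\<omega>. f \<omega> \<partial>S) = (\<integral>\<^sup>+\<omega>. \<integral>\<^sup>+\<omega>'. f (stake m \<omega> @- \<omega>') \<partial>S \<partial>S)"
  using assms
proof (induction m arbitrary: f)
  case 0
  then show ?case by (simp add: S.emeasure_space_1[simplified])
next
  case (Suc m)
  note [measurable] = Suc.prems
  have step: "(\<integral>\<^sup>+\<omega>. g \<omega> \<partial>S) = (\<integral>\<^sup>+i. \<integral>\<^sup>+\<omega>. g (i ## \<omega>) \<partial>S \<partial>P)" if "g \<in> borel_measurable S" for g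
    using that unfolding S_def by (rule prob_space.nn_integral_stream_space[OF measure_pmf.prob_space_axioms])
  have "(\<integral>\<^sup>+\<omega>. f \<omega> \<partial>S) = (\<integral>\<^sup>+i. \<integral>\<^sup>+\<omega>. f (i ## \<omega>) \<partial>S \<partial>P)"
    by (rule step) measurable
  also have "\<dots> = (\<integral>\<^sup>+i. \<integral>\<^sup>+\<omega>. \<integral>\<^sup>+\<omega>'. f (i ## stake m \<omega> @- \<omega>') \<partial>S \<partial>S \<partial>P)"
    by (intro nn_integral_cong Suc.IH) (unfold S_def, measurable)
  also have "\<dots> = (\<integral>\<^sup>+\<omega>. \<integral>\<^sup>+\<omega>'. f (stake (Suc m) \<omega> @- \<omega>') \<partial>S \<partial>S)"
    by (subst step) (simp_all add: S_def)
  finally show ?case .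
qed

lemma measurable_splice [measurable]: "(\<lambda>(\<omega>, \<omega>'). stake m \<omega> @- \<omega>') \<in> S \<Otimes>\<^sub>M S \<rightarrow>\<^sub>M S"
  unfolding S_def split_beta by measurable

lemma distr_splice: "distr (S \<Otimes>\<^sub>M S) S (\<lambda>(\<omega>, \<omega>'). stake m \<omega> @- \<omega>') = S"
proof (rule measure_eqI)
  fix A assume "A \<in> sets (distr (S \<Otimes>\<^sub>M S) S (\<lambda>(\<omega>, \<omega>'). stake m \<omega> @- \<omega>'))"
  then have [measurable]: "A \<in> sets S" by simp
  have "emeasure (distr (S \<Otimes>\<^sub>M S) S (\<lambda>(\<omega>, \<omega>'). stake m \<omega> @- \<omega>')) A
      = (\<integral>\<^sup>+z. indicator A (case z of (\<omega>, \<omega>') \<Rightarrow> stake m \<omega> @- \<omega>') \<partial>(S \<Otimes>\<^sub>M S))"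
    by (subst nn_integral_indicator[symmetric], simp, subst nn_integral_distr) auto
  also have "\<dots> = (\<integral>\<^sup>+\<omega>. \<integral>\<^sup>+\<omega>'. indicator A (stake m \<omega> @- \<omega>') \<partial>S \<partial>S)"
    by (subst S.nn_integral_fst[symmetric]) auto
  also have "\<dots> = (\<integral>\<^sup>+\<omega>. indicator A \<omega> \<partial>S)"
    by (rule nn_integral_split[symmetric]) measurable
  finally show "emeasure (distr (S \<Otimes>\<^sub>M S) S (\<lambda>(\<omega>, \<omega>'). stake m \<omega> @- \<omega>')) A = emeasure S A"
    by simp
qed simp

lemma integral_split:
  fixes f :: "nat stream \<Rightarrow> 'b::{banach, second_countable_topology}"
  assumes [measurable]: "f \<in> borel_measurable S" and bound: "\<And>\<omega>. norm (f \<omega>) \<le> C"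
  shows "(\<integral>\<omega>. f \<omega> \<partial>S) = (\<integral>\<omega>. \<integral>\<omega>'. f (stake m \<omega> @- \<omega>') \<partial>S \<partial>S)"
proof -
  interpret SS: pair_prob_space S S ..
  have "(\<integral>\<omega>. f \<omega> \<partial>S) = (\<integral>z. f (case z of (\<omega>, \<omega>') \<Rightarrow> stake m \<omega> @- \<omega>') \<partial>(S \<Otimes>\<^sub>M S))"
    by (subst distr_splice[of m, symmetric], subst integral_distr) auto
  also have "\<dots> = (\<integral>z. (case z of (\<omega>, \<omega>') \<Rightarrow> f (stake m \<omega> @- \<omega>')) \<partial>(S \<Otimes>\<^sub>M S))"
    by (simp add: case_prod_beta')
  also have "\<dots> = (\<integral>\<omega>. \<integral>\<omega>'. f (stake m \<omega> @- \<omega>') \<partial>S \<partial>S)"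
    by (subst SS.integral_fst[symmetric])
       (auto simp: split_beta bound intro!: SS.P.integrable_const_bound[of _ C])
  finally show ?thesis .
qed

text \<open>\<open>D m\<close> is nearly determined by the letters up to time \<open>n\<close>,
  while \<open>D n\<close> has mean \<open>0\<close> given the first \<open>n + c\<close> letters.
  So the correlation of \<open>D m\<close> and \<open>D n\<close> is at most the error of
  approximating \<open>D m\<close> by a function of those letters.\<close>

lemma AE_martingale_average:
  fixes D :: "nat \<Rightarrow> nat stream \<Rightarrow> complex"
  assumes meas [measurable]: "\<And>m. D m \<in> borel_measurable S"
    and bound: "\<And>m \<omega>. norm (D m \<omega>) \<le> C"
    and local: "\<And>m n \<omega> \<omega>'. stake (m + n) \<omega> = stake (m + n) \<omega>' \<Longrightarrow> norm (D m \<omega> - D m \<omega>') \<le> K * r ^ n"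
    and centered: "\<And>m \<omega>. (\<integral>\<omega>'. D m (stake (m + c) \<omega> @- \<omega>') \<partial>S) = 0"
  shows "AE \<omega> in S. (\<lambda>N. norm (\<Sum>m<N. D m \<omega>) / real N) \<longlonglongrightarrow> 0"
proof (rule S.AE_average_tendsto_0[where C = C and K = "K * C" and r = r])
  have C: "0 \<le> C" using order_trans[OF norm_ge_zero bound[of 0 undefined]] .
  have K: "0 \<le> K" using order_trans[OF norm_ge_zero local[of 0 0 undefined undefined]] by simp
  have [measurable]: "(\<lambda>\<omega>. stake k \<omega> @- \<omega>0) \<in> S \<rightarrow>\<^sub>M S" for k \<omega>0
    unfolding S_def by (rule measurable_shift) (auto simp: space_stream_space)
  have [measurable]: "(\<lambda>\<omega>. w @- \<omega>) \<in> S \<rightarrow>\<^sub>M S" for w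
    using measurable_compose[OF measurable_Pair1'[of "w @- sconst 0" S S], OF _ measurable_splice[of "length w"]]
    by (simp add: stake_shift)
  fix m n :: nat assume mn: "m \<le> n"
  \<comment> \<open>\<open>D m\<close> with all letters beyond \<open>n + c\<close> frozen to an
    arbitrary tail: a function of the first \<open>n + c\<close> letters, hence orthogonal to
    \<open>D n\<close>.\<close>
  define E where "E \<omega> = D m (stake (n + c) \<omega> @- sconst 0)" for \<omega>
  have [measurable]: "E \<in> borel_measurable S" unfolding E_def by measurable
  have Ebound: "norm (E \<omega>) \<le> C" for \<omega> by (simp add: E_def bound)
  have int: "integrable S (\<lambda>\<omega>. f \<omega> \<bullet> D n \<omega>)" if [measurable]: "f \<in> borel_measurable S" and "\<And>\<omega>. norm (f \<omega>) \<le> B"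
    for f B
    by (rule S.integrable_const_bound[of _ "B * C"])
       (auto intro!: order_trans[OF Cauchy_Schwarz_ineq2] mult_mono bound that order_trans[OF norm_ge_zero that(2)])
  have "S.expectation (\<lambda>\<omega>. E \<omega> \<bullet> D n \<omega>) = (\<integral>\<omega>. \<integral>\<omega>'. E (stake (n + c) \<omega> @- \<omega>') \<bullet> D n (stake (n + c) \<omega> @- \<omega>') \<partial>S \<partial>S)"
    by (rule integral_split[where C = "C * C"])
       (auto intro!: order_trans[OF Cauchy_Schwarz_ineq2] mult_mono bound Ebound C)
  also have "\<dots> = (\<integral>\<omega>. \<integral>\<omega>'. E \<omega> \<bullet> D n (stake (n + c) \<omega> @- \<omega>') \<partial>S \<partial>S)"
    by (simp add: E_def stake_shift)
  also have "\<dots> = (\<integral>\<omega>. E \<omega> \<bullet> (\<integral>\<omega>'. D n (stake (n + c) \<omega> @- \<omega>') \<partial>S) \<partial>S)"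
    by (subst integral_inner_right) (auto intro!: S.integrable_const_bound[of _ C] simp: bound)
  also have "\<dots> = 0" by (simp add: centered)
  finally have 0: "S.expectation (\<lambda>\<omega>. E \<omega> \<bullet> D n \<omega>) = 0" .
  have close: "norm (D m \<omega> - E \<omega>) \<le> K * r ^ (n - m)" for \<omega>
  proof -
    have "norm (D m \<omega> - E \<omega>) \<le> K * r ^ (n - m + c)"
      unfolding E_def using mn by (intro local) (simp add: stake_shift)
    also have "\<dots> \<le> K * r ^ (n - m)"
      using r_pos r_lt_1 by (intro mult_left_mono power_decreasing K) auto
    finally show ?thesis .
  qed
  have "S.expectation (\<lambda>\<omega>. D m \<omega> \<bullet> D n \<omega>) = S.expectation (\<lambda>\<omega>. (D m \<omega> - E \<omega>) \<bullet> D n \<omega>)"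
    using 0 int[OF meas bound, of m] int[OF _ Ebound] by (simp add: inner_diff_left)
  also have "norm \<dots> \<le> (\<integral>\<omega>. K * r ^ (n - m) * C \<partial>S)"
  proof (rule order_trans[OF integral_norm_bound integral_mono])
    show "norm ((D m \<omega> - E \<omega>) \<bullet> D n \<omega>) \<le> K * r ^ (n - m) * C" for \<omega>
      unfolding real_norm_def using K r_pos
      by (intro order_trans[OF Cauchy_Schwarz_ineq2] mult_mono bound close) auto
    show "integrable S (\<lambda>\<omega>. norm ((D m \<omega> - E \<omega>) \<bullet> D n \<omega>))"
      by (rule integrable_norm[OF int]) (use close in auto)
  qed simp
  finally show "\<bar>S.expectation (\<lambda>\<omega>. D m \<omega> \<bullet> D n \<omega>)\<bar> \<le> K * C * r ^ (n - m)"
    by (simp add: S.prob_space[simplified] mult_ac)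
qed (use bound r_pos r_lt_1 in auto)

end

section \<open>Weyl sums cut into blocks\<close>

text \<open>Cut at the last block boundary \<open>N m \<le> M\<close>. The initial piece costs at
  most \<open>N 0\<close> and the incomplete last block at most \<open>C\<close>, while linear
  growth of the boundaries gives \<open>m \<le> M / a\<close>.\<close>

lemma block_sums:
  fixes u :: "nat \<Rightarrow> 'a::real_normed_vector" and N :: "nat \<Rightarrow> nat"
  assumes u: "\<And>n. norm (u n) \<le> 1" and a: "0 < a" and e: "0 \<le> e"
    and N_step: "\<And>m. N m \<le> N (Suc m)" "\<And>m. N (Suc m) \<le> N m + C"
    and N_ge: "\<And>m. a * real m \<le> real (N m)"
    and blocks: "\<forall>\<^sub>F m in sequentially. norm (\<Sum>n\<in>{N 0..<N m}. u n) \<le> e * real m"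
  shows "\<forall>\<^sub>F M in sequentially. norm (\<Sum>n<M. u n) \<le> N 0 + C + e / a * real M"
proof -
  obtain m0 where m0: "\<And>m. m \<ge> m0 \<Longrightarrow> norm (\<Sum>n\<in>{N 0..<N m}. u n) \<le> e * real m"
    using blocks by (auto simp: eventually_sequentially)
  have mono: "N m \<le> N m'" if "m \<le> m'" for m m'
    using that by (rule lift_Suc_mono_le[of N, OF N_step(1)])
  show ?thesis
    using eventually_ge_at_top[of "N m0"]
  proof eventually_elim
    case (elim M)
    \<comment> \<open>The maximum exists because \<open>N m\<close> grows at least linearly, which
      is what \<open>bnd\<close> records.\<close>
    define m where "m = (GREATEST m. N m \<le> M)"
    have bnd: "\<forall>m. N m \<le> M \<longrightarrow> m \<le> nat \<lceil>M / a\<rceil>"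
    proof (intro allI impI)
      fix m assume "N m \<le> M"
      then have "a * m \<le> M" using N_ge[of m] by linarith
      then have "real m \<le> M / a" using a by (simp add: field_simps)
      then show "m \<le> nat \<lceil>M / a\<rceil>" by linarith
    qed
    have m: "N m \<le> M" unfolding m_def by (rule GreatestI_nat[of "\<lambda>m. N m \<le> M"]) (use elim bnd in auto)
    have mM: "M < N (Suc m)"
    proof (rule ccontr)
      assume "\<not> M < N (Suc m)"
      then have "Suc m \<le> (GREATEST m. N m \<le> M)"
        by (intro Greatest_le_nat[of "\<lambda>m. N m \<le> M"]) (use bnd in auto)
      then have "Suc m \<le> m" by (simp only: m_def)
      then show False by simp
    qed
    have "m0 \<le> m" unfolding m_def by (rule Greatest_le_nat[of "\<lambda>m. N m \<le> M"]) (use elim bnd in auto)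
    have "(\<Sum>n<M. u n) = (\<Sum>n<N 0. u n) + (\<Sum>n\<in>{N 0..<N m}. u n) + (\<Sum>n\<in>{N m..<M}. u n)"
      using m mono[of 0 m] by (simp add: sum.atLeastLessThan_concat lessThan_atLeast0)
    also have "norm \<dots> \<le> norm (\<Sum>n<N 0. u n) + norm (\<Sum>n\<in>{N 0..<N m}. u n) + norm (\<Sum>n\<in>{N m..<M}. u n)"
      by (intro order_trans[OF norm_triangle_ineq] add_mono order_refl norm_triangle_ineq)
    also have "norm (\<Sum>n<N 0. u n) \<le> N 0 * 1"
      by (rule order_trans[OF sum_norm_bound[of _ _ 1]]) (auto simp: u)
    also have "norm (\<Sum>n\<in>{N m..<M}. u n) \<le> real (card {N m..<M}) * 1"
      by (rule sum_norm_bound) (rule u)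
    also have "real (card {N m..<M}) \<le> C" using mM N_step(2)[of m] by simp
    also have "norm (\<Sum>n\<in>{N 0..<N m}. u n) \<le> e * m" using m0[OF \<open>m0 \<le> m\<close>] .
    also have "e * m \<le> e / a * M"
    proof -
      have "a * m \<le> M" using N_ge[of m] m by linarith
      then have "m \<le> M / a" using a by (simp add: field_simps)
      from mult_left_mono[OF this e] show ?thesis by simp
    qed
    finally show ?case by simp
  qed
qed

lemma ceiling_minus_self: "of_int \<lceil>x\<rceil> - x = frac (- x)" for x :: real
  by (simp add: frac_def ceiling_def)

locale contracting_ifs_base = contracting_ifs +
  fixes b :: nat
  assumes b_ge_2: "2 \<le> b"
begin

section \<open>The law of the coding and the size of words in base \<open>b\<close>\<close>

abbreviation law :: "real measure" where
  "law \<equiv> distr S borel code"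

sublocale law: borel_prob law
proof -
  have "prob_space law" by (rule S.prob_space_distr) measurable
  then show "borel_prob law" by (intro borel_prob.intro borel_prob_axioms.intro) simp_all
qed

text \<open>The number of base \<open>b\<close> digits resolved by the word. It is additive under
  concatenation, so along a random stream it is a random walk with positive steps.\<close>

definition L :: "nat list \<Rightarrow> real" where
  "L w = - log b \<bar>scale w\<bar>"

definition lmin where "lmin = - log b r"
definition lmax where "lmax = - log b r0"

lemma L_Nil [simp]: "L [] = 0"
  by (simp add: L_def)

lemma L_append: "L (u @ v) = L u + L v"
  using b_ge_2 by (simp add: L_def scale_append abs_mult log_mult)

lemma lmin_pos: "0 < lmin"
  using b_ge_2 r_pos r_lt_1 by (simp add: lmin_def)

lemma L_single: "lmin \<le> L [i]" "L [i] \<le> lmax"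
  using b_ge_2 s_ge[of i] s_le[of i] r0_pos s_neq_0[of i] by (auto simp: L_def lmin_def lmax_def)

lemma L_ge: "lmin * length w \<le> L w"
proof (induction w)
  case (Cons i w)
  then show ?case using L_append[of "[i]" w] L_single(1)[of i] by (simp add: distrib_left)
qed simp

lemma L_nonneg: "0 \<le> L w"
  using L_ge[of w] lmin_pos by (meson mult_nonneg_nonneg of_nat_0_le_iff less_imp_le order_trans)

lemma powr_L: "b powr (- L w) = \<bar>scale w\<bar>"
  using b_ge_2 by (simp add: L_def)

definition G :: "real \<Rightarrow> real \<Rightarrow> real" where
  "G k \<xi> = norm (fourier law (k * \<xi>))"

lemma G_nonneg: "0 \<le> G k \<xi>" by (simp add: G_def)

text \<open>The first \<open>n\<close> for which \<open>b ^ n\<close> times the contraction of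
  \<open>w\<close> reaches \<open>b ^ Q\<close>. A large \<open>Q\<close> means that the remaining
  tail is seen at high frequency.\<close>

definition blk :: "nat \<Rightarrow> nat list \<Rightarrow> nat" where
  "blk Q w = nat \<lceil>L w\<rceil> + Q"

definition width :: nat where
  "width = nat \<lceil>lmax\<rceil>"

lemma stake_Suc_L: "L (stake (Suc m) \<omega>) = L (stake m \<omega>) + L [\<omega> !! m]"
  unfolding stake_Suc by (rule L_append)

lemma blk_step:
  "blk Q (stake m \<omega>) \<le> blk Q (stake (Suc m) \<omega>)"
  "blk Q (stake (Suc m) \<omega>) \<le> blk Q (stake m \<omega>) + width"
  unfolding blk_def width_def stake_Suc_L
  using L_nonneg[of "stake m \<omega>"] L_nonneg[of "[\<omega> !! m]"] L_single(2)[of "\<omega> !! m"] by linarith+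

lemma blk_ge: "lmin * real m \<le> real (blk Q (stake m \<omega>))"
  using L_ge[of "stake m \<omega>"] L_nonneg[of "stake m \<omega>"] by (simp add: blk_def) linarith

lemma power_scale: "real b ^ n * \<bar>scale w\<bar> = b powr (n - L w)"
  using b_ge_2 powr_L[of w] by (simp add: powr_diff powr_minus powr_realpow divide_inverse)

lemma blk_power_le:
  assumes "n < blk Q w" shows "real b ^ n * \<bar>scale w\<bar> \<le> real b ^ Q"
proof -
  have "real n - L w \<le> Q" using assms L_nonneg[of w] unfolding blk_def by linarith
  then have "b powr (n - L w) \<le> b powr real Q" using b_ge_2 by (intro powr_mono) auto
  then show ?thesis using b_ge_2 by (simp add: power_scale powr_realpow)
qed

text \<open>Below the boundary of the block, \<open>n\<close> is the ceiling of \<open>L w\<close>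
  plus \<open>Q - i\<close>, and the ceiling minus \<open>L w\<close> is
  \<open>frac (- L w)\<close>. The sign of the contraction disappears because the modulus of the
  transform is even.\<close>

lemma blk_G:
  assumes n: "n < blk Q w" "blk Q w \<le> n + width" and Q: "width \<le> Q"
  shows "\<exists>i\<in>{1..width}. norm (fourier law (k * real b ^ n * scale w)) = G k (b powr (real (Q - i) + frac (- L w)))"
proof (rule bexI)
  let ?i = "blk Q w - n"
  show "?i \<in> {1..width}" using n by auto
  \<comment> \<open>Here \<open>width \<le> Q\<close> ensures that \<open>n\<close> is at least the
    ceiling of \<open>L w\<close>, so that the subtraction \<open>Q - ?i\<close> is not
    truncated.\<close>
  have nn: "real n = \<lceil>L w\<rceil> + real (Q - ?i)"
  proof -
    have "nat \<lceil>L w\<rceil> \<le> n" using n Q unfolding blk_def by linarith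
    moreover from this have "Q - ?i = n - nat \<lceil>L w\<rceil>" using n by (simp add: blk_def)
    ultimately show ?thesis using L_nonneg[of w] by simp
  qed
  have "\<bar>k * real b ^ n * scale w\<bar> = \<bar>k * (real b ^ n * \<bar>scale w\<bar>)\<bar>"
    by (simp add: abs_mult mult.assoc)
  then have "norm (fourier law (k * real b ^ n * scale w)) = G k (real b ^ n * \<bar>scale w\<bar>)"
    unfolding G_def by (metis law.norm_fourier_abs)
  also have "real b ^ n * \<bar>scale w\<bar> = b powr (real (Q - ?i) + frac (- L w))"
    unfolding power_scale nn by (simp add: algebra_simps flip: ceiling_minus_self)
  finally show "norm (fourier law (k * real b ^ n * scale w)) = G k (b powr (real (Q - ?i) + frac (- L w)))" .
qed

text \<open>The block of the Weyl sum belonging to the last letter of \<open>w\<close>, at the point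
  with prefix \<open>w\<close> and tail point \<open>y\<close>, minus its conditional expectation
  given \<open>w\<close>.\<close>

definition centered :: "real \<Rightarrow> nat \<Rightarrow> nat list \<Rightarrow> real \<Rightarrow> complex" where
  "centered k Q w y = (\<Sum>n\<in>{blk Q (butlast w)..<blk Q w}.
     echar (k * real b ^ n * (scale w * y + trans w)) - echar (k * real b ^ n * trans w) * fourier law (k * real b ^ n * scale w))"

lemma butlast_stake: "butlast (stake (Suc m) \<omega>) = stake m \<omega>"
  unfolding stake_Suc by simp

lemma centered_norm_le: "norm (centered k Q (stake (Suc m) \<omega>) y) \<le> 2 * width"
proof -
  have "norm (centered k Q (stake (Suc m) \<omega>) y) \<le> real (card {blk Q (stake m \<omega>)..<blk Q (stake (Suc m) \<omega>)}) * 2"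
    unfolding centered_def butlast_stake
  proof (rule sum_norm_bound)
    fix n
    show "norm (echar (k * real b ^ n * (scale (stake (Suc m) \<omega>) * y + trans (stake (Suc m) \<omega>))) -
         echar (k * real b ^ n * trans (stake (Suc m) \<omega>)) * fourier law (k * real b ^ n * scale (stake (Suc m) \<omega>))) \<le> 2"
      by (rule order_trans[OF norm_triangle_ineq4]) (simp add: norm_mult law.norm_fourier_le_1 del: stake.simps)
  qed
  also have "\<dots> \<le> real width * 2"
    using blk_step(2)[of Q m \<omega>] by (intro mult_right_mono) auto
  finally show ?thesis by simp
qed

lemma centered_lipschitz:
  "norm (centered k Q (stake (Suc m) \<omega>) y - centered k Q (stake (Suc m) \<omega>) y')
    \<le> width * (2 * pi * \<bar>k\<bar> * real b ^ Q) * \<bar>y - y'\<bar>"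
proof -
  let ?w = "stake (Suc m) \<omega>"
  have "centered k Q ?w y - centered k Q ?w y' = (\<Sum>n\<in>{blk Q (stake m \<omega>)..<blk Q ?w}.
     echar (k * real b ^ n * (scale ?w * y + trans ?w)) - echar (k * real b ^ n * (scale ?w * y' + trans ?w)))"
    unfolding centered_def butlast_stake sum_subtractf[symmetric] by (intro sum.cong) auto
  also have "norm \<dots> \<le> real (card {blk Q (stake m \<omega>)..<blk Q ?w}) * (2 * pi * \<bar>k\<bar> * real b ^ Q * \<bar>y - y'\<bar>)"
  proof (rule sum_norm_bound)
    fix n assume n: "n \<in> {blk Q (stake m \<omega>)..<blk Q ?w}"
    have "norm (echar (k * real b ^ n * (scale ?w * y + trans ?w)) - echar (k * real b ^ n * (scale ?w * y' + trans ?w)))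
        \<le> 2 * pi * \<bar>k * real b ^ n * (scale ?w * y + trans ?w) - k * real b ^ n * (scale ?w * y' + trans ?w)\<bar>"
      by (rule norm_echar_diff_le)
    also have "k * real b ^ n * (scale ?w * y + trans ?w) - k * real b ^ n * (scale ?w * y' + trans ?w)
        = k * (real b ^ n * scale ?w) * (y - y')" by (simp add: algebra_simps)
    also have "2 * pi * \<bar>\<dots>\<bar> = 2 * pi * \<bar>k\<bar> * (real b ^ n * \<bar>scale ?w\<bar>) * \<bar>y - y'\<bar>"
      by (simp add: abs_mult del: stake.simps)
    also have "\<dots> \<le> 2 * pi * \<bar>k\<bar> * real b ^ Q * \<bar>y - y'\<bar>"
      using n by (intro mult_right_mono mult_left_mono blk_power_le) (auto simp del: stake.simps)
    finally show "norm (echar (k * real b ^ n * (scale ?w * y + trans ?w)) - echar (k * real b ^ n * (scale ?w * y' + trans ?w)))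
        \<le> 2 * pi * \<bar>k\<bar> * real b ^ Q * \<bar>y - y'\<bar>" .
  qed
  also have "\<dots> \<le> real width * (2 * pi * \<bar>k\<bar> * real b ^ Q * \<bar>y - y'\<bar>)"
    using blk_step(2)[of Q m \<omega>] by (intro mult_right_mono) (auto simp del: stake.simps)
  finally show ?thesis by (simp only: mult.assoc)
qed

lemma measurable_centered [measurable]: "centered k Q w \<in> borel_measurable borel"
  unfolding centered_def by measurable

lemma integral_centered: "(\<integral>\<omega>. centered k Q w (code \<omega>) \<partial>S) = 0"
proof -
  have "(\<integral>\<omega>. echar (k * real b ^ n * (scale w * code \<omega> + trans w)) \<partial>S)
      = echar (k * real b ^ n * trans w) * fourier law (k * real b ^ n * scale w)" for n
  proof -
    have "echar (k * real b ^ n * (scale w * code \<omega> + trans w))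
        = echar (k * real b ^ n * trans w) * echar (k * real b ^ n * scale w * code \<omega>)" for \<omega>
      by (simp add: algebra_simps flip: echar_add)
    moreover have "(\<integral>\<omega>. echar (k * real b ^ n * scale w * code \<omega>) \<partial>S) = fourier law (k * real b ^ n * scale w)"
      unfolding fourier_def by (subst integral_distr) auto
    ultimately show ?thesis by simp
  qed
  moreover have "integrable S (\<lambda>\<omega>. echar (k * real b ^ n * (scale w * code \<omega> + trans w)))" for n
    by (rule S.integrable_const_bound[of _ 1]) auto
  ultimately show ?thesis
    unfolding centered_def by (simp add: S.prob_space[simplified])
qed

text \<open>The shift is \<open>c = 1\<close> since the \<open>m\<close>-th block is centered given
  the first \<open>m + 1\<close> letters. Within a block the frequencies seen by the tail are at
  most a multiple of \<open>b ^ Q\<close>, so the dependence on later letters decays like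
  \<open>r ^ n\<close>.\<close>

lemma AE_centered_average:
  "AE \<omega> in S. (\<lambda>N. norm (\<Sum>m<N. centered k Q (stake (Suc m) \<omega>) (code (sdrop (Suc m) \<omega>))) / real N) \<longlonglongrightarrow> 0"
proof (rule AE_martingale_average[where c = 1])
  let ?D = "\<lambda>m \<omega>. centered k Q (stake (Suc m) \<omega>) (code (sdrop (Suc m) \<omega>))"
  define C1 where "C1 = real width * (2 * pi * \<bar>k\<bar> * real b ^ Q)"
  have C1: "0 \<le> C1" by (simp add: C1_def)
  show "?D m \<in> borel_measurable S" for m
  \<comment> \<open>There are only countably many prefixes, so it suffices to treat a fixed
    word.\<close>
  proof (rule measurable_compose_countable[where g = "stake (Suc m)"])
    have [measurable]: "sdrop n \<in> S \<rightarrow>\<^sub>M S" for n unfolding S_def by measurable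
    show "(\<lambda>\<omega>. centered k Q w (code (sdrop (Suc m) \<omega>))) \<in> borel_measurable S" for w
      by measurable
  qed measurable
  show "norm (?D m \<omega>) \<le> 2 * width" for m \<omega>
    by (rule centered_norm_le)
  fix m n :: nat and \<omega> \<omega>' :: "nat stream"
  show "(\<integral>\<omega>'. ?D m (stake (m + 1) \<omega> @- \<omega>') \<partial>S) = 0"
  proof -
    have "?D m (stake (m + 1) \<omega> @- \<omega>') = centered k Q (stake (Suc m) \<omega>) (code \<omega>')" for \<omega>'
      by (simp add: stake_shift sdrop_shift del: stake.simps(2) sdrop.simps(2))
    then show ?thesis by (simp only: integral_centered)
  qed
  \<comment> \<open>For \<open>n = 0\<close> only the trivial bound \<open>4 * width\<close> is
    available. For \<open>n > 0\<close> one of the agreeing letters belongs to the prefix, and this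
    loses the factor \<open>r\<close>.\<close>
  show "norm (?D m \<omega> - ?D m \<omega>') \<le> (4 * width + C1 * (2 * R) / r) * r ^ n" if eq: "stake (m + n) \<omega> = stake (m + n) \<omega>'"
  proof (cases n)
    case 0
    have "norm (?D m \<omega> - ?D m \<omega>') \<le> real (2 * width) + real (2 * width)"
      by (rule order_trans[OF norm_triangle_ineq4 add_mono]) (rule centered_norm_le)+
    then show ?thesis using 0 C1 R_nonneg r_pos by (simp del: stake.simps sdrop.simps add: add_increasing2)
  next
    case (Suc n')
    have "stake (Suc m) \<omega> @ stake n' (sdrop (Suc m) \<omega>) = stake (Suc m) \<omega>' @ stake n' (sdrop (Suc m) \<omega>')"
      unfolding stake_add using eq Suc by simp
    then have 1: "stake (Suc m) \<omega> = stake (Suc m) \<omega>' \<and> stake n' (sdrop (Suc m) \<omega>) = stake n' (sdrop (Suc m) \<omega>')"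
      by (rule iffD1[OF append_eq_append_conv, rotated]) simp
    have "norm (?D m \<omega> - ?D m \<omega>') \<le> C1 * \<bar>code (sdrop (Suc m) \<omega>) - code (sdrop (Suc m) \<omega>')\<bar>"
      unfolding 1[THEN conjunct1] C1_def by (rule centered_lipschitz)
    also have "\<dots> \<le> C1 * (2 * R * r ^ n')"
      by (intro mult_left_mono code_dist 1[THEN conjunct2] C1)
    also have "\<dots> = C1 * (2 * R) / r * r ^ n" using Suc r_pos by simp
    also have "\<dots> \<le> (4 * width + C1 * (2 * R) / r) * r ^ n"
      using r_pos by (intro mult_right_mono) auto
    finally show ?thesis .
  qed
qed

lemma centered_eq:
  "centered k Q (stake (Suc m) \<omega>) (code (sdrop (Suc m) \<omega>))
    = (\<Sum>n\<in>{blk Q (stake m \<omega>)..<blk Q (stake (Suc m) \<omega>)}. echar (k * real b ^ n * code \<omega>))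
    - (\<Sum>n\<in>{blk Q (stake m \<omega>)..<blk Q (stake (Suc m) \<omega>)}.
        echar (k * real b ^ n * trans (stake (Suc m) \<omega>)) * fourier law (k * real b ^ n * scale (stake (Suc m) \<omega>)))"
  unfolding centered_def butlast_stake sum_subtractf code_split[of \<omega> "Suc m", symmetric] ..

text \<open>A block has at most \<open>width\<close> terms, and by \<open>blk_G\<close> the modulus
  of each is one of the nonnegative summands on the right.\<close>

lemma predictable_le:
  assumes "width \<le> Q"
  shows "norm (\<Sum>n\<in>{blk Q (stake m \<omega>)..<blk Q (stake (Suc m) \<omega>)}.
        echar (k * real b ^ n * trans (stake (Suc m) \<omega>)) * fourier law (k * real b ^ n * scale (stake (Suc m) \<omega>)))
    \<le> width * (\<Sum>i\<in>{1..width}. G k (b powr (real (Q - i) + frac (- L (stake (Suc m) \<omega>)))))"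
    (is "norm ?l \<le> _ * ?s")
proof -
  let ?w = "stake (Suc m) \<omega>"
  have "norm ?l \<le> real (card {blk Q (stake m \<omega>)..<blk Q ?w}) * ?s"
  proof (rule sum_norm_bound)
    fix n assume n: "n \<in> {blk Q (stake m \<omega>)..<blk Q ?w}"
    then have "n < blk Q ?w" "blk Q ?w \<le> n + width" using blk_step(2)[of Q m \<omega>] by auto
    from blk_G[OF this assms, of k] obtain i where i: "i \<in> {1..width}"
      "norm (fourier law (k * real b ^ n * scale ?w)) = G k (b powr (real (Q - i) + frac (- L ?w)))" by blast
    have "norm (echar (k * real b ^ n * trans ?w) * fourier law (k * real b ^ n * scale ?w))
       = G k (b powr (real (Q - i) + frac (- L ?w)))" by (simp add: norm_mult i(2) del: stake.simps)
    also have "\<dots> \<le> ?s" using i(1) by (intro member_le_sum) (auto simp: G_nonneg)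
    finally show "norm (echar (k * real b ^ n * trans ?w) * fourier law (k * real b ^ n * scale ?w)) \<le> ?s" .
  qed
  also have "\<dots> \<le> real width * ?s"
    using blk_step(2)[of Q m \<omega>] by (intro mult_right_mono sum_nonneg G_nonneg) auto
  finally show ?thesis .
qed

lemma block_sum_telescope:
  "(\<Sum>n\<in>{blk Q (stake 0 \<omega>)..<blk Q (stake K \<omega>)}. u n)
    = (\<Sum>m<K. \<Sum>n\<in>{blk Q (stake m \<omega>)..<blk Q (stake (Suc m) \<omega>)}. u n)"
proof (induction K)
  case (Suc K)
  have "blk Q (stake 0 \<omega>) \<le> blk Q (stake K \<omega>)"
    by (rule lift_Suc_mono_le[of "\<lambda>m. blk Q (stake m \<omega>)", OF blk_step(1)]) simp
  from sum.atLeastLessThan_concat[OF this blk_step(1), of u, symmetric] Suc show ?case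
    by (simp del: stake.simps)
qed simp

text \<open>Each block is its centered part plus its conditional expectation. The centered parts
  average to \<open>0\<close>; the others are controlled by \<open>small\<close> at the finitely
  many levels \<open>Q - i\<close>; \<open>block_sums\<close> returns from block boundaries to all
  \<open>N\<close>.\<close>

lemma AE_weyl_average:
  assumes small: "\<And>e. 0 < e \<Longrightarrow> \<exists>j0. \<forall>j\<ge>j0. AE \<omega> in S. \<forall>\<^sub>F K in sequentially.
      (\<Sum>m<K. G k (b powr (real j + frac (- L (stake (Suc m) \<omega>))))) \<le> e * real K"
  shows "AE \<omega> in S. (\<lambda>N. norm (\<Sum>n<N. echar (k * real b ^ n * code \<omega>)) / real N) \<longlonglongrightarrow> 0"
proof -
  have key: "AE \<omega> in S. \<forall>\<^sub>F N in sequentially. norm (\<Sum>n<N. echar (k * real b ^ n * code \<omega>)) \<le> e * real N"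
    if e: "0 < e" for e
  proof -
    \<comment> \<open>Chosen so that \<open>2 * d / lmin = e / 2\<close>; the other half of
      \<open>e\<close> absorbs the constant \<open>blk Q (stake 0 \<omega>) + width\<close> for
      large \<open>N\<close>.\<close>
    define d where "d = e * lmin / 4"
    \<comment> \<open>One factor \<open>width\<close> counts the terms in a block, the other the
      levels \<open>i\<close>; the added \<open>1\<close> avoids a zero denominator.\<close>
    define d' where "d' = d / (real width * real width + 1)"
    have d: "0 < d" "0 < d'" using e lmin_pos by (auto simp: d_def d'_def add_nonneg_pos)
    obtain j0 where j0: "\<And>j. j \<ge> j0 \<Longrightarrow> AE \<omega> in S. \<forall>\<^sub>F K in sequentially.
      (\<Sum>m<K. G k (b powr (real j + frac (- L (stake (Suc m) \<omega>))))) \<le> d' * real K"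
      using small[OF d(2)] by blast
    define Q where "Q = j0 + width"
    have "AE \<omega> in S. \<forall>i\<in>{1..width}. \<forall>\<^sub>F K in sequentially.
      (\<Sum>m<K. G k (b powr (real (Q - i) + frac (- L (stake (Suc m) \<omega>))))) \<le> d' * real K"
      by (intro AE_finite_allI j0) (auto simp: Q_def)
    with AE_centered_average[of k Q] show ?thesis
    proof eventually_elim
      case (elim \<omega>)
      have ev1: "\<forall>\<^sub>F K in sequentially. \<forall>i\<in>{1..width}.
         (\<Sum>m<K. G k (b powr (real (Q - i) + frac (- L (stake (Suc m) \<omega>))))) \<le> d' * real K"
        using elim(2) by (intro eventually_ball_finite) auto
      have ev2: "\<forall>\<^sub>F K in sequentially. norm (\<Sum>m<K. centered k Q (stake (Suc m) \<omega>) (code (sdrop (Suc m) \<omega>))) / real K < d"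
        using order_tendstoD(2)[OF elim(1) d(1)] .
      have "\<forall>\<^sub>F K in sequentially. norm (\<Sum>n\<in>{blk Q (stake 0 \<omega>)..<blk Q (stake K \<omega>)}. echar (k * real b ^ n * code \<omega>)) \<le> 2 * d * real K"
        using ev1 ev2 eventually_gt_at_top[of 0]
      proof eventually_elim
        case (elim K)
        let ?V = "\<lambda>m. \<Sum>n\<in>{blk Q (stake m \<omega>)..<blk Q (stake (Suc m) \<omega>)}.
          echar (k * real b ^ n * trans (stake (Suc m) \<omega>)) * fourier law (k * real b ^ n * scale (stake (Suc m) \<omega>))"
        let ?D = "\<lambda>m. centered k Q (stake (Suc m) \<omega>) (code (sdrop (Suc m) \<omega>))"
        have "(\<Sum>n\<in>{blk Q (stake 0 \<omega>)..<blk Q (stake K \<omega>)}. echar (k * real b ^ n * code \<omega>)) = (\<Sum>m<K. ?D m + ?V m)"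
          unfolding block_sum_telescope centered_eq by simp
        then have total: "norm (\<Sum>n\<in>{blk Q (stake 0 \<omega>)..<blk Q (stake K \<omega>)}. echar (k * real b ^ n * code \<omega>))
            \<le> norm (\<Sum>m<K. ?D m) + norm (\<Sum>m<K. ?V m)"
          by (simp only: sum.distrib norm_triangle_ineq)
        have D: "norm (\<Sum>m<K. ?D m) \<le> d * K"
          using elim(2,3) by (simp add: pos_divide_less_eq del: stake.simps sdrop.simps)
        have "norm (\<Sum>m<K. ?V m) \<le> (\<Sum>m<K. width * (\<Sum>i\<in>{1..width}. G k (b powr (real (Q - i) + frac (- L (stake (Suc m) \<omega>))))))"
          by (intro sum_norm_le predictable_le) (simp add: Q_def)
        also have "\<dots> = width * (\<Sum>i\<in>{1..width}. \<Sum>m<K. G k (b powr (real (Q - i) + frac (- L (stake (Suc m) \<omega>)))))"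
          unfolding sum_distrib_left[symmetric] by (subst sum.swap) (rule refl)
        also have "\<dots> \<le> width * (\<Sum>i\<in>{1..width}. d' * K)"
          using elim(1) by (intro mult_left_mono sum_mono) auto
        also have "\<dots> = (real width * real width * d') * K" by simp
        also have "\<dots> \<le> d * K"
        proof (rule mult_right_mono)
          have "real width * real width * d' \<le> (real width * real width + 1) * d'" using d by (simp add: distrib_right)
          also have "\<dots> = d" by (simp add: d'_def add_nonneg_eq_0_iff)
          finally show "real width * real width * d' \<le> d" .
        qed simp
        finally show ?case using total D by linarith
      qed
      from block_sums[where C = width and N = "\<lambda>m. blk Q (stake m \<omega>)"
          and u = "\<lambda>n. echar (k * real b ^ n * code \<omega>)", OF _ lmin_pos _ blk_step blk_ge this]
      have "\<forall>\<^sub>F N in sequentially. norm (\<Sum>n<N. echar (k * real b ^ n * code \<omega>))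
         \<le> blk Q (stake 0 \<omega>) + width + 2 * d / lmin * real N" using d by simp
      then show ?case
        using eventually_ge_at_top[of "nat \<lceil>2 * (blk Q (stake 0 \<omega>) + width) / e\<rceil>"]
      proof eventually_elim
        case (elim N)
        have "2 * (blk Q (stake 0 \<omega>) + width) / e \<le> N" using elim(2) by linarith
        then have "blk Q (stake 0 \<omega>) + width \<le> e / 2 * N" using e by (simp add: field_simps)
        moreover have "2 * d / lmin = e / 2" using lmin_pos by (simp add: d_def)
        ultimately show ?case using elim(1) by (simp only: of_nat_add)
      qed
    qed
  qed
  \<comment> \<open>The exceptional null set depends on \<open>e\<close>, so \<open>e\<close> is
    restricted to countably many values.\<close>
  have "AE \<omega> in S. \<forall>p. \<forall>\<^sub>F N in sequentially. norm (\<Sum>n<N. echar (k * real b ^ n * code \<omega>)) \<le> inverse (real (Suc p)) * real N"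
    by (subst AE_all_countable) (intro allI key, simp)
  then show ?thesis
  proof eventually_elim
    case (elim \<omega>)
    show ?case
    proof (rule order_tendstoI)
      fix a :: real assume "0 < a"
      then obtain p where p: "inverse (real (Suc p)) < a" using reals_Archimedean by blast
      from elim[rule_format, of p] eventually_gt_at_top[of 0]
      show "\<forall>\<^sub>F N in sequentially. norm (\<Sum>n<N. echar (k * real b ^ n * code \<omega>)) / real N < a"
      proof eventually_elim
        case (elim N)
        then have "norm (\<Sum>n<N. echar (k * real b ^ n * code \<omega>)) / real N \<le> inverse (real (Suc p))"
          by (simp add: divide_le_eq del: of_nat_Suc)
        with p show ?case by linarith
      qed
    next
      fix a :: real assume "a < 0"
      then show "\<forall>\<^sub>F N in sequentially. a < norm (\<Sum>n<N. echar (k * real b ^ n * code \<omega>)) / real N"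
        by (intro always_eventually allI) (auto intro: less_le_trans)
    qed
  qed
qed

end

section \<open>The non-lattice case\<close>

context contracting_ifs_base
begin

lemma distr_shd: "distr S (measure_pmf P) shd = measure_pmf P"
proof (rule measure_eqI)
  have [measurable]: "shd \<in> S \<rightarrow>\<^sub>M measure_pmf P" unfolding S_def by measurable
  fix A
  have "emeasure (distr S (measure_pmf P) shd) A = (\<integral>\<^sup>+\<omega>. indicator A (shd \<omega>) \<partial>S)"
    by (subst nn_integral_indicator[symmetric], simp, subst nn_integral_distr) auto
  also have "\<dots> = (\<integral>\<^sup>+i. \<integral>\<^sup>+\<omega>. indicator A (shd (i ## \<omega>)) \<partial>S \<partial>P)"
    unfolding S_def
    by (rule prob_space.nn_integral_stream_space[OF measure_pmf.prob_space_axioms]) measurable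
  also have "\<dots> = emeasure (measure_pmf P) A"
    by (simp add: S.emeasure_space_1[simplified])
  finally show "emeasure (distr S (measure_pmf P) shd) A = emeasure (measure_pmf P) A" .
qed simp

lemma integral_shd:
  fixes f :: "nat \<Rightarrow> 'b::{banach, second_countable_topology}"
  shows "(\<integral>\<omega>. f (shd \<omega>) \<partial>S) = (\<integral>i. f i \<partial>P)"
proof -
  have [measurable]: "shd \<in> S \<rightarrow>\<^sub>M measure_pmf P" unfolding S_def by measurable
  show ?thesis by (subst distr_shd[symmetric], subst integral_distr) auto
qed

text \<open>Equality in the triangle inequality: real parts at most \<open>1\<close> with mean
  \<open>1\<close> are \<open>1\<close> on the whole support, which would make \<open>g i\<close> an
  integer there.\<close>

lemma integral_echar_neq_1:
  assumes "i \<in> set_pmf P" "g i \<notin> \<int>"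
  shows "(\<integral>i. echar (g i) \<partial>P) \<noteq> 1"
proof
  assume 1: "(\<integral>i. echar (g i) \<partial>P) = 1"
  have int: "integrable P (\<lambda>i. echar (g i))"
    by (rule measure_pmf.integrable_const_bound[of _ 1]) auto
  have "(\<integral>i. 1 - Re (echar (g i)) \<partial>P) = 1 - Re (\<integral>i. echar (g i) \<partial>P)"
    using int by (simp add: integrable_Re)
  then have "(\<integral>i. 1 - Re (echar (g i)) \<partial>P) = 0" using 1 by simp
  moreover have "0 \<le> 1 - Re (echar (g i))" for i
    using complex_Re_le_cmod[of "echar (g i)"] by simp
  ultimately have "AE i in P. 1 - Re (echar (g i)) = 0"
    using int by (subst (asm) integral_nonneg_eq_0_iff_AE) (auto simp: integrable_Re)
  then have re: "Re (echar (g i)) = 1" using assms(1) by (simp add: AE_measure_pmf_iff)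
  moreover have "Im (echar (g i)) = 0"
    using cmod_power2[of "echar (g i)"] re by simp
  ultimately have "echar (g i) = echar 0" by (simp add: complex_eq_iff)
  then show False using assms(2) unfolding echar_eq_iff by simp
qed

text \<open>For a random walk, \<open>x (Suc m) - c * x m\<close> is a martingale difference, where
  \<open>c\<close> is the characteristic function of one step. Summation by parts then yields the
  averages of \<open>x\<close>, because \<open>c \<noteq> 1\<close>.\<close>

lemma AE_weyl_null_L:
  assumes irr: "\<And>j::int. j \<noteq> 0 \<Longrightarrow> \<exists>i\<in>set_pmf P. of_int j * L [i] \<notin> \<int>"
  shows "AE \<omega> in S. weyl_null (\<lambda>m. - L (stake (Suc m) \<omega>))"
proof -
  have "AE \<omega> in S. (\<lambda>N. (\<Sum>m<N. echar (of_int j * (- L (stake (Suc m) \<omega>)))) / of_nat N) \<longlonglongrightarrow> 0"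
    if j: "j \<noteq> 0" for j :: int
  proof -
    define x where "x m \<omega> = echar (of_int j * (- L (stake m \<omega>)))" for m \<omega>
    define c where "c = (\<integral>i. echar (of_int j * (- L [i])) \<partial>P)"
    have c: "c \<noteq> 1"
    proof -
      obtain i where "i \<in> set_pmf P" "of_int j * L [i] \<notin> \<int>" using irr[OF j] by blast
      then show ?thesis unfolding c_def by (intro integral_echar_neq_1[of i]) auto
    qed
    have cn: "norm c \<le> 1"
      unfolding c_def by (rule order_trans[OF integral_norm_bound]) simp
    have "AE \<omega> in S. (\<lambda>N. norm (\<Sum>m<N. x (Suc m) \<omega> - c * x m \<omega>) / real N) \<longlonglongrightarrow> 0"
    proof (rule AE_martingale_average[where c = 0])
      show "(\<lambda>\<omega>. x (Suc m) \<omega> - c * x m \<omega>) \<in> borel_measurable S" for m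
        unfolding x_def
        by (intro borel_measurable_diff borel_measurable_times borel_measurable_const
            measurable_compose[OF measurable_stake' measurable_count_space]
            measurable_compose[OF measurable_stake', of "\<lambda>w. echar (of_int j * (- L w))"]) simp_all
      show "norm (x (Suc m) \<omega> - c * x m \<omega>) \<le> 2" for m \<omega>
        by (rule order_trans[OF norm_triangle_ineq4]) (simp add: x_def norm_mult cn)
      \<comment> \<open>For \<open>n \<ge> 1\<close> the common letters determine both terms and the
        difference vanishes; only \<open>n = 0\<close> calls on the constant.\<close>
      show "norm ((x (Suc m) \<omega> - c * x m \<omega>) - (x (Suc m) \<omega>' - c * x m \<omega>')) \<le> 4 / r * r ^ n"
        if eq: "stake (m + n) \<omega> = stake (m + n) \<omega>'" for m n \<omega> \<omega>'
      proof (cases n)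
        case 0
        have *: "norm (x (Suc m) \<omega> - c * x m \<omega>) \<le> 2" for \<omega>
          by (rule order_trans[OF norm_triangle_ineq4]) (simp add: x_def norm_mult cn)
        have "norm ((x (Suc m) \<omega> - c * x m \<omega>) - (x (Suc m) \<omega>' - c * x m \<omega>')) \<le> 2 + 2"
          by (rule order_trans[OF norm_triangle_ineq4 add_mono[OF * *]])
        also have "\<dots> \<le> 4 / r * r ^ n" using 0 r_pos r_lt_1 by (simp add: field_simps)
        finally show ?thesis .
      next
        case (Suc n')
        have "take m (stake (m + n) \<omega>) = take m (stake (m + n) \<omega>')"
          "take (Suc m) (stake (m + n) \<omega>) = take (Suc m) (stake (m + n) \<omega>')"
          by (simp_all only: eq)
        then have "stake m \<omega> = stake m \<omega>'" "stake (Suc m) \<omega> = stake (Suc m) \<omega>'"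
          using Suc by (simp_all add: take_stake min_def del: stake.simps)
        then show ?thesis using r_pos by (simp only: x_def) simp
      qed
      show "(\<integral>\<omega>'. x (Suc m) (stake (m + 0) \<omega> @- \<omega>') - c * x m (stake (m + 0) \<omega> @- \<omega>') \<partial>S) = 0" for m \<omega>
      proof -
        have 1: "x (Suc m) (stake m \<omega> @- \<omega>') = x m \<omega> * echar (of_int j * (- L [shd \<omega>']))" for \<omega>'
          by (simp add: x_def stake_shift Suc_diff_le L_append algebra_simps del: stake.simps(2) flip: echar_add)
             (simp add: numeral_eq_Suc)
        have 2: "x m (stake m \<omega> @- \<omega>') = x m \<omega>" for \<omega>'
          by (simp add: x_def stake_shift)
        have 3: "(\<integral>\<omega>'. echar (of_int j * (- L [shd \<omega>'])) \<partial>S) = c"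
          unfolding c_def by (rule integral_shd)
        have "integrable S (\<lambda>\<omega>'. echar (of_int j * (- L [shd \<omega>'])))"
          by (rule S.integrable_const_bound[of _ 1])
             (auto intro!: measurable_compose[of shd S "count_space UNIV"] simp: S_def)
        then show ?thesis by (simp add: 1 2 3[simplified] S.prob_space[simplified])
      qed
    qed
    then show ?thesis
    proof eventually_elim
      case (elim \<omega>)
      \<comment> \<open>The sums of \<open>x m\<close> and of \<open>x (Suc m)\<close> differ by
        boundary terms only, so the equation can be solved for the latter.\<close>
      have "(\<Sum>m<N. x (Suc m) \<omega>) = ((\<Sum>m<N. x (Suc m) \<omega> - c * x m \<omega>) + c * (x 0 \<omega> - x N \<omega>)) / (1 - c)" for N
      proof -
        have shift: "(\<Sum>m<N. x m \<omega>) = (\<Sum>m<N. x (Suc m) \<omega>) + x 0 \<omega> - x N \<omega>"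
          by (induction N) auto
        have "(\<Sum>m<N. x (Suc m) \<omega> - c * x m \<omega>) + c * (x 0 \<omega> - x N \<omega>) = (\<Sum>m<N. x (Suc m) \<omega>) * (1 - c)"
          unfolding sum_subtractf sum_distrib_left[symmetric] shift by (simp add: algebra_simps)
        then show ?thesis using c by simp
      qed
      then have eq: "(\<Sum>m<N. x (Suc m) \<omega>) / of_nat N
        = ((\<Sum>m<N. x (Suc m) \<omega> - c * x m \<omega>) / of_nat N + c * (x 0 \<omega> - x N \<omega>) / of_nat N) / (1 - c)" for N
        by (simp add: add_divide_distrib mult.commute)
      have l1: "(\<lambda>N. (\<Sum>m<N. x (Suc m) \<omega> - c * x m \<omega>) / of_nat N) \<longlonglongrightarrow> 0"
        by (rule tendsto_norm_zero_cancel) (use elim in \<open>simp add: norm_divide\<close>)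
      have l2: "(\<lambda>N. c * (x 0 \<omega> - x N \<omega>) / of_nat N) \<longlonglongrightarrow> 0"
      proof (rule Lim_null_comparison[OF always_eventually])
        show "\<forall>N. norm (c * (x 0 \<omega> - x N \<omega>) / of_nat N) \<le> 2 / real N"
        proof
          fix N
          have "norm (c * (x 0 \<omega> - x N \<omega>)) \<le> 1 * (1 + 1)"
            unfolding norm_mult by (intro mult_mono cn order_trans[OF norm_triangle_ineq4]) (auto simp: x_def)
          then show "norm (c * (x 0 \<omega> - x N \<omega>) / of_nat N) \<le> 2 / real N"
            unfolding norm_divide norm_of_nat by (intro divide_right_mono) auto
        qed
        show "(\<lambda>N. 2 / real N) \<longlonglongrightarrow> 0" by (rule lim_const_over_n)
      qed
      have "(\<lambda>N. ((\<Sum>m<N. x (Suc m) \<omega> - c * x m \<omega>) / of_nat N + c * (x 0 \<omega> - x N \<omega>) / of_nat N) / (1 - c)) \<longlonglongrightarrow> (0 + 0) / (1 - c)"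
        using c by (intro tendsto_intros l1 l2) auto
      then have "(\<lambda>N. (\<Sum>m<N. x (Suc m) \<omega>) / of_nat N) \<longlonglongrightarrow> 0"
        unfolding eq by (simp only: add_0 div_0)
      then show ?case by (simp only: x_def)
    qed
  qed
  then have "AE \<omega> in S. \<forall>j::int. j \<noteq> 0 \<longrightarrow> (\<lambda>N. (\<Sum>m<N. echar (of_int j * (- L (stake (Suc m) \<omega>)))) / of_nat N) \<longlonglongrightarrow> 0"
    by (subst AE_all_countable) auto
  then show ?thesis by (simp only: weyl_null_def)
qed

text \<open>Equidistribution turns the orbit average of \<open>(G k)\<^sup>2\<close> into its
  integral over one logarithmic period, which \<open>law.wiener\<close> makes smaller than
  \<open>e\<^sup>2\<close> for large \<open>j\<close>.\<close>

lemma nonlattice_small: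
  assumes irr: "\<And>j::int. j \<noteq> 0 \<Longrightarrow> \<exists>i\<in>set_pmf P. of_int j * L [i] \<notin> \<int>"
    and na: "\<And>x. emeasure law {x} = 0" and k: "k \<noteq> 0" and e: "0 < e"
  shows "\<exists>j0. \<forall>j\<ge>j0. AE \<omega> in S. \<forall>\<^sub>F K in sequentially.
      (\<Sum>m<K. G k (b powr (real j + frac (- L (stake (Suc m) \<omega>))))) \<le> e * real K"
proof -
  define \<phi> where "\<phi> j \<tau> = (G k (b powr (real j + \<tau>)))\<^sup>2" for j \<tau>
  have cont: "continuous_on {0..1} (\<phi> j)" for j
    unfolding \<phi>_def G_def using b_ge_2 by (auto intro!: continuous_intros)
  have "(\<lambda>j. integral {0..1} (\<phi> j)) \<longlonglongrightarrow> 0"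
    unfolding \<phi>_def G_def by (rule law.wiener) (use na k b_ge_2 in auto)
  then have "\<forall>\<^sub>F j in sequentially. integral {0..1} (\<phi> j) < e\<^sup>2"
    using e by (intro order_tendstoD(2)) auto
  then obtain j0 where j0: "\<And>j. j \<ge> j0 \<Longrightarrow> integral {0..1} (\<phi> j) < e\<^sup>2"
    by (auto simp: eventually_sequentially)
  \<comment> \<open>Passes from the mean of the squares, below \<open>e\<^sup>2\<close>, to the mean
    of \<open>G\<close> itself, at most \<open>e\<close>.\<close>
  have amgm: "g \<le> e / 2 + g\<^sup>2 / (2 * e)" for g
  proof -
    have "0 \<le> (g - e)\<^sup>2 / (2 * e)" using e by simp
    also have "\<dots> = e / 2 + g\<^sup>2 / (2 * e) - g"
      using e by (simp add: power2_diff field_simps power2_eq_square)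
    finally show ?thesis by simp
  qed
  show ?thesis
  proof (intro exI allI impI)
    fix j assume j: "j0 \<le> j"
    have "AE \<omega> in S. weyl_null (\<lambda>m. - L (stake (Suc m) \<omega>))"
      by (rule AE_weyl_null_L) (rule irr)
    then show "AE \<omega> in S. \<forall>\<^sub>F K in sequentially.
      (\<Sum>m<K. G k (b powr (real j + frac (- L (stake (Suc m) \<omega>))))) \<le> e * real K"
    proof eventually_elim
      case (elim \<omega>)
      from order_tendstoD(2)[OF weyl_equidistribution[OF elim cont] j0[OF j]] eventually_gt_at_top[of 0]
      show ?case
      proof eventually_elim
        case (elim K)
        let ?g = "\<lambda>m. G k (b powr (real j + frac (- L (stake (Suc m) \<omega>))))"
        have s: "(\<Sum>m<K. (?g m)\<^sup>2) \<le> e\<^sup>2 * K"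
          using elim by (simp add: \<phi>_def divide_less_eq del: stake.simps)
        have "(\<Sum>m<K. ?g m) \<le> (\<Sum>m<K. e / 2 + (?g m)\<^sup>2 / (2 * e))"
          by (intro sum_mono amgm)
        also have "\<dots> = K * (e / 2) + (\<Sum>m<K. (?g m)\<^sup>2) / (2 * e)"
          by (simp add: sum.distrib sum_divide_distrib del: stake.simps)
        also have "\<dots> \<le> K * (e / 2) + e\<^sup>2 * K / (2 * e)"
          using s e by (intro add_left_mono divide_right_mono) auto
        also have "\<dots> = e * K" using e by (simp add: power2_eq_square)
        finally show ?case .
      qed
    qed
  qed
qed

end

section \<open>The lattice case\<close>

text \<open>Expresses the distance to the nearest integer through the principal argument, whose
  continuity at \<open>1\<close> then translates convergence of characters into closeness to
  integers.\<close>

lemma dist_round_eq_Arg: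
  fixes y :: real
  shows "\<bar>y - round y\<bar> = \<bar>Arg (echar y)\<bar> / (2 * pi)"
proof -
  define d where "d = y - round y"
  have d: "- (1 / 2) \<le> d" "d < 1 / 2"
    unfolding d_def round_def by linarith+
  have e: "echar y = cis (2 * pi * d)"
  proof -
    have "echar y = echar d"
      unfolding echar_eq_iff d_def by simp
    then show ?thesis by (simp add: echar_def)
  qed
  show ?thesis
  \<comment> \<open>\<open>round\<close> rounds halves up, which gives \<open>d = - 1 / 2\<close>,
    whereas the principal argument of \<open>- 1\<close> is \<open>+ pi\<close>; only the absolute
    values agree.\<close>
  proof (cases "d = - (1 / 2)")
    case True
    then have "echar y = -1" unfolding e by (simp add: cis.ctr complex_eq_iff)
    moreover have "Arg (- 1) = pi" by (rule Arg_unique[of 1]) auto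
    ultimately show ?thesis using True by (simp add: d_def[symmetric])
  next
    case False
    then have "pi * (- (1 / 2)) < pi * d"
      using d by (intro mult_strict_left_mono) auto
    then have "Arg (echar y) = 2 * pi * d"
      unfolding e using d by (intro Arg_unique[of 1]) (auto simp: cis_conv_exp field_simps)
    then show ?thesis by (simp add: d_def[symmetric] abs_mult)
  qed
qed

lemma expanding_echar:
  fixes y :: real and \<beta> :: nat
  assumes \<beta>: "2 \<le> \<beta>" and lim: "(\<lambda>j. echar (y * real \<beta> ^ j)) \<longlonglongrightarrow> 1"
  shows "\<exists>j0. \<forall>j\<ge>j0. y * real \<beta> ^ j \<in> \<int>"
proof (rule expanding_near_integers[OF \<beta>, of y, unfolded of_nat_power])
  have "isCont Arg 1" by (rule continuous_at_Arg) auto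
  from isCont_tendsto_compose[OF this lim]
  have "(\<lambda>j. \<bar>Arg (echar (y * real \<beta> ^ j))\<bar> / (2 * pi)) \<longlonglongrightarrow> \<bar>Arg 1\<bar> / (2 * pi)"
    by (intro tendsto_divide tendsto_rabs tendsto_const) auto
  then show "(\<lambda>j. \<bar>y * real \<beta> ^ j - round (y * real \<beta> ^ j)\<bar>) \<longlonglongrightarrow> 0"
    by (simp add: dist_round_eq_Arg)
qed

context contracting_ifs_base
begin

lemma fourier_self_similar:
  "fourier law \<xi> = (\<integral>i. echar (\<xi> * t i) * fourier law (\<xi> * s i) \<partial>P)"
proof -
  have "fourier law \<xi> = (\<integral>\<omega>. echar (\<xi> * code \<omega>) \<partial>S)"
    unfolding fourier_def by (subst integral_distr) auto
  also have "\<dots> = (\<integral>\<omega>. \<integral>\<omega>'. echar (\<xi> * code (stake 1 \<omega> @- \<omega>')) \<partial>S \<partial>S)"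
    by (rule integral_split[where C = 1]) auto
  also have "\<dots> = (\<integral>\<omega>. echar (\<xi> * t (shd \<omega>)) * fourier law (\<xi> * s (shd \<omega>)) \<partial>S)"
  proof (rule Bochner_Integration.integral_cong[OF refl])
    fix \<omega>
    have "echar (\<xi> * code (stake 1 \<omega> @- \<omega>')) = echar (\<xi> * t (shd \<omega>)) * echar (\<xi> * s (shd \<omega>) * code \<omega>')" for \<omega>'
      by (simp add: code_Stream algebra_simps flip: echar_add)
    then show "(\<integral>\<omega>'. echar (\<xi> * code (stake 1 \<omega> @- \<omega>')) \<partial>S) = echar (\<xi> * t (shd \<omega>)) * fourier law (\<xi> * s (shd \<omega>))"
      unfolding fourier_def by (subst integral_distr) auto
  qed
  also have "\<dots> = (\<integral>i. echar (\<xi> * t i) * fourier law (\<xi> * s i) \<partial>P)"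
    by (rule integral_shd)
  finally show ?thesis .
qed

text \<open>Two letters at a time are used because the words \<open>ij\<close> and \<open>ji\<close>
  have the same contraction, so their terms in the self-similarity relation differ only by a
  phase.\<close>

definition pair_prob :: "nat \<times> nat \<Rightarrow> real" where
  "pair_prob v = pmf P (fst v) * pmf P (snd v)"

definition pair_word :: "nat \<times> nat \<Rightarrow> nat list" where
  "pair_word v = [fst v, snd v]"

lemma fourier_self_similar_pairs:
  assumes fin: "finite (set_pmf P)"
  shows "fourier law \<xi> = (\<Sum>v\<in>set_pmf P \<times> set_pmf P.
      pair_prob v *\<^sub>R (echar (\<xi> * trans (pair_word v)) * fourier law (\<xi> * scale (pair_word v))))"
proof -
  have *: "fourier law \<xi> = (\<Sum>i\<in>set_pmf P. pmf P i *\<^sub>R (echar (\<xi> * t i) * fourier law (\<xi> * s i)))" for \<xi>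
    by (subst fourier_self_similar, rule integral_measure_pmf[OF fin]) auto
  show ?thesis
    by (subst *, subst *)
       (simp add: pair_prob_def pair_word_def sum.cartesian_product' sum_distrib_left scaleR_sum_right
          algebra_simps echar_add)
qed

lemma pair_prob_sum:
  assumes fin: "finite (set_pmf P)"
  shows "(\<Sum>v\<in>set_pmf P \<times> set_pmf P. pair_prob v) = 1"
  using sum_pmf_eq_1[OF fin order_refl]
  by (simp add: pair_prob_def sum.cartesian_product' flip: sum_distrib_left)

end

locale lattice_ifs = contracting_ifs_base +
  fixes q :: nat and h :: "nat \<Rightarrow> nat" and k :: real
  assumes fin: "finite (set_pmf P)" and q_pos: "0 < q"
    and L_lattice: "\<And>i. i \<in> set_pmf P \<Longrightarrow> L [i] = h i / q"
begin

definition \<phi> :: "nat \<Rightarrow> real" where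
  "\<phi> x = G k (b powr (x / q))"

lemma \<phi>_nonneg: "0 \<le> \<phi> x" and \<phi>_le_1: "\<phi> x \<le> 1"
  by (simp_all add: \<phi>_def G_def law.norm_fourier_le_1)

lemma L_stake_lattice:
  assumes "\<And>m. \<omega> !! m \<in> set_pmf P"
  shows "\<exists>n::nat. L (stake m \<omega>) = n / q"
proof (induction m)
  case 0
  then show ?case by (intro exI[of _ 0]) simp
next
  case (Suc m)
  then obtain n where "L (stake m \<omega>) = real n / q" by blast
  then have "L (stake (Suc m) \<omega>) = real (n + h (\<omega> !! m)) / q"
    using L_lattice[OF assms] by (simp only: stake_Suc_L) (simp add: add_divide_distrib)
  then show ?case by blast
qed

text \<open>On the lattice every term equals \<open>\<phi>\<close> at an index at least
  \<open>j\<close>, so the bound holds term by term and no equidistribution is involved.\<close>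

lemma lattice_small:
  assumes \<phi>: "\<phi> \<longlonglongrightarrow> 0" and e: "0 < e"
  shows "\<exists>j0. \<forall>j\<ge>j0. AE \<omega> in S. \<forall>\<^sub>F K in sequentially.
      (\<Sum>m<K. G k (b powr (real j + frac (- L (stake (Suc m) \<omega>))))) \<le> e * real K"
proof -
  \<comment> \<open>The lattice condition is known only for letters in the support.\<close>
  have AE_supp: "AE \<omega> in S. \<forall>m. \<omega> !! m \<in> set_pmf P"
  proof -
    have "AE \<omega> in S. stream_all (\<lambda>i. i \<in> set_pmf P) \<omega>"
      unfolding S_def by (rule prob_space.AE_stream_all[OF measure_pmf.prob_space_axioms]) (auto intro: AE_pmfI)
    then show ?thesis by eventually_elim (simp add: snth_in[unfolded streams_iff_sset] subset_eq)
  qed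
  obtain n0 where n0: "\<And>x. x \<ge> n0 \<Longrightarrow> \<phi> x < e"
    using order_tendstoD(2)[OF \<phi> e] by (auto simp: eventually_sequentially)
  show ?thesis
  proof (intro exI allI impI)
    fix j assume j: "n0 \<le> j"
    from AE_supp show "AE \<omega> in S. \<forall>\<^sub>F K in sequentially.
      (\<Sum>m<K. G k (b powr (real j + frac (- L (stake (Suc m) \<omega>))))) \<le> e * real K"
    proof eventually_elim
      case (elim \<omega>)
      have "G k (b powr (real j + frac (- L (stake m \<omega>)))) \<le> e" for m
      proof -
        obtain n :: nat where n: "L (stake m \<omega>) = n / q" using L_stake_lattice elim by blast
        define a where "a = int j * q + (\<lceil>L (stake m \<omega>)\<rceil> * q - n)"
        have fr: "real j + frac (- L (stake m \<omega>)) = of_int a / q"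
          using q_pos by (simp add: a_def n field_simps flip: ceiling_minus_self)
        have "real j * q \<le> (real j + frac (- L (stake m \<omega>))) * q"
          by (intro mult_right_mono) auto
        then have "real_of_int (int j * q) \<le> of_int a" unfolding fr using q_pos by simp
        then have "int j * q \<le> a" by (simp only: of_int_le_iff)
        moreover have "int j * 1 \<le> int j * q" using q_pos by (intro mult_left_mono) auto
        ultimately have a: "int n0 \<le> a" using j by linarith
        have "G k (b powr (real j + frac (- L (stake m \<omega>)))) = \<phi> (nat a)"
          unfolding \<phi>_def fr using a by simp
        also have "\<dots> < e" using a by (intro n0) linarith
        finally show ?thesis by simp
      qed
      then have "(\<Sum>m<K. G k (b powr (real j + frac (- L (stake (Suc m) \<omega>))))) \<le> (\<Sum>m<K. e)" for K
        by (intro sum_mono) blast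
      then show ?case by (intro always_eventually allI) (simp add: mult.commute)
    qed
  qed
qed

section \<open>The random walk on the integers driven by two-letter words\<close>

definition W where "W = set_pmf P \<times> set_pmf P"
definition hh where "hh v = h (fst v) + h (snd v)"
definition H where "H = Max (hh ` W)"
text \<open>The unweighted term of the word \<open>v\<close> in the two-step self-similarity
  relation at the frequency \<open>k * b powr (x / q)\<close>; \<open>var x\<close> is the variance
  of these terms under \<open>pair_prob\<close>.\<close>

definition z where "z x v = echar (k * b powr (x / q) * trans (pair_word v)) * fourier law (k * b powr (x / q) * scale (pair_word v))"
definition var where "var x = (\<Sum>v\<in>W. \<Sum>w\<in>W. pair_prob v * pair_prob w * (norm (z x v - z x w))\<^sup>2) / 2"

lemma fin_W: "finite W" using fin by (simp add: W_def)

lemma pair_prob_pos: "v \<in> W \<Longrightarrow> 0 < pair_prob v"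
  by (auto simp: W_def pair_prob_def pmf_positive_iff)

lemma L_pair: "v \<in> W \<Longrightarrow> L (pair_word v) = hh v / q"
  using L_append[of "[fst v]" "[snd v]"] L_lattice by (auto simp: W_def pair_word_def hh_def add_divide_distrib)

lemma hh_le: "v \<in> W \<Longrightarrow> hh v \<le> H"
  unfolding H_def by (rule Max_ge) (auto simp: fin_W)

lemma h_pos: "i \<in> set_pmf P \<Longrightarrow> 0 < h i"
  using L_lattice[of i] L_single(1)[of i] lmin_pos q_pos by (cases "h i") auto

lemma hh_pos: "v \<in> W \<Longrightarrow> 0 < hh v"
  by (auto simp: W_def hh_def h_pos)

text \<open>Contraction by a word divides the frequency by \<open>b powr L\<close>, which on the
  lattice is a shift of the index by \<open>hh v\<close>. For \<open>H \<le> x\<close> the shifted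
  index stays a natural number.\<close>

lemma norm_fourier_pair:
  assumes v: "v \<in> W" and x: "H \<le> x"
  shows "norm (fourier law (k * b powr (x / q) * scale (pair_word v))) = \<phi> (x - hh v)"
proof -
  have "norm (fourier law (k * b powr (x / q) * scale (pair_word v)))
      = norm (fourier law (k * (b powr (x / q) * scale (pair_word v))))" by (simp add: mult.assoc)
  also have "\<dots> = norm (fourier law (k * \<bar>b powr (x / q) * scale (pair_word v)\<bar>))"
    by (rule law.norm_fourier_mult_abs[symmetric])
  also have "\<bar>b powr (x / q) * scale (pair_word v)\<bar> = b powr (x / q - L (pair_word v))"
    using b_ge_2 by (simp add: abs_mult powr_diff powr_minus divide_inverse flip: powr_L)
  also have "x / q - L (pair_word v) = real (x - hh v) / q"
    using hh_le[OF v] x by (simp add: L_pair[OF v] of_nat_diff diff_divide_distrib)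
  finally show ?thesis by (simp add: \<phi>_def G_def)
qed

lemma norm_z: "v \<in> W \<Longrightarrow> H \<le> x \<Longrightarrow> norm (z x v) = \<phi> (x - hh v)"
  by (simp add: z_def norm_mult norm_fourier_pair)

lemma variance_identity:
  assumes "H \<le> x"
  shows "(\<phi> x)\<^sup>2 + var x = (\<Sum>v\<in>W. pair_prob v * (\<phi> (x - hh v))\<^sup>2)"
proof -
  have "\<phi> x = norm (\<Sum>v\<in>W. pair_prob v *\<^sub>R z x v)"
    unfolding \<phi>_def G_def z_def W_def by (subst fourier_self_similar_pairs[OF fin]) simp
  then have "(\<phi> x)\<^sup>2 + var x = (\<Sum>v\<in>W. pair_prob v * (norm (z x v))\<^sup>2)"
    unfolding var_def using weighted_variance[OF fin_W, of pair_prob "z x"] pair_prob_sum[OF fin]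
    by (simp add: W_def)
  also have "\<dots> = (\<Sum>v\<in>W. pair_prob v * (\<phi> (x - hh v))\<^sup>2)"
    by (intro sum.cong) (auto simp: norm_z assms)
  finally show ?thesis .
qed

sublocale subharmonic W pair_prob hh "\<lambda>x. (\<phi> x)\<^sup>2" var H
proof
  show "(\<Sum>v\<in>W. pair_prob v) = 1" unfolding W_def by (rule pair_prob_sum[OF fin])
  show "(\<phi> x)\<^sup>2 + var x \<le> (\<Sum>v\<in>W. pair_prob v * (\<phi> (x - hh v))\<^sup>2)" if "H \<le> x" for x
    using variance_identity[OF that] by simp
  show "0 \<le> var x" for x
    unfolding var_def by (intro divide_nonneg_nonneg sum_nonneg mult_nonneg_nonneg) (auto intro: less_imp_le pair_prob_pos)
qed (use fin_W pair_prob_pos hh_pos hh_le in auto)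

text \<open>All summands of \<open>var x\<close> are nonnegative, so each squared difference is at
  most a fixed multiple of \<open>var x\<close>, which tends to \<open>0\<close> by
  \<open>\<epsilon>_tendsto_0\<close>.\<close>

lemma z_diff_tendsto_0:
  assumes v: "v \<in> W" and w: "w \<in> W"
  shows "(\<lambda>x. z x v - z x w) \<longlonglongrightarrow> 0"
proof -
  let ?c = "pair_prob v * pair_prob w"
  have c: "0 < ?c" using v w by (intro mult_pos_pos pair_prob_pos)
  have le: "?c * (norm (z x v - z x w))\<^sup>2 \<le> 2 * var x" for x
  proof -
    have "?c * (norm (z x v - z x w))\<^sup>2 \<le> (\<Sum>w\<in>W. pair_prob v * pair_prob w * (norm (z x v - z x w))\<^sup>2)"
      using w by (intro member_le_sum fin_W mult_nonneg_nonneg) (auto intro: less_imp_le pair_prob_pos v)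
    also have "\<dots> \<le> (\<Sum>v\<in>W. \<Sum>w\<in>W. pair_prob v * pair_prob w * (norm (z x v - z x w))\<^sup>2)"
      using v by (intro member_le_sum[of v W "\<lambda>v. \<Sum>w\<in>W. pair_prob v * pair_prob w * (norm (z x v - z x w))\<^sup>2"]
          fin_W sum_nonneg mult_nonneg_nonneg) (auto intro: less_imp_le pair_prob_pos)
    finally show ?thesis by (simp add: var_def)
  qed
  have "(\<lambda>x. sqrt (2 * var x / ?c)) \<longlonglongrightarrow> sqrt (2 * 0 / ?c)"
    using c by (intro tendsto_intros \<epsilon>_tendsto_0) auto
  then have lim: "(\<lambda>x. sqrt (2 * var x / ?c)) \<longlonglongrightarrow> 0" by simp
  show ?thesis
  proof (rule Lim_null_comparison[OF always_eventually lim], rule allI)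
    fix x
    show "norm (z x v - z x w) \<le> sqrt (2 * var x / ?c)"
      using le[of x] c by (intro real_le_rsqrt) (simp add: field_simps)
  qed
qed

lemma \<psi>_diff_tendsto_0:
  assumes v: "v \<in> W" and w: "w \<in> W"
  shows "(\<lambda>x. (\<phi> (x - hh v))\<^sup>2 - (\<phi> (x - hh w))\<^sup>2) \<longlonglongrightarrow> 0"
proof (rule Lim_null_comparison)
  show "\<forall>\<^sub>F x in sequentially. norm ((\<phi> (x - hh v))\<^sup>2 - (\<phi> (x - hh w))\<^sup>2) \<le> 2 * norm (z x v - z x w)"
    using eventually_ge_at_top[of H]
  proof eventually_elim
    case (elim x)
    let ?a = "\<phi> (x - hh v)" and ?b = "\<phi> (x - hh w)"
    have "norm (?a\<^sup>2 - ?b\<^sup>2) = \<bar>?a + ?b\<bar> * \<bar>?a - ?b\<bar>"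
      by (simp add: power2_eq_square flip: abs_mult) (simp add: algebra_simps)
    also have "\<dots> \<le> 2 * norm (z x v - z x w)"
    proof (intro mult_mono)
      show "\<bar>?a + ?b\<bar> \<le> 2" using \<phi>_nonneg \<phi>_le_1 by (smt (verit))
      show "\<bar>?a - ?b\<bar> \<le> norm (z x v - z x w)"
        using norm_triangle_ineq3[of "z x v" "z x w"] by (simp add: norm_z v w elim)
    qed auto
    finally show ?case .
  qed
  show "(\<lambda>x. 2 * norm (z x v - z x w)) \<longlonglongrightarrow> 0"
    using tendsto_mult_left[OF tendsto_norm[OF z_diff_tendsto_0[OF v w]], of 2] by simp
qed

text \<open>The terms for \<open>ij\<close> and \<open>ji\<close> have a common factor of modulus at
  least \<open>sqrt c\<close> along a progression, so their phases must agree asymptotically there.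
  The frequencies grow by the integer factor \<open>b ^ d\<close>, and
  \<open>expanding_echar\<close> upgrades this to integrality.\<close>

lemma commutator_integrality:
  assumes not: "\<not> \<phi> \<longlonglongrightarrow> 0" and i: "i \<in> set_pmf P" and j: "j \<in> set_pmf P"
  shows "\<exists>\<rho>\<in>\<rat>. 0 < \<rho> \<and> k * (trans [i, j] - trans [j, i]) * b powr \<rho> \<in> \<int>"
proof -
  have not': "\<not> (\<lambda>x. (\<phi> x)\<^sup>2) \<longlonglongrightarrow> 0"
  proof
    assume "(\<lambda>x. (\<phi> x)\<^sup>2) \<longlonglongrightarrow> 0"
    from tendsto_real_sqrt[OF this] have "\<phi> \<longlonglongrightarrow> 0" by (simp add: \<phi>_nonneg)
    with not show False by contradiction
  qed
  from persistence[OF \<psi>_diff_tendsto_0 not'] obtain d x0 c where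
    d: "0 < d" and c: "0 < c" and lower: "\<And>n. c \<le> (\<phi> (x0 + d * n))\<^sup>2" by blast
  let ?v = "(i, j)" and ?w = "(j, i)"
  have vw: "?v \<in> W" "?w \<in> W" using i j by (auto simp: W_def)
  define D where "D = trans [i, j] - trans [j, i]"
  define g where "g = hh ?v"
  \<comment> \<open>The summand \<open>g\<close> compensates the shift by \<open>hh ?v\<close>; the
    last summand forces \<open>H \<le> xs n\<close> while staying on the progression.\<close>
  define x1 where "x1 = x0 + g + d * q * H"
  \<comment> \<open>The factor \<open>q\<close> in the step makes \<open>b powr (xs n / q)\<close>
    grow by the integer \<open>b ^ d\<close> each time.\<close>
  define xs where "xs n = x1 + d * q * n" for n
  have xs_ge: "H \<le> xs n" for n
  proof -
    have "1 * H \<le> d * q * H" using d q_pos by (intro mult_right_mono) auto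
    then show ?thesis unfolding xs_def x1_def by linarith
  qed
  have sub: "filterlim xs at_top sequentially"
    using d q_pos by (intro filterlim_subseq) (auto simp: strict_mono_def xs_def)
  have eq: "norm (z (xs n) ?v - z (xs n) ?w) = norm (echar (k * b powr (xs n / q) * D) - 1) * \<phi> (xs n - g)" for n
  proof -
    let ?y = "k * b powr (xs n / q)"
    have sc: "scale (pair_word ?w) = scale (pair_word ?v)" by (simp add: pair_word_def)
    have "z (xs n) ?v - z (xs n) ?w
      = echar (?y * trans [j, i]) * (echar (?y * D) - 1) * fourier law (?y * scale (pair_word ?v))"
      unfolding z_def sc by (simp add: pair_word_def D_def algebra_simps flip: echar_add)
    then show ?thesis
      using norm_fourier_pair[OF vw(1) xs_ge, of n] by (simp add: norm_mult g_def)
  qed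
  have lower': "sqrt c \<le> \<phi> (xs n - g)" for n
  proof -
    have "xs n - g = x0 + d * (q * H + q * n)" by (simp add: xs_def x1_def algebra_simps)
    then show ?thesis using lower[of "q * H + q * n"] \<phi>_nonneg by (intro real_le_lsqrt) simp_all
  qed
  have "(\<lambda>n. echar (k * b powr (xs n / q) * D) - 1) \<longlonglongrightarrow> 0"
  proof (rule Lim_null_comparison[OF always_eventually], rule allI)
    fix n
    have "norm (echar (k * b powr (xs n / q) * D) - 1) * sqrt c \<le> norm (z (xs n) ?v - z (xs n) ?w)"
      unfolding eq using lower'[of n] by (intro mult_left_mono) auto
    then show "norm (echar (k * b powr (xs n / q) * D) - 1) \<le> norm (z (xs n) ?v - z (xs n) ?w) / sqrt c"
      using c by (simp add: field_simps)
  next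
    have "(\<lambda>n. norm (z (xs n) ?v - z (xs n) ?w) / sqrt c) \<longlonglongrightarrow> norm (0::complex) / sqrt c"
      using c by (intro tendsto_intros filterlim_compose[OF z_diff_tendsto_0[OF vw] sub]) auto
    then show "(\<lambda>n. norm (z (xs n) ?v - z (xs n) ?w) / sqrt c) \<longlonglongrightarrow> 0" by simp
  qed
  then have lim: "(\<lambda>n. echar (k * b powr (xs n / q) * D)) \<longlonglongrightarrow> 1"
    by (simp add: LIM_zero_iff)
  have pw: "b powr (xs n / q) = b powr (x1 / q) * real (b ^ d) ^ n" for n
  proof -
    have "real (xs n) / q = x1 / q + real (d * n)" using q_pos by (simp add: xs_def field_simps)
    then show ?thesis using b_ge_2 by (simp add: powr_add powr_realpow power_mult del: of_nat_mult)
  qed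
  have "2 \<le> b ^ d" using b_ge_2 d by (meson order_trans self_le_power le_trans one_le_numeral)
  moreover have "(\<lambda>n. echar (k * b powr (x1 / q) * D * real (b ^ d) ^ n)) \<longlonglongrightarrow> 1"
    using lim unfolding pw by (simp add: mult_ac)
  ultimately obtain n where "k * b powr (x1 / q) * D * real (b ^ d) ^ n \<in> \<int>"
    using expanding_echar by blast
  then have "k * D * b powr (xs n / q) \<in> \<int>" unfolding pw by (simp add: mult_ac)
  \<comment> \<open>Positivity of the exponent comes from the summand
    \<open>g = hh ?v\<close>.\<close>
  moreover have "0 < xs n" using hh_pos[OF vw(1)] by (simp add: xs_def x1_def g_def)
  ultimately show ?thesis
    using q_pos by (intro bexI[of _ "xs n / q"]) (auto simp: D_def)
qed

end

section \<open>Self-similar measures\<close>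

context contracting_ifs_base
begin

text \<open>Failure of the Weyl averages rules out the non-lattice case, and then, on the lattice,
  convergence of \<open>\<phi>\<close> to \<open>0\<close>; what remains is covered by
  \<open>commutator_integrality\<close>.\<close>

lemma dichotomy:
  fixes k :: real
  assumes fin: "finite (set_pmf P)" and na: "\<And>x. emeasure law {x} = 0" and k: "k \<noteq> 0"
    and not: "\<not> (AE \<omega> in S. (\<lambda>N. norm (\<Sum>n<N. echar (k * real b ^ n * code \<omega>)) / real N) \<longlonglongrightarrow> 0)"
  shows "(\<forall>i\<in>set_pmf P. L [i] \<in> \<rat>) \<and>
    (\<forall>i\<in>set_pmf P. \<forall>j\<in>set_pmf P. \<exists>\<rho>\<in>\<rat>. 0 < \<rho> \<and> k * (trans [i, j] - trans [j, i]) * b powr \<rho> \<in> \<int>)"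
proof -
  have "\<exists>j::int. j \<noteq> 0 \<and> (\<forall>i\<in>set_pmf P. of_int j * L [i] \<in> \<int>)"
    using AE_weyl_average[OF nonlattice_small[OF _ na k]] not by blast
  then obtain j :: int where j: "j \<noteq> 0" "\<And>i. i \<in> set_pmf P \<Longrightarrow> of_int j * L [i] \<in> \<int>" by blast
  \<comment> \<open>The sign of \<open>j\<close> is dropped; as \<open>L\<close> is nonnegative,
    \<open>q * L [i]\<close> is then a natural number.\<close>
  define q where "q = nat \<bar>j\<bar>"
  define h where "h i = nat \<lfloor>real q * L [i]\<rfloor>" for i
  have q: "0 < q" using j(1) by (simp add: q_def)
  have Lh: "L [i] = h i / q" if i: "i \<in> set_pmf P" for i
  proof -
    have "real q * L [i] = of_int j * L [i] \<or> real q * L [i] = - (of_int j * L [i])"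
      by (auto simp: q_def abs_if)
    then have "real q * L [i] \<in> \<int>" using j(2)[OF i] by auto
    moreover have "0 \<le> real q * L [i]" by (simp add: L_nonneg)
    ultimately have "real (h i) = real q * L [i]" by (auto simp: h_def elim!: Ints_cases)
    then show ?thesis using q by (simp add: field_simps)
  qed
  interpret lattice_ifs P s t r0 r T b q h k
    by unfold_locales (use fin q Lh in auto)
  have "\<not> \<phi> \<longlonglongrightarrow> 0"
    using AE_weyl_average[OF lattice_small] not by blast
  then show ?thesis
    using commutator_integrality by (auto simp: Lh)
qed

end

section \<open>Identification of the given measure with the law of the coding, and the passage to
  normality\<close>

lemma (in borel_prob) fourier_0: "fourier \<nu> 0 = 1"
  using prob_space by (simp add: fourier_def)

text \<open>The difference at \<open>\<xi>\<close> is a weighted mean, up to phases, of the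
  differences at the smaller points \<open>\<xi> * s i\<close>. Iteration reaches a neighbourhood of
  \<open>0\<close>, where continuity makes the difference small.\<close>

lemma char_unique_self_similar:
  fixes u v :: "real \<Rightarrow> complex" and s t :: "nat \<Rightarrow> real"
  assumes u: "\<And>\<xi>. u \<xi> = (\<Sum>i\<in>I. p i *\<^sub>R (echar (\<xi> * t i) * u (\<xi> * s i)))"
    and v: "\<And>\<xi>. v \<xi> = (\<Sum>i\<in>I. p i *\<^sub>R (echar (\<xi> * t i) * v (\<xi> * s i)))"
    and p: "\<And>i. i \<in> I \<Longrightarrow> 0 \<le> p i" "(\<Sum>i\<in>I. p i) = 1"
    and s: "\<And>i. i \<in> I \<Longrightarrow> \<bar>s i\<bar> \<le> r" and r: "0 < r" "r < 1"
    and cont: "isCont u 0" "isCont v 0" and eq0: "u 0 = v 0"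
  shows "u = v"
proof
  fix \<xi>
  have step: "norm (u \<xi> - v \<xi>) \<le> e" if "\<And>i. i \<in> I \<Longrightarrow> norm (u (\<xi> * s i) - v (\<xi> * s i)) \<le> e" for \<xi> e
  proof -
    have "u \<xi> - v \<xi> = (\<Sum>i\<in>I. p i *\<^sub>R (echar (\<xi> * t i) * (u (\<xi> * s i) - v (\<xi> * s i))))"
      by (subst u, subst v) (simp add: right_diff_distrib scaleR_diff_right sum_subtractf)
    also have "norm \<dots> \<le> (\<Sum>i\<in>I. p i * e)"
      by (rule sum_norm_le) (use p(1) that in \<open>auto simp: norm_mult intro!: mult_left_mono\<close>)
    also have "\<dots> = e" using p(2) by (simp flip: sum_distrib_right)
    finally show ?thesis .
  qed
  have "norm (u \<xi> - v \<xi>) \<le> e" if e: "0 < e" for e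
  proof -
    have "isCont (\<lambda>\<xi>. u \<xi> - v \<xi>) 0" by (intro continuous_intros cont)
    then obtain d where d: "0 < d" "\<And>\<xi>. \<bar>\<xi>\<bar> < d \<Longrightarrow> norm (u \<xi> - v \<xi>) < e"
      using e eq0 unfolding continuous_at_eps_delta by (auto simp: dist_norm)
    have scales: "norm (u \<xi> - v \<xi>) \<le> e" if "\<bar>\<xi>\<bar> * r ^ n < d" for n \<xi>
      using that
    proof (induction n arbitrary: \<xi>)
      case 0
      then show ?case using d(2)[of \<xi>] by simp
    next
      case (Suc n)
      show ?case
      proof (rule step, rule Suc.IH)
        fix i assume "i \<in> I"
        then have "\<bar>\<xi>\<bar> * \<bar>s i\<bar> * r ^ n \<le> \<bar>\<xi>\<bar> * r * r ^ n"
          using s r by (intro mult_right_mono mult_left_mono) auto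
        then show "\<bar>\<xi> * s i\<bar> * r ^ n < d" using Suc.prems by (simp add: abs_mult mult_ac)
      qed
    qed
    have "(\<lambda>n. \<bar>\<xi>\<bar> * r ^ n) \<longlonglongrightarrow> 0"
      by (rule tendsto_mult_right_zero, rule LIMSEQ_realpow_zero) (use r in auto)
    then obtain n where "\<bar>\<xi>\<bar> * r ^ n < d"
      using order_tendstoD(2)[OF _ d(1)] by (metis eventually_sequentially order_refl)
    then show ?thesis by (rule scales)
  qed
  then have "norm (u \<xi> - v \<xi>) \<le> 0" by (rule field_le_epsilon[of _ 0, simplified])
  then show "u \<xi> = v \<xi>" by simp
qed

text \<open>Stated for positive iterates: the zeroth is \<open>x\<close> itself, which need not lie
  in the unit interval.\<close>

lemma Tmap_iterate: "(Tmap (int b) ^^ Suc n) x = frac (real b ^ Suc n * x)"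
proof (induction n)
  case 0
  then show ?case by (simp add: Tmap_def)
next
  case (Suc n)
  have "real b * frac (real b ^ Suc n * x) = real b ^ Suc (Suc n) * x + of_int (- int b * \<lfloor>real b ^ Suc n * x\<rfloor>)"
    by (simp add: frac_def algebra_simps)
  then have "frac (real b * frac (real b ^ Suc n * x)) = frac (real b ^ Suc (Suc n) * x)"
    by (simp only: frac_add_of_int_right)
  then show ?case using Suc by (simp add: Tmap_def)
qed

lemma normal_to_base_if_weyl:
  assumes weyl: "\<And>k::int. k \<noteq> 0 \<Longrightarrow> (\<lambda>N. norm (\<Sum>n<N. echar (of_int k * real b ^ n * x)) / real N) \<longlonglongrightarrow> 0"
    and b: "2 \<le> b"
  shows "normal_to_base (int b) x"
  unfolding normal_to_base_iff_continuous
proof (intro allI impI)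
  fix \<phi> :: "real \<Rightarrow> real" assume cont: "continuous_on {0..1} \<phi>"
  have "weyl_null (\<lambda>n. real b ^ Suc n * x)"
    unfolding weyl_null_def
  proof (intro allI impI)
    fix j :: int assume j: "j \<noteq> 0"
    \<comment> \<open>The empirical averages start at the first iterate; the extra factor
      \<open>b\<close> is absorbed into the frequency.\<close>
    have "(\<lambda>N. norm (\<Sum>n<N. echar (of_int (j * int b) * real b ^ n * x)) / real N) \<longlonglongrightarrow> 0"
      by (rule weyl) (use j b in auto)
    then have "(\<lambda>N. norm ((\<Sum>n<N. echar (of_int j * (real b ^ Suc n * x))) / of_nat N)) \<longlonglongrightarrow> 0"
      by (simp add: norm_divide mult_ac)
    then show "(\<lambda>N. (\<Sum>n<N. echar (of_int j * (real b ^ Suc n * x))) / of_nat N) \<longlonglongrightarrow> 0"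
      by (rule tendsto_norm_zero_cancel)
  qed
  from weyl_equidistribution[OF this cont]
  have "(\<lambda>N. (\<Sum>n<N. \<phi> ((Tmap (int b) ^^ Suc n) x)) / real N) \<longlonglongrightarrow> integral {0..1} \<phi>"
    by (simp only: Tmap_iterate)
  moreover have "(\<Sum>n<N. \<phi> ((Tmap (int b) ^^ Suc n) x)) = (\<Sum>n=1..N. \<phi> ((Tmap (int b) ^^ n) x))" for N
    by (rule sum.reindex_bij_witness[of _ "\<lambda>n. n - 1" Suc]) auto
  moreover have "integral {0..1} \<phi> = (LBINT y:{0..1}. \<phi> y)"
    using set_borel_integral_eq_integral(2)[OF borel_integrable_atLeastAtMost'[OF cont]] by simp
  ultimately show "(\<lambda>N. (\<Sum>n=1..N. \<phi> ((Tmap (int b) ^^ n) x)) / real N) \<longlonglongrightarrow> (LBINT y:{0..1}. \<phi> y)"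
    by simp
qed

text \<open>The identity for sets says that \<open>\<nu>\<close> is the image of the product of
  \<open>P\<close> and \<open>\<nu>\<close> under \<open>F\<close>; the relation for transforms
  follows by Fubini.\<close>

lemma self_similar_measure_fourier:
  fixes s t :: "nat \<Rightarrow> real"
  assumes \<nu>: "borel_prob \<nu>" and p: "\<And>i. i \<in> I \<Longrightarrow> 0 < p i" "(\<Sum>i\<in>I. p i) = 1" and I: "finite I"
    and meas: "\<And>i. i \<in> I \<Longrightarrow> f i = (\<lambda>x. s i * x + t i)"
    and eq: "\<And>A. A \<in> sets borel \<Longrightarrow> measure \<nu> A = (\<Sum>i\<in>I. p i * measure (distr \<nu> borel (f i)) A)"
    and P: "\<And>i. pmf P i = (if i \<in> I then p i else 0)"
  shows "fourier \<nu> \<xi> = (\<Sum>i\<in>I. p i *\<^sub>R (echar (\<xi> * t i) * fourier \<nu> (\<xi> * s i)))"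
proof -
  interpret borel_prob \<nu> by fact
  have setP: "set_pmf P = I"
    using p(1) by (force simp: set_pmf_eq P)
  interpret PM: pair_prob_space "measure_pmf P" \<nu> ..
  define F where "F z = s (fst z) * snd z + t (fst z)" for z :: "nat \<times> real"
  have [measurable]: "F \<in> borel_measurable (measure_pmf P \<Otimes>\<^sub>M \<nu>)"
    unfolding F_def by measurable
  have \<nu>_eq: "\<nu> = distr (measure_pmf P \<Otimes>\<^sub>M \<nu>) borel F"
  proof (rule measure_eqI)
    fix A assume "A \<in> sets \<nu>"
    then have A [measurable]: "A \<in> sets borel" by simp
    have "emeasure (distr (measure_pmf P \<Otimes>\<^sub>M \<nu>) borel F) A = (\<integral>\<^sup>+z. indicator A (F z) \<partial>(measure_pmf P \<Otimes>\<^sub>M \<nu>))"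
      by (subst nn_integral_indicator[symmetric], simp, subst nn_integral_distr) auto
    also have "\<dots> = (\<integral>\<^sup>+i. \<integral>\<^sup>+x. indicator A (s i * x + t i) \<partial>\<nu> \<partial>P)"
      by (subst nn_integral_fst[symmetric]) (auto simp: F_def)
    also have "\<dots> = (\<Sum>i\<in>I. (\<integral>\<^sup>+x. indicator A (s i * x + t i) \<partial>\<nu>) * ennreal (p i))"
      using I by (subst nn_integral_measure_pmf_finite) (auto simp: setP P)
    also have "\<dots> = (\<Sum>i\<in>I. ennreal (p i * measure (distr \<nu> borel (f i)) A))"
    proof (rule sum.cong[OF refl])
      fix i assume i: "i \<in> I"
      have [measurable]: "f i \<in> borel_measurable borel" by (simp add: meas[OF i])
      interpret D: prob_space "distr \<nu> borel (f i)" by (rule prob_space_distr) measurable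
      have "(\<integral>\<^sup>+x. indicator A (s i * x + t i) \<partial>\<nu>) = emeasure (distr \<nu> borel (f i)) A"
        by (subst nn_integral_indicator[symmetric], simp, subst nn_integral_distr) (auto simp: meas[OF i])
      then show "(\<integral>\<^sup>+x. indicator A (s i * x + t i) \<partial>\<nu>) * ennreal (p i) = ennreal (p i * measure (distr \<nu> borel (f i)) A)"
        using p(1)[OF i] by (simp add: D.emeasure_eq_measure ennreal_mult' mult.commute)
    qed
    also have "\<dots> = ennreal (measure \<nu> A)"
      using p(1) by (subst sum_ennreal) (auto simp: eq less_imp_le)
    finally show "emeasure \<nu> A = emeasure (distr (measure_pmf P \<Otimes>\<^sub>M \<nu>) borel F) A"
      by (simp add: emeasure_eq_measure)
  qed simp
  have "fourier \<nu> \<xi> = (\<integral>z. echar (\<xi> * F z) \<partial>(measure_pmf P \<Otimes>\<^sub>M \<nu>))"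
    unfolding fourier_def by (subst \<nu>_eq, subst integral_distr) auto
  also have "\<dots> = (\<integral>i. \<integral>x. echar (\<xi> * F (i, x)) \<partial>\<nu> \<partial>P)"
    by (rule PM.integral_fst'[symmetric]) (rule PM.P.integrable_const_bound[of _ 1], auto)
  also have "\<dots> = (\<integral>i. echar (\<xi> * t i) * fourier \<nu> (\<xi> * s i) \<partial>P)"
  proof (rule Bochner_Integration.integral_cong[OF refl])
    fix i
    have "echar (\<xi> * F (i, x)) = echar (\<xi> * t i) * echar (\<xi> * s i * x)" for x
      by (simp add: F_def algebra_simps flip: echar_add)
    then show "(\<integral>x. echar (\<xi> * F (i, x)) \<partial>\<nu>) = echar (\<xi> * t i) * fourier \<nu> (\<xi> * s i)"
      by (simp add: fourier_def)
  qed
  also have "\<dots> = (\<Sum>i\<in>I. p i *\<^sub>R (echar (\<xi> * t i) * fourier \<nu> (\<xi> * s i)))"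
    by (subst integral_measure_pmf[of I]) (auto simp: I setP P)
  finally show ?thesis .
qed

theorem theorem1p1:
  fixes \<nu> :: "real measure" and l :: nat and f :: "nat \<Rightarrow> real \<Rightarrow> real"
  assumes "self_similar_IFS l f"
    and "self_similar_measure l f \<nu>"
    and "non_atomic \<nu>"
    and "\<not> pointwise_absolutely_normal \<nu>"
  shows "\<exists>g :: real \<Rightarrow> real.
    (\<exists>\<alpha> \<beta>. \<alpha> \<noteq> 0 \<and> g = (\<lambda>x. \<alpha> * x + \<beta>)) \<and>
    (\<exists>b :: int. b > 1 \<and>
      (\<forall>i\<in>{1..l}. \<exists>s t :: real.
         inv g \<circ> f i \<circ> g = (\<lambda>x. s * x + t) \<and>
         ln \<bar>s\<bar> / ln (real_of_int b) \<in> \<rat> \<and>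
         (\<exists>(k :: int) (q :: real). q \<in> \<rat> \<and> q > 0 \<and>
            t = real_of_int k / real_of_int b powr q)))"
proof -
  have "\<forall>i. \<exists>c. i \<in> {1..l} \<longrightarrow> -1 < fst c \<and> fst c < 1 \<and> fst c \<noteq> 0 \<and> f i = (\<lambda>x. fst c * x + snd c)"
    using assms(1) unfolding self_similar_IFS_def similarity_def by (metis fst_conv snd_conv)
  then obtain c where c: "\<And>i. i \<in> {1..l} \<Longrightarrow> -1 < fst (c i) \<and> fst (c i) < 1 \<and> fst (c i) \<noteq> 0 \<and> f i = (\<lambda>x. fst (c i) * x + snd (c i))"
    by metis
  \<comment> \<open>Indices outside the range get the filler map with slope \<open>1 / 2\<close> and
    translation \<open>0\<close>, so that the locale bounds hold for all natural numbers.\<close>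
  define s where "s i = (if i \<in> {1..l} then fst (c i) else 1 / 2)" for i
  define t where "t i = (if i \<in> {1..l} then snd (c i) else 0)" for i
  have f: "f i = (\<lambda>x. s i * x + t i)" if "i \<in> {1..l}" for i
    using c[OF that] that by (simp add: s_def t_def)
  have s: "0 < \<bar>s i\<bar>" "\<bar>s i\<bar> < 1" for i
    using c[of i] by (auto simp: s_def)
  obtain i1 where i1: "i1 \<in> {1..l}"
    using assms(1) unfolding self_similar_IFS_def by blast
  \<comment> \<open>The index \<open>0\<close> represents all filler maps, so extrema over the
    finite set \<open>{0..l}\<close> bound every index.\<close>
  define r0 where "r0 = Min ((\<lambda>i. \<bar>s i\<bar>) ` {0..l})"
  define r where "r = Max ((\<lambda>i. \<bar>s i\<bar>) ` {0..l})"
  define T where "T = Max ((\<lambda>i. \<bar>t i\<bar>) ` {0..l})"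
  have outside: "s i = s 0" "t i = t 0" if "i \<notin> {0..l}" for i
    using that by (auto simp: s_def t_def)
  interpret contr: contracting_ifs P s t r0 r T for P
  proof
    show "0 < r0" unfolding r0_def by (subst Min_gr_iff) (use s in auto)
    show "r < 1" unfolding r_def by (subst Max_less_iff) (use s in auto)
    fix i
    have i': "\<exists>i'\<in>{0..l}. s i = s i' \<and> t i = t i'"
      using outside[of i] by (cases "i \<in> {0..l}") auto
    then show "r0 \<le> \<bar>s i\<bar>" unfolding r0_def by (intro Min_le) auto
    from i' show "\<bar>s i\<bar> \<le> r" unfolding r_def by (intro Max_ge) auto
    from i' show "\<bar>t i\<bar> \<le> T" unfolding T_def by (intro Max_ge) auto
  qed
  from assms(2) obtain p where \<nu>: "real_distribution \<nu>"
    and p: "\<And>i. i \<in> {1..l} \<Longrightarrow> 0 < p i" "(\<Sum>i=1..l. p i) = 1"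
    and eq: "\<And>A. A \<in> sets borel \<Longrightarrow> measure \<nu> A = (\<Sum>i=1..l. p i * measure (distr \<nu> borel (f i)) A)"
    unfolding self_similar_measure_def by blast
  interpret \<nu>: real_distribution \<nu> by fact
  have \<nu>': "borel_prob \<nu>"
    by (intro borel_prob.intro borel_prob_axioms.intro) (auto intro: \<nu>.prob_space_axioms)
  define P where "P = embed_pmf (\<lambda>i. if i \<in> {1..l} then p i else 0)"
  have P: "pmf P i = (if i \<in> {1..l} then p i else 0)" for i
    unfolding P_def
  proof (rule pmf_embed_pmf)
    show "0 \<le> (if i \<in> {1..l} then p i else 0)" for i using p(1)[of i] by auto
    have "(\<integral>\<^sup>+i. ennreal (if i \<in> {1..l} then p i else 0) \<partial>count_space UNIV) = (\<Sum>i=1..l. ennreal (p i))"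
      by (subst nn_integral_count_space'[of "{1..l}"]) auto
    also have "\<dots> = 1" using p by (subst sum_ennreal) (auto intro: less_imp_le)
    finally show "(\<integral>\<^sup>+i. ennreal (if i \<in> {1..l} then p i else 0) \<partial>count_space UNIV) = 1" .
  qed
  have setP: "set_pmf P = {1..l}"
    unfolding set_pmf_eq P using p(1) by (auto simp: less_le)
  have \<nu>_law: "\<nu> = distr (contr.S P) borel contr.code"
  proof -
    \<comment> \<open>Any base gives access to the Fourier facts about \<open>law\<close>;
      \<open>2\<close> is chosen here, before the base where normality fails is known.\<close>
    interpret contracting_ifs_base P s t r0 r T 2 by unfold_locales simp
    have "fourier \<nu> = fourier law"
    proof (rule char_unique_self_similar[where I = "{1..l}" and p = p and s = s and t = t and r = r])
      show "fourier \<nu> \<xi> = (\<Sum>i\<in>{1..l}. p i *\<^sub>R (echar (\<xi> * t i) * fourier \<nu> (\<xi> * s i)))" for \<xi>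
        by (rule self_similar_measure_fourier[OF \<nu>' p _ f eq P]) auto
      show "fourier law \<xi> = (\<Sum>i\<in>{1..l}. p i *\<^sub>R (echar (\<xi> * t i) * fourier law (\<xi> * s i)))" for \<xi>
        by (subst fourier_self_similar, subst integral_measure_pmf[of "{1..l}"]) (auto simp: setP P)
      show "fourier \<nu> 0 = fourier law 0"
        by (simp only: borel_prob.fourier_0[OF \<nu>'] law.fourier_0)
    qed (use p contr.r_pos contr.r_lt_1 contr.s_le borel_prob.isCont_fourier[OF \<nu>'] law.isCont_fourier in \<open>auto intro: less_imp_le\<close>)
    then have "char \<nu> (2 * pi * (x / (2 * pi))) = char law (2 * pi * (x / (2 * pi)))" for x
      by (simp only: borel_prob.fourier_eq_char[OF \<nu>', symmetric] law.fourier_eq_char[symmetric])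
    then have "char \<nu> = char law" by (simp add: fun_eq_iff)
    from Levy_uniqueness[OF \<nu> law.real_distribution this] show ?thesis
      .
  qed
  have "\<exists>b::nat. 2 \<le> b \<and> \<not> (AE x in \<nu>. normal_to_base (int b) x)"
  proof (rule ccontr)
    assume "\<not> ?thesis"
    then have *: "AE x in \<nu>. normal_to_base (int b) x" if "2 \<le> b" for b using that by blast
    have "AE x in \<nu>. \<forall>b::nat. 2 \<le> b \<longrightarrow> normal_to_base (int b) x"
      by (subst AE_all_countable) (auto intro: *)
    then have "AE x in \<nu>. absolutely_normal x"
    proof eventually_elim
      case (elim x)
      show ?case
        unfolding absolutely_normal_def
      proof (intro allI impI)
        fix b :: int assume "2 \<le> b"
        then show "normal_to_base b x" using elim[rule_format, of "nat b"] by simp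
      qed
    qed
    with assms(4) show False by (simp add: pointwise_absolutely_normal_def)
  qed
  then obtain b :: nat where b: "2 \<le> b" "\<not> (AE x in \<nu>. normal_to_base (int b) x)" by blast
  \<comment> \<open>There are only countably many frequencies, so failure of normality shows up at a
    single fixed \<open>k\<close>.\<close>
  have "\<exists>k::int. k \<noteq> 0 \<and> \<not> (AE x in \<nu>. (\<lambda>N. norm (\<Sum>n<N. echar (of_int k * real b ^ n * x)) / real N) \<longlonglongrightarrow> 0)"
  proof (rule ccontr)
    assume "\<not> ?thesis"
    then have "AE x in \<nu>. \<forall>k::int. k \<noteq> 0 \<longrightarrow> (\<lambda>N. norm (\<Sum>n<N. echar (of_int k * real b ^ n * x)) / real N) \<longlonglongrightarrow> 0"
      by (subst AE_all_countable) auto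
    then have "AE x in \<nu>. normal_to_base (int b) x"
      by eventually_elim (intro normal_to_base_if_weyl b(1), blast)
    with b(2) show False by contradiction
  qed
  then obtain k :: int where k: "k \<noteq> 0"
    "\<not> (AE x in \<nu>. (\<lambda>N. norm (\<Sum>n<N. echar (of_int k * real b ^ n * x)) / real N) \<longlonglongrightarrow> 0)" by blast
  interpret contracting_ifs_base P s t r0 r T b by unfold_locales (rule b)
  have not: "\<not> (AE \<omega> in contr.S P. (\<lambda>N. norm (\<Sum>n<N. echar (of_int k * real b ^ n * contr.code \<omega>)) / real N) \<longlonglongrightarrow> 0)"
  proof
    assume *: "AE \<omega> in contr.S P. (\<lambda>N. norm (\<Sum>n<N. echar (of_int k * real b ^ n * contr.code \<omega>)) / real N) \<longlonglongrightarrow> 0"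
    have "{x \<in> space borel. (\<lambda>N. norm (\<Sum>n<N. echar (of_int k * real b ^ n * x)) / real N) \<longlonglongrightarrow> 0} \<in> sets borel"
      by measurable
    then have "AE x in distr (contr.S P) borel contr.code. (\<lambda>N. norm (\<Sum>n<N. echar (of_int k * real b ^ n * x)) / real N) \<longlonglongrightarrow> 0"
      using * by (subst AE_distr_iff) simp_all
    then have "AE x in \<nu>. (\<lambda>N. norm (\<Sum>n<N. echar (of_int k * real b ^ n * x)) / real N) \<longlonglongrightarrow> 0"
      by (subst \<nu>_law)
    with k(2) show False by contradiction
  qed
  have na: "emeasure (distr (contr.S P) borel contr.code) {x} = 0" for x
    using assms(3) \<nu>_law by (simp add: non_atomic_def)
  have "(\<forall>i\<in>set_pmf P. L [i] \<in> \<rat>) \<and>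
    (\<forall>i\<in>set_pmf P. \<forall>j\<in>set_pmf P. \<exists>\<rho>\<in>\<rat>. 0 < \<rho> \<and> of_int k * (contr.trans [i, j] - contr.trans [j, i]) * b powr \<rho> \<in> \<int>)"
    by (rule dichotomy) (use na k(1) not setP in auto)
  then have rat: "\<And>i. i \<in> {1..l} \<Longrightarrow> L [i] \<in> \<rat>"
    and integral: "\<And>i. i \<in> {1..l} \<Longrightarrow> \<exists>\<rho>\<in>\<rat>. 0 < \<rho> \<and> of_int k * (contr.trans [i, i1] - contr.trans [i1, i]) * b powr \<rho> \<in> \<int>"
    using i1 by (auto simp: setP)
  \<comment> \<open>The fixed point of \<open>f i1\<close>, which becomes the new origin.\<close>
  define \<beta> where "\<beta> = t i1 / (1 - s i1)"
  \<comment> \<open>With this unit of length the translation part of each conjugated map is exactly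
    \<open>k\<close> times the difference of the translation parts of the words
    \<open>[i, i1]\<close> and \<open>[i1, i]\<close>.\<close>
  define \<alpha> where "\<alpha> = 1 / (of_int k * (1 - s i1))"
  have s1: "1 - s i1 \<noteq> 0" using s(2)[of i1] by auto
  have \<alpha>: "\<alpha> \<noteq> 0" using s1 k(1) by (simp add: \<alpha>_def)
  define g where "g x = \<alpha> * x + \<beta>" for x
  have inv_g: "inv g = (\<lambda>y. (y - \<beta>) / \<alpha>)"
    by (rule inv_equality) (use \<alpha> in \<open>auto simp: g_def field_simps\<close>)
  show ?thesis
  proof (intro exI[of _ g] conjI exI[of _ "int b"] ballI)
    show "\<exists>\<alpha> \<beta>. \<alpha> \<noteq> 0 \<and> g = (\<lambda>x. \<alpha> * x + \<beta>)" using \<alpha> g_def by blast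
    show "1 < int b" using b(1) by simp
    fix i assume i: "i \<in> {1..l}"
    from integral[OF i] obtain \<rho> m where \<rho>: "\<rho> \<in> \<rat>" "0 < \<rho>"
      and m: "of_int k * (contr.trans [i, i1] - contr.trans [i1, i]) * b powr \<rho> = of_int m"
      by (auto elim: Ints_cases)
    let ?t = "(s i * \<beta> + t i - \<beta>) / \<alpha>"
    have "?t = of_int k * (contr.trans [i, i1] - contr.trans [i1, i])"
    proof -
      have "?t = of_int k * ((s i - 1) * (\<beta> * (1 - s i1)) + t i * (1 - s i1))"
        by (simp add: \<alpha>_def algebra_simps)
      also have "\<beta> * (1 - s i1) = t i1" using s1 by (simp add: \<beta>_def)
      finally show ?thesis by (simp add: algebra_simps)
    qed
    moreover have "b powr \<rho> \<noteq> 0" using b(1) by simp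
    ultimately have "?t = of_int m / b powr \<rho>"
      using m by (metis nonzero_eq_divide_eq)
    moreover have "inv g \<circ> f i \<circ> g = (\<lambda>x. s i * x + ?t)"
      using \<alpha> by (auto simp: inv_g f[OF i] g_def fun_eq_iff field_simps)
    moreover have "ln \<bar>s i\<bar> / ln (real b) = - L [i]" by (simp add: L_def log_def)
    then have "ln \<bar>s i\<bar> / ln (real_of_int (int b)) \<in> \<rat>" using rat[OF i] by simp
    ultimately show "\<exists>s t. inv g \<circ> f i \<circ> g = (\<lambda>x. s * x + t) \<and> ln \<bar>s\<bar> / ln (real_of_int (int b)) \<in> \<rat> \<and>
         (\<exists>(k :: int) (q :: real). q \<in> \<rat> \<and> q > 0 \<and> t = real_of_int k / real_of_int (int b) powr q)"
      using \<rho> by auto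
  qed
qed

end
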